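(* Let $\rho:\Gamma\to GL_2(\mathbb{C})$ be an irreducible representation with $\rho(T)=\mathrm{diag}(e^{2\pi i r_1},e^{2\pi i r_2})$, $0\le r_j<1$ real, let $\upsilon$ be a multiplier system for $\Gamma$, and let $\{\lambda_1,\lambda_2\}$ be the minimal admissible set of $(\rho,\upsilon)$. Then $$\mathcal{H}(\rho,\upsilon)=\bigoplus_{k\geq0}\mathcal{H}(k_0+2k,\rho,\upsilon)=\mathcal{R}F_0$$ is cyclic as an $\mathcal{R}$-module (with generator $F_0\in\mathcal{H}(k_0,\rho,\upsilon)$), where $k_0=6(\lambda_1+\lambda_2)-1$ is the minimal weight, and the components of $F_0$ form a fundamental system of solutions of a second order MMDE in weight $k_0$.
   Context: $\Gamma=SL_2(\mathbb{Z})$, $T=\begin{pmatrix}1&1\\0&1\end{pmatrix}$, $\mathbb{H}$ is the upper half-plane, $q=e^{2\pi iz}$, $q^\lambda=e^{2\pi i\lambda z}$. For $k\in\mathbb{R}$, a multiplier system in weight $k$ is a function $\upsilon:\Gamma\to\{z\in\mathbb{C}:|z|=1\}$ such that $f|_k^\upsilon\gamma(z)=\upsilon(\gamma)^{-1}(cz+d)^{-k}f\left(\frac{az+b}{cz+d}\right)$, $\gamma=\begin{pmatrix}a&b\\c&d\end{pmatrix}\in\Gamma$, defines a right action of $\Gamma$ on the holomorphic functions on $\mathbb{H}$ (real powers are taken with a fixed branch of the argument, e.g. $-\pi<\arg\le\pi$); it is then a multiplier system exactly in the weights congruent to $k$ mod $\mathbb{Z}$. The cusp parameter of $\upsilon$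 is the unique $0\le m<12$ with $\upsilon(T)=e^{2\pi im/12}$. Vector-valued modular forms: for $\rho:\Gamma\to GL_d(\mathbb{C})$, $\mathcal{H}(k,\rho,\upsilon)$ is the space of $F=(f_1,\dots,f_d)^t:\mathbb{H}\to\mathbb{C}^d$ with each $f_j$ holomorphic and of moderate growth at infinity (there is an integer $N\ge0$ with $|f_j(x+iy)|<y^N$ for any fixed $x$ and $y\gg0$) and $F|_k^\upsilon\gamma=\rho(\gamma)F$ for all $\gamma\in\Gamma$ (slash action componentwise). $\mathcal{H}(\rho,\upsilon)$ is the graded space which is the direct sum of the $\mathcal{H}(k,\rho,\upsilon)$ over all weights $k$ of $\upsilon$. When $\rho(-I)$ is scalar (in particular for irreducible $\rho$), $\mathcal{H}(\rho,\upsilon)=\bigoplus_{k\ge0}\mathcal{H}(k_0+2k,\rho,\upsilon)$, where $k_0$, the minimal weight, is the least weight $k$ with $\mathcal{H}(k,\rho,\upsilon)\ne0$. Minimal admissible set: if $\rho(T)=\mathrm{diag}(e^{2\pi i r_1},\dots,e^{2\pi i r_d})$, $0\le r_j<1$, the minimal admissible set of $(\rho,\upsilon)$ is $\{\lambda_1,\dots,\lambda_d\}$, where $0\le\lambda_j<1$ and $\lambda_j\equiv r_j+\frac{m}{12}\pmod{\mathbb{Z}}$. Differential structure: $\mathcal{M}=\bigoplus_{k\ge0}\mathcal{M}_{2k}=\mathbb{C}[E_4,E_6]$ is the graded ring of holomorphic modular forms for $\Gamma$; $E_2=1-24\sum_{n\ge1}\left(\sum_{d\mid n}d\right)q^n$;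 $D_k=q\frac{d}{dq}-\frac{k}{12}E_2$ maps $\mathcal{H}(k,\rho,\upsilon)$ to $\mathcal{H}(k+2,\rho,\upsilon)$; $D$ is the operator acting as $D_k$ in weight $k$, and $D_k^n=D_{k+2(n-1)}\circ\cdots\circ D_{k+2}\circ D_k$. $\mathcal{R}=\{f_0+f_1d+\cdots+f_nd^n: f_j\in\mathcal{M},n\ge0\}$ is the skew polynomial ring with multiplication $df=fd+Df$; it acts on $\mathcal{H}(\rho,\upsilon)$ with $\mathcal{M}$ acting by multiplication and $d$ acting as $D$. MMDE: a $d$-th order monic modular differential equation in weight $k$ is $D_k^df+M_4D_k^{d-2}f+\cdots+M_{2(d-1)}D_kf+M_{2d}f=0$ with $M_j\in\mathcal{M}_j$. A fundamental system of solutions is a basis of its solution space (viewed as holomorphic functions on $\mathbb{H}$) consisting of functions of the form $q^{\lambda}\sum_{n\ge0}a(n)q^n$.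
   Formalization: Moderate growth is taken with the threshold "y≫0" uniform for x in bounded sets; with a threshold depending on each fixed x, forms such as h(j)F_0/Δ^m with suitable entire h would exist in arbitrarily negative weights and no minimal weight would exist. *)

theory Defs
  imports "HOL-Analysis.Analysis" "HOL-Library.Function_Algebras" "HOL-Algebra.Ring"
begin

section \<open>The modular group and its representations\<close>

definition SL2Z :: "(int^2^2) monoid" where
  "SL2Z = \<lparr>carrier = {A. det A = 1}, mult = (**), one = mat 1\<rparr>"

definition matT :: "int^2^2" where
  "matT = vector [vector [1, 1], vector [0, 1]]"

definition GLC :: "(complex^'d^'d::finite) monoid" where
  "GLC = \<lparr>carrier = {A. invertible A}, mult = (**), one = mat 1\<rparr>"

definition irreducible_rep :: "(int^2^2 \<Rightarrow> complex^'d^'d::finite) \<Rightarrow> bool" where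
  "irreducible_rep \<rho> \<longleftrightarrow> \<rho> \<in> hom SL2Z GLC \<and>
     (\<forall>V. vec.subspace V \<and> (\<forall>\<gamma>\<in>carrier SL2Z. \<forall>v\<in>V. \<rho> \<gamma> *v v \<in> V) \<longrightarrow> V = {0} \<or> V = UNIV)"

section \<open>Functions on the upper half-plane\<close>

text \<open>
  A function on the upper half-plane is represented by a function on the complex numbers.
  The members of all spaces of functions below vanish off the upper half-plane, so that
  equality of such functions is equality on the upper half-plane.
\<close>

definition UH :: "complex set" where
  "UH = {z. Im z > 0}"

definition qexp :: "real \<Rightarrow> complex \<Rightarrow> complex" where
  "qexp l z = exp (2 * of_real pi * \<i> * of_real l * z)"

definition mobius :: "int^2^2 \<Rightarrow> complex \<Rightarrow> complex" where
  "mobius \<gamma> z =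
     (of_int (\<gamma>$1$1) * z + of_int (\<gamma>$1$2)) / (of_int (\<gamma>$2$1) * z + of_int (\<gamma>$2$2))"

definition autf :: "int^2^2 \<Rightarrow> complex \<Rightarrow> complex" where
  "autf \<gamma> z = of_int (\<gamma>$2$1) * z + of_int (\<gamma>$2$2)"

text \<open>Complex \<open>powr\<close> uses the branch of the argument with values in \<open>(-pi, pi]\<close>.\<close>

definition slash :: "real \<Rightarrow> (int^2^2 \<Rightarrow> complex) \<Rightarrow> int^2^2 \<Rightarrow> (complex \<Rightarrow> complex) \<Rightarrow> complex \<Rightarrow> complex" where
  "slash k \<upsilon> \<gamma> f z = inverse (\<upsilon> \<gamma>) * autf \<gamma> z powr (- of_real k) * f (mobius \<gamma> z)"

definition multiplier_system :: "real \<Rightarrow> (int^2^2 \<Rightarrow> complex) \<Rightarrow> bool" where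
  "multiplier_system k \<upsilon> \<longleftrightarrow>
     (\<forall>\<gamma>\<in>carrier SL2Z. cmod (\<upsilon> \<gamma>) = 1) \<and>
     (\<forall>f. f holomorphic_on UH \<longrightarrow>
        (\<forall>z\<in>UH. slash k \<upsilon> (mat 1) f z = f z) \<and>
        (\<forall>\<gamma>\<in>carrier SL2Z. \<forall>\<delta>\<in>carrier SL2Z. \<forall>z\<in>UH.
           slash k \<upsilon> \<delta> (slash k \<upsilon> \<gamma> f) z = slash k \<upsilon> (\<gamma> ** \<delta>) f z))"

definition multiplier_weights :: "(int^2^2 \<Rightarrow> complex) \<Rightarrow> real set" where
  "multiplier_weights \<upsilon> = {k. multiplier_system k \<upsilon>}"

definition cusp_parameter :: "(int^2^2 \<Rightarrow> complex) \<Rightarrow> real \<Rightarrow> bool" where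
  "cusp_parameter \<upsilon> m \<longleftrightarrow> 0 \<le> m \<and> m < 12 \<and> \<upsilon> matT = exp (2 * of_real pi * \<i> * of_real m / 12)"

definition rep_exponents :: "(int^2^2 \<Rightarrow> complex^'d^'d::finite) \<Rightarrow> ('d \<Rightarrow> real) \<Rightarrow> bool" where
  "rep_exponents \<rho> r \<longleftrightarrow> (\<forall>j. 0 \<le> r j \<and> r j < 1) \<and>
     \<rho> matT = (\<chi> i j. if i = j then exp (2 * of_real pi * \<i> * of_real (r i)) else 0)"

definition minimal_admissible ::
    "(int^2^2 \<Rightarrow> complex) \<Rightarrow> ('d \<Rightarrow> real) \<Rightarrow> ('d \<Rightarrow> real) \<Rightarrow> bool" where
  "minimal_admissible \<upsilon> r l \<longleftrightarrow>
     (\<exists>m. cusp_parameter \<upsilon> m \<and> (\<forall>j. 0 \<le> l j \<and> l j < 1 \<and> l j - (r j + m / 12) \<in> \<int>))"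

section \<open>Vector-valued modular forms\<close>

text \<open>
  In the growth condition the bound on \<open>y\<close> is uniform for \<open>x\<close> in bounded sets. A bound
  depending on each single \<open>x\<close> without any uniformity would not give meromorphy at infinity:
  there are nonconstant entire functions \<open>h\<close> that are small along every ray, even along every
  curve at bounded distance from a ray, and then \<open>h(j(z))\<close>, with \<open>j\<close> the elliptic modular
  invariant, would be of moderate growth.
\<close>

definition moderate_growth :: "(complex \<Rightarrow> complex) \<Rightarrow> bool" where
  "moderate_growth f \<longleftrightarrow>
     (\<exists>N::nat. \<forall>X::real. \<forall>\<^sub>F y in at_top. \<forall>x::real. \<bar>x\<bar> \<le> X \<longrightarrow> cmod (f (Complex x y)) < y ^ N)"

definition vvmf ::
    "real \<Rightarrow> (int^2^2 \<Rightarrow> complex^'d^'d::finite) \<Rightarrow> (int^2^2 \<Rightarrow> complex) \<Rightarrow> (complex \<Rightarrow> complex^'d) set" where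
  "vvmf k \<rho> \<upsilon> = {F.
     (\<forall>z. z \<notin> UH \<longrightarrow> F z = 0) \<and>
     (\<forall>j. (\<lambda>z. F z $ j) holomorphic_on UH \<and> moderate_growth (\<lambda>z. F z $ j)) \<and>
     (\<forall>\<gamma>\<in>carrier SL2Z. \<forall>z\<in>UH. (\<chi> j. slash k \<upsilon> \<gamma> (\<lambda>w. F w $ j) z) = \<rho> \<gamma> *v F z)}"

text \<open>
  The external direct sum of the spaces \<open>vvmf k \<rho> \<upsilon>\<close> over \<open>k \<in> W\<close>: finitely supported families
  indexed by the weight.
\<close>

definition vvmf_sum ::
    "real set \<Rightarrow> (int^2^2 \<Rightarrow> complex^'d^'d::finite) \<Rightarrow> (int^2^2 \<Rightarrow> complex) \<Rightarrow>
     (real \<Rightarrow> complex \<Rightarrow> complex^'d) set" where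
  "vvmf_sum W \<rho> \<upsilon> = {F. finite {k. F k \<noteq> 0} \<and> (\<forall>k\<in>W. F k \<in> vvmf k \<rho> \<upsilon>) \<and> (\<forall>k. k \<notin> W \<longrightarrow> F k = 0)}"

definition vvmf_graded ::
    "(int^2^2 \<Rightarrow> complex^'d^'d::finite) \<Rightarrow> (int^2^2 \<Rightarrow> complex) \<Rightarrow>
     (real \<Rightarrow> complex \<Rightarrow> complex^'d) set" where
  "vvmf_graded \<rho> \<upsilon> = vvmf_sum (multiplier_weights \<upsilon>) \<rho> \<upsilon>"

definition in_weight :: "real \<Rightarrow> (complex \<Rightarrow> complex^'d) \<Rightarrow> real \<Rightarrow> complex \<Rightarrow> complex^'d" where
  "in_weight k F = (\<lambda>w. if w = k then F else 0)"

definition minimal_weight ::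
    "(int^2^2 \<Rightarrow> complex^'d^'d::finite) \<Rightarrow> (int^2^2 \<Rightarrow> complex) \<Rightarrow> real \<Rightarrow> bool" where
  "minimal_weight \<rho> \<upsilon> k0 \<longleftrightarrow> k0 \<in> multiplier_weights \<upsilon> \<and> vvmf k0 \<rho> \<upsilon> \<noteq> {0} \<and>
     (\<forall>k\<in>multiplier_weights \<upsilon>. vvmf k \<rho> \<upsilon> \<noteq> {0} \<longrightarrow> k0 \<le> k)"

section \<open>The modular derivative\<close>

definition E2 :: "complex \<Rightarrow> complex" where
  "E2 z = 1 - 24 * (\<Sum>n. of_nat (\<Sum>d | d dvd Suc n. d) * qexp 1 z ^ Suc n)"

text \<open>\<open>q d/dq = (1 / (2 pi i)) d/dz\<close>.\<close>

definition modD :: "real \<Rightarrow> (complex \<Rightarrow> complex) \<Rightarrow> complex \<Rightarrow> complex" where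
  "modD k f = (\<lambda>z. if z \<in> UH
     then deriv f z / (2 * of_real pi * \<i>) - of_real k / 12 * E2 z * f z else 0)"

primrec modD_pow :: "real \<Rightarrow> nat \<Rightarrow> (complex \<Rightarrow> complex) \<Rightarrow> complex \<Rightarrow> complex" where
  "modD_pow k 0 f = f"
| "modD_pow k (Suc n) f = modD (k + 2 * real n) (modD_pow k n f)"

definition modD_vec :: "real \<Rightarrow> (complex \<Rightarrow> complex^'d) \<Rightarrow> complex \<Rightarrow> complex^'d::finite" where
  "modD_vec k F = (\<lambda>z. \<chi> j. modD k (\<lambda>w. F w $ j) z)"

definition Dgr :: "(real \<Rightarrow> complex \<Rightarrow> complex^'d) \<Rightarrow> real \<Rightarrow> complex \<Rightarrow> complex^'d::finite" where
  "Dgr F = (\<lambda>w. modD_vec (w - 2) (F (w - 2)))"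

section \<open>The graded ring of holomorphic modular forms\<close>

definition modular_forms :: "nat \<Rightarrow> (complex \<Rightarrow> complex) set" where
  "modular_forms w = {f.
     (\<forall>z. z \<notin> UH \<longrightarrow> f z = 0) \<and> f holomorphic_on UH \<and>
     (\<forall>\<gamma>\<in>carrier SL2Z. \<forall>z\<in>UH. f (mobius \<gamma> z) = autf \<gamma> z ^ w * f z) \<and>
     (\<exists>B Y. \<forall>z. Im z \<ge> Y \<longrightarrow> cmod (f z) \<le> B)}"

text \<open>
  The direct sum of the spaces \<open>modular_forms (2 * k)\<close>. The component of \<open>f\<close> with index \<open>k\<close>
  has weight \<open>2 * k\<close>.
\<close>

definition MF :: "(nat \<Rightarrow> complex \<Rightarrow> complex) set" where
  "MF = {f. finite {k. f k \<noteq> 0} \<and> (\<forall>k. f k \<in> modular_forms (2 * k))}"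

definition MF_one :: "nat \<Rightarrow> complex \<Rightarrow> complex" where
  "MF_one = (\<lambda>k z. if k = 0 \<and> z \<in> UH then 1 else 0)"

definition MF_mult ::
    "(nat \<Rightarrow> complex \<Rightarrow> complex) \<Rightarrow> (nat \<Rightarrow> complex \<Rightarrow> complex) \<Rightarrow> nat \<Rightarrow> complex \<Rightarrow> complex" where
  "MF_mult f g = (\<lambda>k z. \<Sum>i\<le>k. f i z * g (k - i) z)"

definition MF_D :: "(nat \<Rightarrow> complex \<Rightarrow> complex) \<Rightarrow> nat \<Rightarrow> complex \<Rightarrow> complex" where
  "MF_D f = (\<lambda>k. case k of 0 \<Rightarrow> 0 | Suc i \<Rightarrow> modD (2 * real i) (f i))"

definition MF_act ::
    "(nat \<Rightarrow> complex \<Rightarrow> complex) \<Rightarrow> (real \<Rightarrow> complex \<Rightarrow> complex^'d) \<Rightarrow> real \<Rightarrow> complex \<Rightarrow> complex^'d" where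
  "MF_act f F = (\<lambda>w z. \<Sum>k | f k \<noteq> 0. f k z *s F (w - 2 * real k) z)"

section \<open>The skew polynomial ring and its action\<close>

text \<open>
  \<open>f_0 + f_1 d + ... + f_n d^n\<close> is represented by the finitely supported sequence of its
  coefficients in \<open>MF\<close>. Left multiplication by \<open>d\<close> is
  \<open>d (\<Sum> f_i d^i) = \<Sum> (f_i d^(i+1) + (D f_i) d^i)\<close>, as dictated by \<open>d f = f d + D f\<close>.
\<close>

type_synonym skew = "nat \<Rightarrow> nat \<Rightarrow> complex \<Rightarrow> complex"

definition skew_dmult :: "skew \<Rightarrow> skew" where
  "skew_dmult s = (\<lambda>j. (case j of 0 \<Rightarrow> 0 | Suc i \<Rightarrow> s i) + MF_D (s j))"

definition skew_mult :: "skew \<Rightarrow> skew \<Rightarrow> skew" where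
  "skew_mult r s = (\<lambda>j. \<Sum>n | r n \<noteq> 0. MF_mult (r n) ((skew_dmult ^^ n) s j))"

definition skew_const :: "(nat \<Rightarrow> complex \<Rightarrow> complex) \<Rightarrow> skew" where
  "skew_const f = (\<lambda>n. if n = 0 then f else 0)"

definition skew_d :: skew where
  "skew_d = (\<lambda>n. if n = 1 then MF_one else 0)"

definition skew_ring :: "skew ring" where
  "skew_ring = \<lparr>carrier = {r. finite {n. r n \<noteq> 0} \<and> (\<forall>n. r n \<in> MF)},
     mult = skew_mult, one = skew_const MF_one, zero = 0, add = (+)\<rparr>"

definition skew_act :: "skew \<Rightarrow> (real \<Rightarrow> complex \<Rightarrow> complex^'d) \<Rightarrow> real \<Rightarrow> complex \<Rightarrow> complex^'d::finite" where
  "skew_act r F = (\<lambda>w z. \<Sum>n | r n \<noteq> 0. MF_act (r n) ((Dgr ^^ n) F) w z)"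

definition skew_orbit :: "(real \<Rightarrow> complex \<Rightarrow> complex^'d::finite) \<Rightarrow> (real \<Rightarrow> complex \<Rightarrow> complex^'d) set" where
  "skew_orbit F = (\<lambda>r. skew_act r F) ` carrier skew_ring"

lemma MF_one_mult:
  assumes "\<And>k z. z \<notin> UH \<Longrightarrow> f k z = 0"
  shows "MF_mult MF_one f = f"
proof (intro ext)
  fix k z
  have "(\<Sum>i\<le>k. MF_one i z * f (k - i) z) = (\<Sum>i\<in>{0}. MF_one i z * f (k - i) z)"
    by (rule sum.mono_neutral_right) (auto simp: MF_one_def)
  then show "MF_mult MF_one f k z = f k z"
    using assms[of z k] by (auto simp: MF_mult_def MF_one_def)
qed

lemma skew_commutation:
  assumes "f \<in> MF"
  shows "skew_d \<otimes>\<^bsub>skew_ring\<^esub> skew_const f =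
    (skew_const f \<otimes>\<^bsub>skew_ring\<^esub> skew_d) \<oplus>\<^bsub>skew_ring\<^esub> skew_const (MF_D f)"
proof -
  have f0: "f k z = 0" if "z \<notin> UH" for k z
    using assms that by (auto simp: MF_def modular_forms_def)
  have D0: "MF_D f k z = 0" if "z \<notin> UH" for k z
    using that by (auto simp: MF_D_def modD_def split: nat.splits)
  have D00: "MF_D 0 = 0"
    by (auto simp: MF_D_def modD_def fun_eq_iff zero_fun_def split: nat.splits)
  have mult0: "MF_mult g 0 = 0" for g
    by (auto simp: MF_mult_def fun_eq_iff)
  have multr: "MF_mult f MF_one = f"
  proof (intro ext)
    fix k z
    have "(\<Sum>i\<le>k. f i z * MF_one (k - i) z) = (\<Sum>i\<in>{k}. f i z * MF_one (k - i) z)"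
      by (rule sum.mono_neutral_right) (auto simp: MF_one_def)
    then show "MF_mult f MF_one k z = f k z"
      using f0[of z k] by (auto simp: MF_mult_def MF_one_def)
  qed
  have one_ne: "MF_one \<noteq> 0"
  proof
    assume "MF_one = 0"
    then have "MF_one 0 \<i> = 0" by simp
    then show False by (simp add: MF_one_def UH_def)
  qed
  have supp: "{n. skew_d n \<noteq> 0} = {1}"
    using one_ne by (auto simp: skew_d_def)
  have dm: "skew_dmult (skew_const f) = (\<lambda>j. if j = 0 then MF_D f else if j = 1 then f else 0)"
    by (rule ext) (auto simp: skew_dmult_def skew_const_def D00 split: nat.splits)
  have L: "skew_mult skew_d (skew_const f) = skew_dmult (skew_const f)"
    unfolding skew_mult_def supp
    by (rule ext) (simp add: skew_d_def dm MF_one_mult[OF f0] MF_one_mult[OF D0] mult0)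
  have "skew_mult (skew_const f) skew_d = (\<lambda>j. if j = 1 then f else 0)"
  proof (cases "f = 0")
    case True
    then have "{n. skew_const f n \<noteq> 0} = {}" by (auto simp: skew_const_def)
    then have "skew_mult (skew_const f) skew_d = (\<lambda>j. 0)"
      unfolding skew_mult_def by simp
    moreover have "(\<lambda>j. 0) = (\<lambda>j. if j = (1::nat) then f else 0)"
      using True by (intro ext) simp
    ultimately show ?thesis by (rule trans)
  next
    case False
    then have "{n. skew_const f n \<noteq> 0} = {0}" by (auto simp: skew_const_def)
    then have "skew_mult (skew_const f) skew_d = (\<lambda>j. MF_mult f (skew_d j))"
      unfolding skew_mult_def by (simp add: skew_const_def)
    then show ?thesis
      by (simp add: skew_d_def multr mult0 if_distrib[of "MF_mult f"] cong: if_cong)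
  qed
  then show ?thesis
    unfolding skew_ring_def monoid.simps ring.simps L dm
    by (intro ext) (simp add: skew_const_def)
qed

section \<open>Modular differential equations\<close>

global_interpretation cfun: vector_space "\<lambda>(c::complex) (f::complex \<Rightarrow> complex) z. c * f z"
  by unfold_locales (auto simp: algebra_simps)

text \<open>
  \<open>M j\<close> is the coefficient of weight \<open>2 * j\<close>, standing before the derivative of order \<open>d - j\<close>;
  the term with \<open>j = 1\<close> is absent.
\<close>

definition mmde_coeffs :: "nat \<Rightarrow> (nat \<Rightarrow> complex \<Rightarrow> complex) \<Rightarrow> bool" where
  "mmde_coeffs d M \<longleftrightarrow> (\<forall>j\<in>{2..d}. M j \<in> modular_forms (2 * j))"

definition mmde_solutions :: "real \<Rightarrow> nat \<Rightarrow> (nat \<Rightarrow> complex \<Rightarrow> complex) \<Rightarrow> (complex \<Rightarrow> complex) set" where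
  "mmde_solutions k d M = {f. (\<forall>z. z \<notin> UH \<longrightarrow> f z = 0) \<and> f holomorphic_on UH \<and>
     (\<forall>z\<in>UH. modD_pow k d f z + (\<Sum>j=2..d. M j z * modD_pow k (d - j) f z) = 0)}"

definition has_q_expansion :: "(complex \<Rightarrow> complex) \<Rightarrow> bool" where
  "has_q_expansion f \<longleftrightarrow>
     (\<exists>(l::real) (a::nat \<Rightarrow> complex). \<forall>z\<in>UH. summable (\<lambda>n. a n * qexp 1 z ^ n) \<and>
        f z = qexp l z * (\<Sum>n. a n * qexp 1 z ^ n))"

definition fundamental_system ::
    "real \<Rightarrow> nat \<Rightarrow> (nat \<Rightarrow> complex \<Rightarrow> complex) \<Rightarrow> ('i \<Rightarrow> complex \<Rightarrow> complex) \<Rightarrow> bool" where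
  "fundamental_system k d M f \<longleftrightarrow>
     inj f \<and> cfun.independent (range f) \<and> cfun.span (range f) = mmde_solutions k d M \<and>
     (\<forall>i. has_q_expansion (f i))"

end

theory Submission
  imports Defs "HOL-Complex_Analysis.Complex_Analysis" "HOL-Real_Asymp.Real_Asymp"
begin

text \<open>
  The equation \<open>D\<^sup>2 f + c E\<^sub>4 f = 0\<close> in weight \<open>k\<^sub>0 = 6 (\<lambda>\<^sub>1 + \<lambda>\<^sub>2) - 1\<close>, with \<open>c\<close> chosen such that
  the indicial roots at the cusp are \<open>\<lambda>\<^sub>1\<close> and \<open>\<lambda>\<^sub>2\<close>, has solutions \<open>f\<^sub>j = q\<^bsup>\<lambda>\<^sub>j\<^esup> (1 + \<dots>)\<close>. The
  Wronskian \<open>W\<close> of any two solutions satisfies a linear equation of order one, so the solution space is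
  two-dimensional and carries a representation of the modular group. Its value at \<open>T\<close> agrees with
  \<open>\<rho> T\<close>. A matrix for \<open>S\<close> which is not diagonal is determined by the eigenvalues of \<open>T\<close> up to conjugation
  by diagonal matrices; a diagonal one is impossible, because \<open>f\<^sub>1 f\<^sub>2 / W\<close> would then be a bounded form
  of weight \<open>-2\<close>. Hence \<open>F\<^sub>0 = (f\<^sub>1, f\<^sub>2)\<close> is a form for \<open>\<rho>\<close> after rescaling \<open>f\<^sub>1\<close>.

  Since \<open>W = det (F\<^sub>0, D F\<^sub>0)\<close> has no zero in the upper half-plane and vanishes at the cusp exactly to the order
  \<open>\<lambda>\<^sub>1 + \<lambda>\<^sub>2\<close>, Cramer's rule writes every form \<open>G\<close> of weight \<open>k\<close> as \<open>G = \<alpha> F\<^sub>0 + \<beta> D F\<^sub>0\<close>, where \<open>\<alpha>\<close> and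
  \<open>\<beta>\<close> are holomorphic modular forms of the weights \<open>k - k\<^sub>0\<close> and \<open>k - k\<^sub>0 - 2\<close>; these vanish in negative and
  in odd weights. The transformation law of \<open>E\<^sub>2\<close>, which makes \<open>D\<close> equivariant, comes from Eisenstein's
  conditionally convergent lattice sum, evaluated in both orders of summation.
\<close>

text \<open>The value of \<open>k0\<close> is forced. The Wronskian of two forms of weight k has
  weight 2k + 2, and having no zero in the upper half-plane and order l1 + l2 at the cusp requires
  (2k + 2) / 12 = l1 + l2. The equation leads to the same number: no nonzero holomorphic modular
  form of weight 2 exists, so there is no first-order term, and the constant term 1 of
  \<open>E2\<close> makes (k + 1) / 6 the sum of the indicial roots. The constant c then adjusts
  their product. Zeros are never counted. That W does not vanish follows from its first-order
  equation, and the remaining uses of a valence formula are replaced by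
  \<open>negative_weight_zero\<close>, which works with absolute values and so is indifferent to
  multipliers. A form for \<rho> is not taken from an existence theorem: the solutions are built
  first and their transformation under S is compared with \<rho> afterwards. Irreducibility enters
  through the off-diagonal entries of \<open>\<rho> matS\<close> and the distinct eigenvalues of
  \<open>\<rho> matT\<close>. The latter give l1 and l2 distinct; as both lie in [0,1), their
  difference is not an integer and no logarithm can occur.\<close>

no_notation fps_nth (infixl \<open>$\<close> 75)

section \<open>Partial fractions of the cotangent\<close>

text \<open>This is the logarithmic derivative of the reflection formula for
  \<open>Gamma\<close>.\<close>

lemma Digamma_reflection:
  fixes w :: complex
  assumes "w \<notin> \<int>"
  shows "Digamma (1 - w) - Digamma w = pi * cot (pi * w)"
proof -
  have n1: "w \<notin> \<int>\<^sub>\<le>\<^sub>0" and n2: "1 - w \<notin> \<int>\<^sub>\<le>\<^sub>0"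
    using assms by (auto dest!: nonpos_Ints_Int)
  have s: "sin (of_real pi * w) \<noteq> 0"
  proof
    assume "sin (of_real pi * w) = 0"
    then obtain n :: int where "of_real pi * w = of_real (real_of_int n * pi)"
      by (auto simp: sin_eq_0)
    hence "w = of_int n" by (simp add: field_simps)
    with assms show False by auto
  qed
  have g: "Gamma w \<noteq> 0" "Gamma (1 - w) \<noteq> 0" using n1 n2 by (auto simp: Gamma_eq_zero_iff)
  have "((\<lambda>z. Gamma z * Gamma (1 - z)) has_field_derivative
      Gamma w * Gamma (1 - w) * (Digamma w - Digamma (1 - w))) (at w)"
    using n1 n2 by (auto intro!: derivative_eq_intros simp: algebra_simps)
  moreover have "((\<lambda>z. of_real pi / sin (of_real pi * z)) has_field_derivative
      - (of_real pi / sin (of_real pi * w)) * (of_real pi * cot (of_real pi * w))) (at w)"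
    using s by (auto intro!: derivative_eq_intros simp: cot_def field_simps power2_eq_square)
  ultimately have "Gamma w * Gamma (1 - w) * (Digamma w - Digamma (1 - w)) =
     - (of_real pi / sin (of_real pi * w)) * (of_real pi * cot (of_real pi * w))"
    unfolding Gamma_reflection_complex by (rule DERIV_unique)
  hence "Gamma w * Gamma (1 - w) * (Digamma w - Digamma (1 - w)) =
     Gamma w * Gamma (1 - w) * - (of_real pi * cot (of_real pi * w))"
    unfolding Gamma_reflection_complex by simp
  hence "(Digamma w - Digamma (1 - w)) = - (of_real pi * cot (of_real pi * w))"
    using g by (metis mult_cancel_left mult_eq_0_iff)
  thus ?thesis by (simp add: algebra_simps)
qed

text \<open>The window is half open so that the map n to -1-n exchanges its two halves. They have
  equal length and match the series of \<open>Digamma\<close> at w and at 1 - w.\<close>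

lemma sum_symmetric_int:
  fixes f :: "int \<Rightarrow> 'a :: comm_monoid_add"
  shows "(\<Sum>n\<in>{-int N..<int N}. f n) = (\<Sum>n<N. f (int n)) + (\<Sum>n<N. f (- 1 - int n))"
proof (induction N)
  case (Suc N)
  have "{-int (Suc N)..<int (Suc N)} = insert (int N) (insert (-1 - int N) {-int N..<int N})" by auto
  thus ?case by (simp add: Suc add_ac)
qed auto

lemma cot_partial_fractions:
  fixes w :: complex
  assumes "w \<notin> \<int>"
  shows "(\<lambda>N. \<Sum>n\<in>{-int N..<int N}. 1 / (w + of_int n)) \<longlonglongrightarrow> pi * cot (pi * w)"
proof -
  have "w \<noteq> 0" "1 - w \<noteq> 0" using assms by auto
  from tendsto_diff[OF Digamma_LIMSEQ[OF this(2)] Digamma_LIMSEQ[OF this(1)]]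
  have "(\<lambda>m. (\<Sum>n<m. inverse (w + of_nat n)) - (\<Sum>n<m. inverse (1 - w + of_nat n))) \<longlonglongrightarrow> pi * cot (pi * w)"
    by (simp add: Digamma_reflection[OF assms])
  moreover have "(\<Sum>n<m. inverse (w + of_nat n)) - (\<Sum>n<m. inverse (1 - w + of_nat n)) =
     (\<Sum>n\<in>{-int m..<int m}. 1 / (w + of_int n))" for m
    unfolding sum_symmetric_int sum_negf[symmetric] diff_conv_add_uminus
    by (intro arg_cong2[of _ _ _ _ "(+)"] sum.cong refl)
       (simp_all add: inverse_eq_divide, subst minus_divide_right, simp add: algebra_simps)
  ultimately show ?thesis by simp
qed

section \<open>Unordered sums over the integers\<close>

lemma has_sum_int_symmetric:
  fixes f :: "int \<Rightarrow> 'a :: {topological_comm_monoid_add}"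
  assumes "(f has_sum s) UNIV"
  shows "(\<lambda>N. \<Sum>n\<in>{-int N..<int N}. f n) \<longlonglongrightarrow> s"
proof -
  have "filterlim (\<lambda>N. {-int N..<int N}) (finite_subsets_at_top UNIV) sequentially"
    unfolding filterlim_finite_subsets_at_top
  proof safe
    fix X :: "int set" assume X: "finite X"
    define K where "K = Max (insert 0 ((\<lambda>x. nat \<bar>x\<bar> + 1) ` X))"
    have "nat \<bar>x\<bar> + 1 \<le> K" if "x \<in> X" for x
      unfolding K_def using X that by (intro Max_ge) auto
    hence "X \<subseteq> {-int N..<int N}" if "N \<ge> K" for N using that by fastforce
    thus "\<forall>\<^sub>F x in sequentially. finite {- int x..<int x} \<and> X \<subseteq> {- int x..<int x} \<and> {- int x..<int x} \<subseteq> UNIV"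
      unfolding eventually_sequentially by auto
  qed
  with assms show ?thesis unfolding has_sum_def by (rule filterlim_compose)
qed

lemma has_sum_nonzero_int_symmetric:
  fixes f :: "int \<Rightarrow> 'a :: {topological_comm_monoid_add}"
  assumes "(f has_sum s) (- {0})"
  shows "(\<lambda>N. \<Sum>n\<in>{-int N..<int N} - {0}. f n) \<longlonglongrightarrow> s"
proof -
  have "((\<lambda>n. if n = 0 then 0 else f n) has_sum s) UNIV"
    using assms by (subst has_sum_cong_neutral[where T = "- {0}" and g = f]) auto
  from has_sum_int_symmetric[OF this]
  show ?thesis
    by (simp add: sum.If_cases if_distrib Int_def set_diff_eq conj_commute)
qed

lemma summable_on_int_powr:
  assumes "(p::real) > 1"
  shows "(\<lambda>n::int. (1 + \<bar>of_int n\<bar>) powr - p) summable_on UNIV"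
proof -
  have "summable (\<lambda>n. real (Suc n) powr - p)"
    using assms by (subst summable_Suc_iff) (simp add: summable_real_powr_iff)
  hence *: "(\<lambda>n::nat. real (Suc n) powr - p) summable_on UNIV"
    by (intro summable_nonneg_imp_summable_on) auto
  have "(\<lambda>n::int. (1 + \<bar>of_int n\<bar>) powr - p) summable_on range int"
    by (subst summable_on_reindex) (use * in \<open>auto simp: o_def inj_on_def add_ac\<close>)
  moreover have "(\<lambda>n::int. (1 + \<bar>of_int n\<bar>) powr - p) summable_on range (\<lambda>n. - int n)"
    by (subst summable_on_reindex) (use * in \<open>auto simp: o_def inj_on_def add_ac\<close>)
  moreover have "range int \<union> range (\<lambda>n. - int n) = UNIV"
  proof -
    have "x \<in> range int \<union> range (\<lambda>n. - int n)" for x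
      by (cases x rule: int_cases2) auto
    thus ?thesis by auto
  qed
  ultimately show ?thesis using summable_on_union by metis
qed

lemma summable_on_int_square_bound:
  fixes f :: "int \<Rightarrow> 'a :: banach"
  assumes "\<And>n. n \<in> A \<Longrightarrow> norm (f n) \<le> C / (1 + \<bar>of_int n\<bar>)\<^sup>2"
  shows "f summable_on A"
proof -
  have "(\<lambda>n::int. C * (1 + \<bar>of_int n\<bar>) powr - 2) summable_on UNIV"
    by (intro summable_on_cmult_right summable_on_int_powr) auto
  hence "(\<lambda>n::int. C * (1 + \<bar>of_int n\<bar>) powr - 2) summable_on A"
    by (rule summable_on_subset_banach) auto
  hence "(\<lambda>n. norm (f n)) summable_on A"
    by (rule summable_on_comparison_test) (use assms in \<open>auto simp: powr_minus divide_inverse\<close>)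
  thus ?thesis by (rule abs_summable_summable)
qed

text \<open>The imaginary part controls x, and then the triangle inequality controls y.\<close>

lemma lattice_norm_bound:
  fixes z :: complex
  assumes "Im z \<noteq> 0"
  shows "\<exists>c>0. \<forall>x y. c * (\<bar>x\<bar> + \<bar>y\<bar>) \<le> norm (of_real x * z + of_real y)"
proof -
  define K where "K = 1 / \<bar>Im z\<bar> + 1 + norm z / \<bar>Im z\<bar>"
  have K: "K > 0" unfolding K_def using assms by (intro add_pos_nonneg) auto
  have "1 / K * (\<bar>x\<bar> + \<bar>y\<bar>) \<le> norm (of_real x * z + of_real y)" for x y
  proof -
  let ?N = "norm (of_real x * z + of_real y)"
  have "\<bar>x\<bar> * \<bar>Im z\<bar> \<le> ?N"
    using abs_Im_le_cmod[of "of_real x * z + of_real y"] by (simp add: abs_mult)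
  hence x: "\<bar>x\<bar> \<le> ?N / \<bar>Im z\<bar>" using assms by (simp add: field_simps)
  have "\<bar>y\<bar> = norm ((of_real x * z + of_real y) - of_real x * z)" by simp
  also have "\<dots> \<le> ?N + norm (of_real x * z)" by (rule norm_triangle_ineq4)
  also have "\<dots> = ?N + \<bar>x\<bar> * norm z" by (simp add: norm_mult)
  also have "\<dots> \<le> ?N + ?N / \<bar>Im z\<bar> * norm z" using x by (intro add_left_mono mult_right_mono) auto
  finally have "\<bar>x\<bar> + \<bar>y\<bar> \<le> ?N * K" using x by (simp add: K_def algebra_simps)
  thus ?thesis using K by (simp add: field_simps)
  qed
  moreover have "1 / K > 0" using K by simp
  ultimately show ?thesis by blast
qed

text \<open>This is the closed form of the sum of 1 / (w + n)^2 over all integers n, that is, of one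
  row of the Eisenstein series of weight 2.\<close>

definition csc2 :: "complex \<Rightarrow> complex" where
  "csc2 w = of_real (pi\<^sup>2) / sin (of_real pi * w) ^ 2"

lemma csc2_minus [simp]: "csc2 (- w) = csc2 w"
  by (simp add: csc2_def)

lemma sin_pi_nz: "Im w \<noteq> 0 \<Longrightarrow> sin (of_real pi * w) \<noteq> 0"
proof
  assume w: "Im w \<noteq> 0" "sin (of_real pi * w) = 0"
  then obtain n :: int where "of_real pi * w = of_real (real_of_int n * pi)"
    by (auto simp: sin_eq_0)
  hence "w = of_int n" by (simp add: field_simps)
  with w show False by auto
qed

text \<open>The series is minus the derivative of the partial fractions of the cotangent. Absolute
  convergence allows its value to be read off symmetric partial sums, which converge to
  \<open>Polygamma 1 w + Polygamma 1 (1 - w)\<close>; differentiating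
  \<open>Digamma_reflection\<close> identifies this with \<open>csc2 w\<close>.\<close>

lemma csc2_has_sum:
  fixes w :: complex
  assumes "Im w \<noteq> 0"
  shows "((\<lambda>n. 1 / (w + of_int n)^2) has_sum csc2 w) UNIV"
proof -
  obtain c where c: "c > 0" "\<And>x y. norm (of_real x * w + of_real y) \<ge> c * (\<bar>x\<bar> + \<bar>y\<bar>)"
    using lattice_norm_bound[OF assms] by auto
  have "(\<lambda>n. 1 / (w + of_int n)^2) summable_on UNIV"
  proof (rule summable_on_int_square_bound)
    fix n :: int
    have "c * (1 + \<bar>of_int n\<bar>) \<le> norm (w + of_int n)" using c(2)[of 1 "of_int n"] by simp
    moreover have "c * (1 + \<bar>of_int n\<bar>) > (0::real)" using c(1) by (intro mult_pos_pos) auto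
    ultimately have "1 / norm (w + of_int n) ^ 2 \<le> 1 / (c * (1 + \<bar>of_int n\<bar>))^2"
      by (intro divide_left_mono power_mono mult_pos_pos[of "_ ^ 2"] zero_less_power) auto
    thus "norm (1 / (w + of_int n)^2) \<le> 1 / c\<^sup>2 / (1 + \<bar>of_int n\<bar>)\<^sup>2"
      by (simp add: norm_divide norm_power power_mult_distrib)
  qed
  then obtain s where s: "((\<lambda>n. 1 / (w + of_int n)^2) has_sum s) UNIV" by (auto simp: summable_on_def)
  note lim1 = has_sum_int_symmetric[OF s]
  have nz: "v \<noteq> 0" "1 - v \<noteq> 0" "v \<notin> \<int>" "v \<notin> \<int>\<^sub>\<le>\<^sub>0" "1 - v \<notin> \<int>\<^sub>\<le>\<^sub>0" if "Im v \<noteq> 0" for v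
    using that by (auto simp: complex_eq_iff elim!: Ints_cases nonpos_Ints_cases)
  have "(\<lambda>N. (\<Sum>n<N. inverse ((w + of_nat n) ^ Suc 1)) + (\<Sum>n<N. inverse ((1 - w + of_nat n) ^ Suc 1)))
     \<longlonglongrightarrow> Polygamma 1 w + Polygamma 1 (1 - w)"
    using Polygamma_LIMSEQ[OF nz(1)[OF assms], of 1] Polygamma_LIMSEQ[OF nz(2)[OF assms], of 1]
    by (intro tendsto_add) (simp_all add: sums_def)
  moreover have "(\<Sum>n<N. inverse ((w + of_nat n) ^ Suc 1)) + (\<Sum>n<N. inverse ((1 - w + of_nat n) ^ Suc 1))
     = (\<Sum>n\<in>{-int N..<int N}. 1 / (w + of_int n)^2)" for N
    unfolding sum_symmetric_int
    by (intro arg_cong2[of _ _ _ _ "(+)"] sum.cong refl)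
       (simp_all add: inverse_eq_divide power2_commute[of "1 - w + _" 0] flip: power2_eq_square,
        subst power2_minus[symmetric], simp add: algebra_simps)
  ultimately have s_eq: "s = Polygamma 1 w + Polygamma 1 (1 - w)"
    using lim1 LIMSEQ_unique by fastforce
  have op: "open {v. Im v \<noteq> 0}" by (intro open_Collect_neq continuous_intros)
  have "((\<lambda>v. Digamma (1 - v) - Digamma v) has_field_derivative - Polygamma 1 (1 - w) - Polygamma 1 w) (at w)"
    using nz[OF assms] by (auto intro!: derivative_eq_intros)
  hence "((\<lambda>v. pi * cot (pi * v)) has_field_derivative - Polygamma 1 (1 - w) - Polygamma 1 w) (at w)"
    by (rule has_field_derivative_transform_within_open[OF _ op])
       (use assms Digamma_reflection nz in auto)
  moreover have "((\<lambda>v. pi * cot (pi * v)) has_field_derivative - csc2 w) (at w)"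
    using sin_pi_nz[OF assms] unfolding csc2_def
    by (auto intro!: derivative_eq_intros DERIV_chain2[OF DERIV_cot] simp: field_simps power2_eq_square)
  ultimately have "- Polygamma 1 (1 - w) - Polygamma 1 w = - csc2 w" by (rule DERIV_unique)
  moreover have "s = - (- Polygamma 1 (1 - w) - Polygamma 1 w)" unfolding s_eq by simp
  ultimately have "s = csc2 w" by (simp only: minus_minus)
  with s show ?thesis by simp
qed

lemma qexp_pow: "qexp 1 (of_nat n * w) = qexp 1 w ^ n"
  by (simp add: qexp_def mult_ac flip: exp_of_nat_mult)

lemma norm_qexp: "norm (qexp l w) = exp (- 2 * pi * l * Im w)"
  by (simp add: qexp_def)

lemma qexp_eq: "qexp 1 w = exp (\<i> * (of_real pi * w)) ^ 2"
  by (simp add: qexp_def mult_ac flip: exp_double)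

lemma sin_exp_half: "sin x = \<i> / (2 * exp (\<i> * x)) * (1 - exp (\<i> * x) ^ 2)"
proof -
  have "exp (\<i> * x) * exp (- (\<i> * x)) = 1" by (simp flip: exp_add)
  thus ?thesis by (simp add: sin_exp_eq field_simps power2_eq_square)
qed

lemma csc2_qexp:
  shows "csc2 w = - 4 * pi\<^sup>2 * qexp 1 w / (1 - qexp 1 w)^2"
  unfolding csc2_def qexp_eq sin_exp_half
  by (simp add: power_mult_distrib power_divide)

lemma cot_qexp:
  fixes w :: complex
  assumes "Im w \<noteq> 0"
  shows "cot (pi * w) = \<i> * (qexp 1 w + 1) / (qexp 1 w - 1)"
proof -
  have "cos x = (1 + exp (\<i> * x) ^ 2) / (2 * exp (\<i> * x))" for x
  proof -
    have "exp (\<i> * x) * exp (- (\<i> * x)) = 1" by (simp flip: exp_add)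
    thus ?thesis by (simp add: cos_exp_eq field_simps power2_eq_square)
  qed
  moreover have "exp (\<i> * (of_real pi * w)) ^ 2 \<noteq> 1"
    using sin_pi_nz[OF assms] unfolding sin_exp_half by auto
  ultimately show ?thesis unfolding cot_def qexp_eq sin_exp_half by (simp add: divide_simps) (simp add: algebra_simps)
qed

section \<open>The Eisenstein series of weight 2 in both orders of summation\<close>

lemma sum_telescope_int:
  fixes f :: "int \<Rightarrow> 'a :: ab_group_add"
  shows "(\<Sum>n\<in>{-int N..<int N}. f n - f (n + 1)) = f (- int N) - f (int N)"
proof (induction N)
  case (Suc N)
  have "{-int (Suc N)..<int (Suc N)} = insert (int N) (insert (-1 - int N) {-int N..<int N})" by auto
  thus ?case by (simp add: Suc add_ac)
qed auto

text \<open>In the half-open window only the term at -N has no partner.\<close>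

lemma sum_odd_int:
  fixes f :: "int \<Rightarrow> 'a :: ab_group_add"
  assumes "\<And>n. f (- n) = - f n"
  shows "(\<Sum>n\<in>{-int N..<int N} - {0}. f n) = (if N = 0 then 0 else f (- int N))"
proof (induction N)
  case (Suc N)
  have "{-int (Suc N)..<int (Suc N)} - {0} =
      (if N = 0 then {-1} else insert (int N) (insert (-1 - int N) ({-int N..<int N} - {0})))" by auto
  moreover have "f (int N) + f (- int N) = 0" using assms[of "int N"] by simp
  ultimately show ?case by (auto simp add: Suc add_ac)
qed auto

lemma has_sum_remove:
  fixes f :: "'b \<Rightarrow> 'a :: banach"
  assumes "(f has_sum s) UNIV"
  shows "(f has_sum (s - f x)) (- {x})"
proof -
  have "f summable_on (- {x})"
    by (rule summable_on_subset_banach[OF has_sum_imp_summable[OF assms]]) auto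
  then obtain t where t: "(f has_sum t) (- {x})" by (auto simp: summable_on_def)
  have "(f has_sum (f x + t)) (insert x (- {x}))" by (intro has_sum_insert t) auto
  moreover have "insert x (- {x}) = UNIV" by auto
  ultimately have "(f has_sum (f x + t)) UNIV" by simp
  with assms have "s = f x + t" by (rule has_sum_unique)
  with t show ?thesis by simp
qed

lemma inverse_squares_int_has_sum: "((\<lambda>n::int. 1 / (of_int n :: complex) ^ 2) has_sum (of_real (pi\<^sup>2 / 3))) (-{0})"
proof -
  have "(\<lambda>n. 1 / real (Suc n) ^ 2) sums (pi\<^sup>2 / 6)" using inverse_squares_sums by simp
  hence "((\<lambda>n. 1 / real (Suc n) ^ 2) has_sum (pi\<^sup>2 / 6)) UNIV"
    by (intro sums_nonneg_imp_has_sum) auto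
  hence *: "((\<lambda>n. 1 / of_nat (Suc n) ^ 2 :: complex) has_sum of_real (pi\<^sup>2 / 6)) UNIV"
    by (subst (asm) has_sum_of_real_iff[symmetric, where 'a = complex]) (simp add: field_simps)
  have "((\<lambda>n::int. 1 / (of_int n :: complex) ^ 2) has_sum of_real (pi\<^sup>2 / 6)) (range (\<lambda>n. int (Suc n)))"
    by (subst has_sum_reindex) (use * in \<open>auto simp: o_def inj_on_def add_ac\<close>)
  moreover have "((\<lambda>n::int. 1 / (of_int n :: complex) ^ 2) has_sum of_real (pi\<^sup>2 / 6)) (range (\<lambda>n. - int (Suc n)))"
    by (subst has_sum_reindex) (use * in \<open>auto simp: o_def inj_on_def add_ac power2_commute[of "-1"]\<close>)
  ultimately have "((\<lambda>n::int. 1 / (of_int n :: complex) ^ 2) has_sum of_real (pi\<^sup>2 / 6) + of_real (pi\<^sup>2 / 6))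
     (range (\<lambda>n. int (Suc n)) \<union> range (\<lambda>n. - int (Suc n)))"
    by (rule has_sum_Un_disjoint) auto
  also have "range (\<lambda>n. int (Suc n)) \<union> range (\<lambda>n. - int (Suc n)) = - {0}"
  proof -
    have "x \<in> range (\<lambda>n. int (Suc n)) \<union> range (\<lambda>n. - int (Suc n))" if "x \<noteq> 0" for x
      using that by (cases x rule: int_cases3) (auto simp: image_iff gr0_conv_Suc)
    thus ?thesis by auto
  qed
  finally show ?thesis by simp
qed

lemma lattice_shift_bound: "(m::int) \<noteq> 0 \<Longrightarrow> \<bar>m\<bar> + \<bar>n\<bar> \<le> 2 * (\<bar>m\<bar> + \<bar>n + 1\<bar>)"
  by (cases "m > 0"; cases "n \<ge> 0"; cases "n + 1 \<ge> 0") (auto simp: abs_if)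

section \<open>Eisenstein's lattice sum over the rows with m nonzero\<close>

context
  fixes z :: complex and c :: real
  assumes z: "Im z > 0"
  assumes c: "c > 0" "\<forall>x y. c * (\<bar>x\<bar> + \<bar>y\<bar>) \<le> norm (of_real x * z + of_real y)"
begin

definition lpoint :: "int \<Rightarrow> int \<Rightarrow> complex" where "lpoint m n = of_int m * z + of_int n"

lemma lpoint_bound: "c * of_int (\<bar>m\<bar> + \<bar>n\<bar>) \<le> norm (lpoint m n)"
  using c(2)[rule_format, of "of_int m" "of_int n"] by (simp add: lpoint_def)

lemma lpoint_bound': "m \<noteq> 0 \<Longrightarrow> c / 2 * of_int (\<bar>m\<bar> + \<bar>n\<bar>) \<le> norm (lpoint m (n + 1))"
proof -
  assume m: "m \<noteq> 0"
  have "\<bar>m\<bar> + \<bar>n\<bar> \<le> 2 * (\<bar>m\<bar> + \<bar>n + 1\<bar>)"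
    using m by (rule lattice_shift_bound)
  hence "of_int (\<bar>m\<bar> + \<bar>n\<bar>) \<le> (of_int (2 * (\<bar>m\<bar> + \<bar>n + 1\<bar>)) :: real)" unfolding of_int_le_iff .
  hence "c / 2 * of_int (\<bar>m\<bar> + \<bar>n\<bar>) \<le> c / 2 * (of_int (2 * (\<bar>m\<bar> + \<bar>n + 1\<bar>)))"
    using c(1) by (intro mult_left_mono) auto
  also have "\<dots> = c * of_int (\<bar>m\<bar> + \<bar>n+1\<bar>)" by simp
  also have "\<dots> \<le> norm (lpoint m (n + 1))" by (rule lpoint_bound)
  finally show ?thesis .
qed

lemma lpoint_nz: "m \<noteq> 0 \<or> n \<noteq> 0 \<Longrightarrow> lpoint m n \<noteq> 0"
proof
  assume *: "m \<noteq> 0 \<or> n \<noteq> 0" "lpoint m n = 0"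
  have "c * of_int (\<bar>m\<bar> + \<bar>n\<bar>) > 0" using c(1) *(1) by (intro mult_pos_pos) (simp_all, linarith)
  with lpoint_bound[of m n] *(2) show False by simp
qed

definition tele :: "int \<Rightarrow> int \<Rightarrow> complex" where "tele m n = 1 / lpoint m n - 1 / lpoint m (n + 1)"
text \<open>Removing the telescoping part improves the decay of 1 / (m z + n)^2 from order two to
  order three. The remainder converges absolutely over the lattice and may be summed in either
  order, so the discrepancy between the two orders is carried by \<open>tele\<close> alone: its rows
  sum to 0, its column sums do not add up to 0.\<close>

definition cubic :: "int \<Rightarrow> int \<Rightarrow> complex" where "cubic m n = 1 / lpoint m n ^ 2 - tele m n"

lemma tele_eq: "m \<noteq> 0 \<Longrightarrow> tele m n = 1 / (lpoint m n * lpoint m (n + 1))"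
  unfolding tele_def using lpoint_nz[of m n] lpoint_nz[of m "n + 1"]
  by (simp add: divide_simps) (simp add: lpoint_def algebra_simps)

lemma cubic_eq: "m \<noteq> 0 \<Longrightarrow> cubic m n = 1 / (lpoint m n ^ 2 * lpoint m (n + 1))"
  unfolding cubic_def tele_def using lpoint_nz[of m n] lpoint_nz[of m "n + 1"]
  by (simp add: divide_simps) (simp add: lpoint_def algebra_simps power2_eq_square)

lemma norm_tele_le:
  assumes "m \<noteq> 0"
  shows "norm (tele m n) \<le> 2 / c\<^sup>2 * (1 / (of_int (\<bar>m\<bar> + \<bar>n\<bar>) ^ 2))"
proof -
  define s :: real where "s = of_int (\<bar>m\<bar> + \<bar>n\<bar>)"
  have s: "s > 0" using assms by (simp add: s_def)
  have 1: "norm (lpoint m n) \<ge> c * s" "norm (lpoint m (n + 1)) \<ge> c / 2 * s"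
    using lpoint_bound[of m n] lpoint_bound'[OF assms, of n] unfolding s_def by auto
  have "norm (lpoint m n) * norm (lpoint m (n + 1)) \<ge> (c * s) * (c / 2 * s)"
    using 1 c(1) s by (intro mult_mono) auto
  hence "1 / (norm (lpoint m n) * norm (lpoint m (n + 1))) \<le> 1 / ((c * s) * (c / 2 * s))"
    using c(1) s assms by (intro divide_left_mono mult_pos_pos) (auto simp: lpoint_nz)
  also have "\<dots> = 2 / c\<^sup>2 * (1 / s ^ 2)" using c(1) s by (simp add: power2_eq_square)
  finally show ?thesis using assms by (simp add: s_def tele_eq norm_divide norm_mult)
qed

lemma norm_cubic_le:
  assumes "m \<noteq> 0"
  shows "norm (cubic m n) \<le> 2 / c^3 * (1 / (of_int (\<bar>m\<bar> + \<bar>n\<bar>) ^ 3))"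
proof -
  define s :: real where "s = of_int (\<bar>m\<bar> + \<bar>n\<bar>)"
  have s: "s > 0" using assms by (simp add: s_def)
  have 1: "norm (lpoint m n) \<ge> c * s" "norm (lpoint m (n + 1)) \<ge> c / 2 * s"
    using lpoint_bound[of m n] lpoint_bound'[OF assms, of n] unfolding s_def by auto
  have "norm (lpoint m n) ^ 2 * norm (lpoint m (n + 1)) \<ge> (c * s) ^ 2 * (c / 2 * s)"
    using 1 c(1) s by (intro mult_mono power_mono) auto
  hence "1 / (norm (lpoint m n) ^ 2 * norm (lpoint m (n + 1))) \<le> 1 / ((c * s)^2 * (c / 2 * s))"
    using c(1) s assms by (intro divide_left_mono mult_pos_pos) (auto simp: lpoint_nz)
  also have "\<dots> = 2 / c^3 * (1 / s ^ 3)" using c(1) s by (simp add: power2_eq_square power3_eq_cube)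
  finally show ?thesis using assms by (simp add: s_def cubic_eq norm_divide norm_mult norm_power)
qed

lemma tele_summable1:
  assumes "m \<noteq> 0" shows "(\<lambda>n. tele m n) summable_on UNIV"
proof (rule summable_on_int_square_bound)
  fix n :: int
  have m: "\<bar>m\<bar> \<ge> 1" using assms by linarith
  have "1 / (of_int (\<bar>m\<bar> + \<bar>n\<bar>) ^ 2) \<le> 1 / (1 + \<bar>of_int n\<bar> :: real) ^ 2"
    using m by (intro divide_left_mono power_mono mult_pos_pos zero_less_power) auto
  hence "2 / c\<^sup>2 * (1 / (of_int (\<bar>m\<bar> + \<bar>n\<bar>) ^ 2)) \<le> 2 / c\<^sup>2 * (1 / (1 + \<bar>of_int n\<bar> :: real) ^ 2)"
    by (intro mult_left_mono) auto
  thus "norm (tele m n) \<le> 2 / c\<^sup>2 / (1 + \<bar>of_int n\<bar>)\<^sup>2"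
    using norm_tele_le[OF assms, of n] by simp
qed

lemma tele_summable2: "(\<lambda>m. tele m n) summable_on -{0}"
proof (rule summable_on_int_square_bound)
  fix m :: int assume "m \<in> -{0}"
  hence m0: "m \<noteq> 0" by auto
  hence m: "\<bar>m\<bar> \<ge> 1" by linarith
  have "1 / (of_int (\<bar>m\<bar> + \<bar>n\<bar>) ^ 2) \<le> 1 / ((1 + \<bar>of_int m\<bar> :: real) / 2) ^ 2"
    using m by (intro divide_left_mono power_mono mult_pos_pos zero_less_power) auto
  hence "2 / c\<^sup>2 * (1 / (of_int (\<bar>m\<bar> + \<bar>n\<bar>) ^ 2)) \<le> 2 / c\<^sup>2 * (4 / (1 + \<bar>of_int m\<bar> :: real) ^ 2)"
    by (intro mult_left_mono) (simp_all add: power_divide)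
  thus "norm (tele m n) \<le> 8 / c\<^sup>2 / (1 + \<bar>of_int m\<bar>)\<^sup>2"
    using norm_tele_le[OF m0, of n] by simp
qed

lemma cubic_summable: "(\<lambda>(m, n). cubic m n) summable_on (-{0}) \<times> UNIV"
proof -
  \<comment> \<open>The exponent 3/2 is half of the cubic decay and still exceeds 1: both 1 + |m|
    and 1 + |n| are at most twice |m| + |n|, so the cubic bound is dominated by a product of two
    convergent series.\<close>
  let ?f = "\<lambda>m::int. (1 + \<bar>of_int m\<bar> :: real) powr - (3/2)"
  obtain s where s: "(?f has_sum s) UNIV"
    using summable_on_int_powr[of "3/2"] by (auto simp: summable_on_def)
  have "(\<lambda>(m,n). ?f m * ?f n) summable_on UNIV \<times> UNIV"
  proof (rule summable_on_SigmaI[where g = "\<lambda>m. ?f m * s"])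
    show "((\<lambda>n. case (m, n) of (m, n) \<Rightarrow> ?f m * ?f n) has_sum (?f m * s)) UNIV" for m
      unfolding prod.case by (rule has_sum_cmult_right[OF s])
    show "(\<lambda>m. ?f m * s) summable_on UNIV"
      by (rule summable_on_cmult_left[OF has_sum_imp_summable[OF s]])
  qed auto
  hence "(\<lambda>(m,n). ?f m * ?f n) summable_on (-{0}) \<times> UNIV"
    by (rule summable_on_subset_banach) auto
  hence "(\<lambda>x. (2 / c^3 * 8) * (case x of (m,n) \<Rightarrow> ?f m * ?f n)) summable_on (-{0}) \<times> UNIV"
    by (rule summable_on_cmult_right)
  hence "(\<lambda>x. norm (case x of (m, n) \<Rightarrow> cubic m n)) summable_on (-{0}) \<times> UNIV"
  proof (rule summable_on_comparison_test)
    fix x :: "int \<times> int" assume "x \<in> (-{0}) \<times> UNIV"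
    then obtain m n where x: "x = (m, n)" and m0: "m \<noteq> 0" by auto
    define s :: real where "s = of_int (\<bar>m\<bar> + \<bar>n\<bar>)"
    have "real_of_int \<bar>m\<bar> \<ge> 1" using m0 by linarith
    hence s: "s > 0" "1 + \<bar>of_int m\<bar> \<le> 2 * s" "1 + \<bar>of_int n\<bar> \<le> 2 * s" by (simp_all add: s_def)
    have "(2 * s) powr - (3/2) \<le> ?f m" "(2 * s) powr - (3/2) \<le> ?f n"
      using s by (auto intro!: powr_mono2')
    hence "(2 * s) powr - (3/2) * (2 * s) powr - (3/2) \<le> ?f m * ?f n"
      by (intro mult_mono) auto
    also have "(2 * s) powr - (3/2) * (2 * s) powr - (3/2) = 1 / (8 * s ^ 3)"
      using s by (simp add: powr_add[symmetric] powr_minus divide_simps power_mult_distrib)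
    finally have "2 / c^3 * 8 * (1 / (8 * s ^ 3)) \<le> 2 / c^3 * 8 * (?f m * ?f n)"
      using c(1) by (intro mult_left_mono) auto
    moreover have "2 / c^3 * 8 * (1 / (8 * s ^ 3)) = 2 / c^3 * (1 / s ^ 3)" by simp
    moreover note norm_cubic_le[OF m0, of n]
    ultimately show "norm (case x of (m, n) \<Rightarrow> cubic m n) \<le> 2 / c^3 * 8 * (case x of (m,n) \<Rightarrow> ?f m * ?f n)"
      unfolding x s_def by simp
  qed (auto simp: c(1) less_imp_le)
  thus ?thesis by (rule abs_summable_summable)
qed

lemma tele_has_sum1:
  assumes m: "m \<noteq> 0" shows "((\<lambda>n. tele m n) has_sum 0) UNIV"
proof -
  obtain s where s: "((\<lambda>n. tele m n) has_sum s) UNIV" using tele_summable1[OF m] by (auto simp: summable_on_def)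
  have "(\<Sum>n\<in>{-int N..<int N}. tele m n) = 1 / lpoint m (- int N) - 1 / lpoint m (int N)" for N
    unfolding tele_def by (rule sum_telescope_int)
  with has_sum_int_symmetric[OF s]
  have 1: "(\<lambda>N. 1 / lpoint m (- int N) - 1 / lpoint m (int N)) \<longlonglongrightarrow> s" by simp
  have fl: "filterlim (\<lambda>N. norm (lpoint m (k * int N))) at_top sequentially" if "\<bar>k\<bar> = 1" for k
  proof (rule filterlim_at_top_mono[where f = "\<lambda>N. c * real N"])
    show "filterlim (\<lambda>N. c * real N) at_top sequentially"
      using c(1) by (intro filterlim_tendsto_pos_mult_at_top[OF tendsto_const] filterlim_real_sequentially)
    have "c * real N \<le> norm (lpoint m (k * int N))" for N
    proof -
      have "c * real N \<le> c * of_int (\<bar>m\<bar> + \<bar>k * int N\<bar>)" using c(1) that by (intro mult_left_mono) (auto simp: abs_mult)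
      also have "\<dots> \<le> norm (lpoint m (k * int N))" by (rule lpoint_bound)
      finally show ?thesis .
    qed
    thus "\<forall>\<^sub>F N in sequentially. c * real N \<le> norm (lpoint m (k * int N))" by simp
  qed
  have "(\<lambda>N. 1 / lpoint m (k * int N)) \<longlonglongrightarrow> 0" if "\<bar>k\<bar> = 1" for k
    using fl[OF that] by (intro tendsto_divide_0[OF tendsto_const]) (simp add: filterlim_at_infinity_conv_norm_at_top)
  from tendsto_diff[OF this[of "-1"] this[of 1]]
  have "(\<lambda>N. 1 / lpoint m (- int N) - 1 / lpoint m (int N)) \<longlonglongrightarrow> 0" by simp
  with 1 have "s = 0" by (rule LIMSEQ_unique)
  with s show ?thesis by simp
qed

text \<open>The symmetric limit of the sum of 1 / (m z + n) over nonzero m: the partial fractions of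
  the cotangent at n / z with the term m = 0 taken out. For n = 0 the terms cancel in pairs.\<close>

definition colsum :: "int \<Rightarrow> complex" where
  "colsum n = (if n = 0 then 0 else (of_real pi / z) * cot (of_real pi * (of_int n / z)) - 1 / of_int n)"

lemma z_nz: "z \<noteq> 0" using z by auto

lemma Im_div_z: "n \<noteq> 0 \<Longrightarrow> Im (of_int n / z) \<noteq> 0"
  using z z_nz by (auto simp: Im_divide)

lemma colsum_tendsto:
  "(\<lambda>N. \<Sum>m\<in>{-int N..<int N} - {0}. 1 / lpoint m n) \<longlonglongrightarrow> colsum n"
proof (cases "n = 0")
  case True
  have "(\<Sum>m\<in>{-int N..<int N} - {0}. 1 / lpoint m 0) = (if N = 0 then 0 else - (1 / z) / of_nat N)" for N
    by (subst sum_odd_int) (auto simp: lpoint_def)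
  moreover have "(\<lambda>N. (if N = 0 then 0 else - (1 / z) / of_nat N)) \<longlonglongrightarrow> 0"
  proof (rule Lim_transform_eventually)
    show "(\<lambda>N. - (1 / z) / of_nat N) \<longlonglongrightarrow> 0" by (rule lim_const_over_n)
    show "\<forall>\<^sub>F N in sequentially. - (1 / z) / of_nat N = (if N = 0 then 0 else - (1 / z) / of_nat N)"
      using eventually_gt_at_top[of 0] by eventually_elim auto
  qed
  ultimately show ?thesis using True by (simp add: colsum_def)
next
  case False
  have "(\<lambda>N. \<Sum>m\<in>{-int N..<int N}. 1 / (of_int n / z + of_int m)) \<longlonglongrightarrow> pi * cot (pi * (of_int n / z))"
    by (rule cot_partial_fractions) (use Im_div_z[OF False] in \<open>auto elim!: Ints_cases\<close>)
  hence "(\<lambda>N. 1 / z * (\<Sum>m\<in>{-int N..<int N}. 1 / (of_int n / z + of_int m)) - 1 / of_int n) \<longlonglongrightarrow>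
     1 / z * (pi * cot (pi * (of_int n / z))) - 1 / of_int n"
    by (intro tendsto_intros)
  moreover have "\<forall>\<^sub>F N in sequentially. 1 / z * (\<Sum>m\<in>{-int N..<int N}. 1 / (of_int n / z + of_int m)) - 1 / of_int n
     = (\<Sum>m\<in>{-int N..<int N} - {0}. 1 / lpoint m n)"
    using eventually_gt_at_top[of 0]
  proof eventually_elim
    case (elim N)
    have "1 / z * (\<Sum>m\<in>{-int N..<int N}. 1 / (of_int n / z + of_int m)) = (\<Sum>m\<in>{-int N..<int N}. 1 / lpoint m n)"
      unfolding sum_distrib_left
    proof (intro sum.cong refl)
      fix m
      have "z * (of_int n / z + of_int m) = lpoint m n" using z_nz by (simp add: lpoint_def field_simps)
      thus "1 / z * (1 / (of_int n / z + of_int m)) = 1 / lpoint m n" by (metis divide_divide_eq_left mult_1_right times_divide_eq_right)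
    qed
    also have "\<dots> = 1 / of_int n + (\<Sum>m\<in>{-int N..<int N} - {0}. 1 / lpoint m n)"
      using elim by (subst sum.remove[of _ 0]) (auto simp: lpoint_def)
    finally show ?case by simp
  qed
  ultimately show ?thesis using False by (auto simp: colsum_def intro: Lim_transform_eventually)
qed

lemma tele_has_sum2: "((\<lambda>m. tele m n) has_sum (colsum n - colsum (n + 1))) (-{0})"
proof -
  obtain s where s: "((\<lambda>m. tele m n) has_sum s) (-{0})" using tele_summable2 by (auto simp: summable_on_def)
  from has_sum_nonzero_int_symmetric[OF s]
  have "(\<lambda>N. (\<Sum>m\<in>{-int N..<int N} - {0}. 1 / lpoint m n) - (\<Sum>m\<in>{-int N..<int N} - {0}. 1 / lpoint m (n+1))) \<longlonglongrightarrow> s"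
    unfolding tele_def sum_subtractf .
  moreover have "(\<lambda>N. (\<Sum>m\<in>{-int N..<int N} - {0}. 1 / lpoint m n) - (\<Sum>m\<in>{-int N..<int N} - {0}. 1 / lpoint m (n+1))) \<longlonglongrightarrow> colsum n - colsum (n + 1)"
    by (intro tendsto_intros colsum_tendsto)
  ultimately have "s = colsum n - colsum (n + 1)" by (rule LIMSEQ_unique)
  with s show ?thesis by simp
qed

text \<open>The point -N / z moves up the half-plane, where the cotangent tends to -i. This limit is
  nonzero, and it is the source of the non-modular term in the transformation law of
  \<open>E2\<close>.\<close>

lemma colsum_lim: "(\<lambda>N. colsum (- int N) - colsum (int N)) \<longlonglongrightarrow> - 2 * of_real pi * \<i> / z"
proof -
  define q where "q = qexp 1 (- (1 / z))"
  have "Im (- (1 / z)) > 0" using z z_nz by (simp add: Im_divide sum_power2_gt_zero_iff complex_eq_iff)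
  hence q1: "norm q < 1" by (simp add: q_def norm_qexp mult_pos_neg)
  hence q: "(\<lambda>N. q ^ N) \<longlonglongrightarrow> 0" by (rule LIMSEQ_power_zero)
  have "(\<lambda>N. 2 * ((of_real pi / z) * (\<i> * (q ^ N + 1) / (q ^ N - 1)) + 1 / of_nat N)) \<longlonglongrightarrow>
     2 * ((of_real pi / z) * (\<i> * (0 + 1) / (0 - 1)) + 0)"
    by (intro tendsto_intros lim_const_over_n) (simp_all add: q1)
  moreover have "\<forall>\<^sub>F N in sequentially. 2 * ((of_real pi / z) * (\<i> * (q ^ N + 1) / (q ^ N - 1)) + 1 / of_nat N)
     = colsum (- int N) - colsum (int N)"
    using eventually_gt_at_top[of 0]
  proof eventually_elim
    case (elim N)
    have "cot (of_real pi * (of_int (- int N) / z)) = \<i> * (q ^ N + 1) / (q ^ N - 1)"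
      by (subst cot_qexp) (use Im_div_z[of "- int N"] elim in \<open>auto simp: q_def simp flip: qexp_pow\<close>)
    moreover have "colsum (int N) = - colsum (- int N)" using elim by (simp add: colsum_def cot_def)
    ultimately show ?case using elim by (simp add: colsum_def)
  qed
  ultimately have "(\<lambda>N. colsum (- int N) - colsum (int N)) \<longlonglongrightarrow> 2 * ((of_real pi / z) * (\<i> * (0 + 1) / (0 - 1)) + 0)"
    by (rule Lim_transform_eventually)
  moreover have "2 * ((of_real pi / z) * (\<i> * (0 + 1) / (0 - 1)) + 0) = - 2 * of_real pi * \<i> / z" by simp
  ultimately show ?thesis by (simp add: mult_ac)
qed

text \<open>Summation by rows yields B, summation by columns yields P. The convergence of the column
  series is left as a premise on P because it follows from the first conjunct applied at -1/z,
  \<open>csc2\<close> being even.\<close>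

lemma csc2_lattice_aux:
  "\<exists>B. ((\<lambda>m. csc2 (of_int m * z)) has_sum B) (-{0}) \<and>
    (\<forall>P. ((\<lambda>n. csc2 (of_int n / z)) has_sum P) (-{0}) \<longrightarrow>
      P + pi\<^sup>2 / 3 = z\<^sup>2 * (B + pi\<^sup>2 / 3) - 2 * of_real pi * \<i> * z)"
proof -
  obtain S where S: "((\<lambda>(m, n). cubic m n) has_sum S) ((-{0}) \<times> UNIV)"
    using cubic_summable by (auto simp: summable_on_def)
  have nz: "Im (of_int m * z) \<noteq> 0" if "m \<noteq> 0" for m using that z by simp
  have row: "((\<lambda>n. cubic m n) has_sum csc2 (of_int m * z)) UNIV" if "m \<noteq> 0" for m
    using has_sum_add[OF csc2_has_sum[OF nz[OF that]] has_sum_uminusI[OF tele_has_sum1[OF that]]]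
    by (simp add: cubic_def lpoint_def)
  have B: "((\<lambda>m. csc2 (of_int m * z)) has_sum S) (-{0})"
    by (rule has_sum_SigmaD[OF S]) (use row in auto)
  \<comment> \<open>The sum of column n over nonzero m: the factor 1 / z^2 turns (m z + n)^2 into (n
    / z + m)^2, and 1 / n^2 is the term m = 0 that is left out. For n = 0 the column is 1 / z^2
    times twice the sum of inverse squares.\<close>
  define A where "A n = (if n = 0 then 1 / z\<^sup>2 * of_real (pi\<^sup>2 / 3) else 1 / z\<^sup>2 * csc2 (of_int n / z) - 1 / of_int n ^ 2)" for n :: int
  have A: "((\<lambda>m. 1 / lpoint m n ^ 2) has_sum A n) (-{0})" for n
  proof (cases "n = 0")
    case True
    have "((\<lambda>m::int. 1 / z\<^sup>2 * (1 / of_int m ^ 2)) has_sum (1 / z\<^sup>2 * of_real (pi\<^sup>2 / 3))) (-{0})"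
      by (intro has_sum_cmult_right inverse_squares_int_has_sum)
    thus ?thesis using True by (simp add: A_def lpoint_def power_mult_distrib mult_ac)
  next
    case False
    have "((\<lambda>m. 1 / (of_int n / z + of_int m)^2) has_sum csc2 (of_int n / z) - 1 / (of_int n / z + of_int 0)^2) (-{0})"
      by (intro has_sum_remove[where x = "0::int"] csc2_has_sum Im_div_z False)
    hence "((\<lambda>m. 1 / z\<^sup>2 * (1 / (of_int n / z + of_int m)^2)) has_sum 1 / z\<^sup>2 * (csc2 (of_int n / z) - 1 / (of_int n / z + of_int 0)^2)) (-{0})"
      by (rule has_sum_cmult_right)
    moreover have "1 / z\<^sup>2 * (1 / (of_int n / z + of_int m)^2) = 1 / lpoint m n ^ 2" for m
    proof -
      have "lpoint m n = z * (of_int n / z + of_int m)" using z_nz by (simp add: lpoint_def field_simps)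
      thus ?thesis by (simp add: power_mult_distrib)
    qed
    ultimately show ?thesis using False z_nz by (simp add: A_def algebra_simps power_divide)
  qed
  have col: "((\<lambda>m. cubic m n) has_sum (A n - (colsum n - colsum (n + 1)))) (-{0})" for n
    using has_sum_add[OF A[of n] has_sum_uminusI[OF tele_has_sum2[of n]]] by (simp add: cubic_def algebra_simps)
  have "((\<lambda>(n, m). cubic m n) has_sum S) (UNIV \<times> (-{0}))"
    using S unfolding has_sum_swap[of _ _ "- {0}"] by simp
  hence C: "((\<lambda>n. A n - (colsum n - colsum (n + 1))) has_sum S) UNIV"
    by (rule has_sum_SigmaD) (use col in auto)
  have key: "P + pi\<^sup>2 / 3 = z\<^sup>2 * (S + pi\<^sup>2 / 3) - 2 * of_real pi * \<i> * z"
    if P: "((\<lambda>n. csc2 (of_int n / z)) has_sum P) (-{0})" for P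
  proof -
    have "((\<lambda>n. A n) has_sum (1 / z\<^sup>2 * P - of_real (pi\<^sup>2 / 3))) (-{0})"
      using has_sum_add[OF has_sum_cmult_right[OF P, of "1 / z\<^sup>2"] has_sum_uminusI[OF inverse_squares_int_has_sum]]
      by (subst has_sum_cong[where g = "\<lambda>n. 1 / z\<^sup>2 * csc2 (of_int n / z) + - (1 / of_int n ^ 2)"]) (auto simp: A_def)
    hence "((\<lambda>n. A n) has_sum (A 0 + (1 / z\<^sup>2 * P - of_real (pi\<^sup>2 / 3)))) (insert 0 (-{0}))"
      by (intro has_sum_insert) auto
    moreover have "insert 0 (-{0}) = (UNIV :: int set)" by auto
    ultimately have "((\<lambda>n. A n) has_sum (A 0 + (1 / z\<^sup>2 * P - of_real (pi\<^sup>2 / 3)))) UNIV" by simp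
    from has_sum_add[OF this has_sum_uminusI[OF C]]
    have "((\<lambda>n. colsum n - colsum (n + 1)) has_sum (A 0 + (1 / z\<^sup>2 * P - of_real (pi\<^sup>2 / 3)) - S)) UNIV" by simp
    from has_sum_int_symmetric[OF this]
    have "(\<lambda>N. colsum (- int N) - colsum (int N)) \<longlonglongrightarrow> A 0 + (1 / z\<^sup>2 * P - of_real (pi\<^sup>2 / 3)) - S"
      unfolding sum_telescope_int .
    hence eq: "A 0 + (1 / z\<^sup>2 * P - of_real (pi\<^sup>2 / 3)) - S = - 2 * of_real pi * \<i> / z"
      using colsum_lim LIMSEQ_unique by blast
    have "z\<^sup>2 * (A 0 + (1 / z\<^sup>2 * P - of_real (pi\<^sup>2 / 3)) - S) = - 2 * of_real pi * \<i> * z"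
      unfolding eq using z_nz by (simp add: power2_eq_square)
    thus "P + pi\<^sup>2 / 3 = z\<^sup>2 * (S + pi\<^sup>2 / 3) - 2 * of_real pi * \<i> * z"
      using z_nz by (simp add: A_def algebra_simps)
  qed
  show ?thesis
  proof (intro exI conjI allI impI)
    show "((\<lambda>m. csc2 (of_int m * z)) has_sum S) (-{0})" by (rule B)
    show "P + pi\<^sup>2 / 3 = z\<^sup>2 * (S + pi\<^sup>2 / 3) - 2 * of_real pi * \<i> * z"
      if "((\<lambda>n. csc2 (of_int n / z)) has_sum P) (-{0})" for P
      using that by (rule key)
  qed
qed

end

lemma csc2_lattice:
  assumes z: "Im z > 0"
  obtains B P where "((\<lambda>m. csc2 (of_int m * z)) has_sum B) (-{0})"
    "((\<lambda>m. csc2 (of_int m * (- (1 / z)))) has_sum P) (-{0})"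
    "P + pi\<^sup>2 / 3 = z\<^sup>2 * (B + pi\<^sup>2 / 3) - 2 * of_real pi * \<i> * z"
proof -
  have "Im z \<noteq> 0" using z by simp
  then obtain c where c: "c > 0" "\<forall>x y. c * (\<bar>x\<bar> + \<bar>y\<bar>) \<le> norm (of_real x * z + of_real y)"
    using lattice_norm_bound by blast
  from csc2_lattice_aux[OF z c]
  obtain B where B: "((\<lambda>m. csc2 (of_int m * z)) has_sum B) (-{0})"
    and B2: "\<forall>P. ((\<lambda>n. csc2 (of_int n / z)) has_sum P) (-{0}) \<longrightarrow>
      P + pi\<^sup>2 / 3 = z\<^sup>2 * (B + pi\<^sup>2 / 3) - 2 * of_real pi * \<i> * z"
    by (elim exE conjE)
  have z': "Im (- (1 / z)) > 0" using z by (auto simp: Im_divide sum_power2_gt_zero_iff complex_eq_iff)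
  hence "Im (- (1 / z)) \<noteq> 0" by linarith
  then obtain c' where c': "c' > 0" "\<forall>x y. c' * (\<bar>x\<bar> + \<bar>y\<bar>) \<le> norm (of_real x * (- (1 / z)) + of_real y)"
    using lattice_norm_bound by blast
  from csc2_lattice_aux[OF z' c']
  obtain P where P: "((\<lambda>m. csc2 (of_int m * (- (1 / z)))) has_sum P) (-{0})"
    by (elim exE conjE)
  moreover have "csc2 (of_int m * (- (1 / z))) = csc2 (of_int m / z)" for m
    using csc2_minus[of "of_int m / z"] by simp
  ultimately have P': "((\<lambda>n. csc2 (of_int n / z)) has_sum P) (-{0})" by simp
  show ?thesis using that[OF B P B2[rule_format, OF P']] .
qed

section \<open>Quasimodularity of \<open>E\<^sub>2\<close>\<close>

lemma has_sum_nat_deriv_geometric: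
  fixes x :: "'a :: {banach, real_normed_field}"
  assumes "norm x < 1"
  shows "((\<lambda>d. of_nat d * x ^ d) has_sum (x / (1 - x)\<^sup>2)) {1..}"
proof -
  have s: "(\<lambda>n. of_nat (Suc n) * y ^ Suc n) sums (y / (1 - y)\<^sup>2)" if "norm y < 1" for y :: "'b :: {banach, real_normed_field}"
    using sums_mult[OF geometric_deriv_sums[OF that], of y] by (simp add: mult_ac)
  have "summable (\<lambda>n. norm (of_nat (Suc n) * x ^ Suc n))"
    using s[of "norm x"] assms by (simp add: norm_mult norm_power sums_iff del: of_nat_Suc)
  hence "((\<lambda>n. of_nat (Suc n) * x ^ Suc n) has_sum (x / (1 - x)\<^sup>2)) UNIV"
    using s[OF assms] by (intro norm_summable_imp_has_sum)
  moreover have "{1..} = range Suc" by (auto simp: image_iff Suc_le_eq gr0_conv_Suc)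
  ultimately show ?thesis by (simp add: has_sum_reindex o_def)
qed

definition E2_coeff :: "nat \<Rightarrow> complex" where
  "E2_coeff n = (if n = 0 then 1 else -24 * of_nat (\<Sum>d | d dvd n. d))"

context
  fixes q :: complex
  assumes q: "norm q < 1"
begin

lemma lambert_summable: "(\<lambda>(m,d). of_nat d * q ^ (m * d)) summable_on {1..} \<times> {1..}"
proof -
  let ?r = "norm q"
  have r: "?r ^ m < 1" if "m \<in> {1..}" for m :: nat
    using q that by (simp add: power_less_one_iff)
  have "(\<lambda>(m,d). of_nat d * ?r ^ (m * d)) summable_on {1..} \<times> {1..}"
  proof (rule summable_on_SigmaI[where g = "\<lambda>m. ?r ^ m / (1 - ?r ^ m)\<^sup>2"])
    show "((\<lambda>d. case (m, d) of (m, d) \<Rightarrow> of_nat d * ?r ^ (m * d)) has_sum ?r ^ m / (1 - ?r ^ m)\<^sup>2) {1..}"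
      if "m \<in> {1..}" for m
      using has_sum_nat_deriv_geometric[of "?r ^ m"] r[OF that] by (simp add: power_mult)
    have "summable (\<lambda>m. ?r ^ m * (1 / (1 - ?r)\<^sup>2))"
      using q by (intro summable_mult2 summable_geometric) auto
    hence "(\<lambda>m. ?r ^ m * (1 / (1 - ?r)\<^sup>2)) summable_on UNIV"
      by (intro summable_nonneg_imp_summable_on) auto
    hence "(\<lambda>m. ?r ^ m * (1 / (1 - ?r)\<^sup>2)) summable_on {1..}"
      by (rule summable_on_subset_banach) auto
    thus "(\<lambda>m. ?r ^ m / (1 - ?r ^ m)\<^sup>2) summable_on {1..}"
    proof (rule summable_on_comparison_test)
      fix m :: nat assume m: "m \<in> {1..}"
      have "?r ^ m \<le> ?r ^ 1" using m q by (intro power_decreasing) auto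
      hence "?r ^ m / (1 - ?r ^ m)\<^sup>2 \<le> ?r ^ m / (1 - ?r)\<^sup>2"
        using q r[OF m] by (intro divide_left_mono power_mono mult_pos_pos zero_less_power) auto
      thus "?r ^ m / (1 - ?r ^ m)\<^sup>2 \<le> ?r ^ m * (1 / (1 - ?r)\<^sup>2)" by simp
    qed auto
  qed auto
  hence "(\<lambda>x. norm (case x of (m,d) \<Rightarrow> of_nat d * q ^ (m * d))) summable_on {1..} \<times> {1..}"
    by (simp add: case_prod_unfold norm_mult norm_power)
  thus ?thesis by (rule abs_summable_summable)
qed

text \<open>Both sides evaluate the double series of d q^(m d). Summing over d first gives the
  Lambert terms, grouping by the product m d gives the divisor sums.\<close>

lemma lambert_series:
  "\<exists>S. ((\<lambda>m. q ^ m / (1 - q ^ m)\<^sup>2) has_sum S) {1..} \<and>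
    (\<lambda>n. of_nat (\<Sum>d | d dvd Suc n. d) * q ^ Suc n) sums S"
proof -
  obtain S where S: "((\<lambda>(m,d). of_nat d * q ^ (m * d)) has_sum S) ({1..} \<times> {1..})"
    using lambert_summable by (auto simp: summable_on_def)
  have 1: "((\<lambda>m. q ^ m / (1 - q ^ m)\<^sup>2) has_sum S) {1..}"
  proof (rule has_sum_SigmaD[OF S])
    show "((\<lambda>d. case (m, d) of (m, d) \<Rightarrow> of_nat d * q ^ (m * d)) has_sum q ^ m / (1 - q ^ m)\<^sup>2) {1..}"
      if "m \<in> {1..}" for m
      using has_sum_nat_deriv_geometric[of "q ^ m"] that q by (simp add: power_mult norm_power power_less_one_iff)
  qed
  have bij: "bij_betw (\<lambda>(m,d). (m * d, d)) ({1..} \<times> {1..}) (SIGMA n:{1::nat..}. {d. d dvd n})"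
    by (rule bij_betw_byWitness[where f' = "\<lambda>(n,d). (n div d, d)"])
       (auto simp: Suc_le_eq dvd_div_eq_0_iff elim!: dvdE intro!: Nat.gr0I)
  have "((\<lambda>(n,d). of_nat d * q ^ n) has_sum S) (SIGMA n:{1..}. {d. d dvd n})"
    using S unfolding has_sum_reindex_bij_betw[OF bij, symmetric] by (simp add: case_prod_unfold)
  hence "((\<lambda>n. \<Sum>d | d dvd n. of_nat d * q ^ n) has_sum S) {1..}"
    by (rule has_sum_SigmaD) (auto intro!: has_sum_finiteI)
  hence "((\<lambda>n. of_nat (\<Sum>d | d dvd n. d) * q ^ n) has_sum S) {1..}"
    by (simp add: sum_distrib_right)
  moreover have "{1..} = range Suc" by (auto simp: image_iff Suc_le_eq gr0_conv_Suc)
  ultimately have "((\<lambda>n. of_nat (\<Sum>d | d dvd Suc n. d) * q ^ Suc n) has_sum S) UNIV"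
    by (simp add: has_sum_reindex o_def)
  from has_sum_imp_sums[OF this] 1 show ?thesis by blast
qed

end

definition E2_fps :: "complex fps" where "E2_fps = Abs_fps E2_coeff"

lemma E2_fps_sums:
  assumes "norm q < 1" 
  shows "(\<lambda>n. fps_nth E2_fps n * q ^ n) sums (1 - 24 * (\<Sum>n. of_nat (\<Sum>d | d dvd Suc n. d) * q ^ Suc n))"
proof -
  from lambert_series[OF assms] obtain S where S: "(\<lambda>n. of_nat (\<Sum>d | d dvd Suc n. d) * q ^ Suc n) sums S" by blast
  have "(\<lambda>n. -24 * (of_nat (\<Sum>d | d dvd Suc n. d) * q ^ Suc n)) sums (-24 * S)"
    by (intro sums_mult S)
  hence "(\<lambda>n. E2_coeff (Suc n) * q ^ Suc n) sums (-24 * S)" by (simp add: E2_coeff_def mult_ac)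
  hence "(\<lambda>n. E2_coeff n * q ^ n) sums (-24 * S + E2_coeff 0 * q ^ 0)" by (rule sums_Suc)
  with S show ?thesis by (simp add: E2_fps_def E2_coeff_def sums_iff)
qed

lemma conv_radius_E2_fps: "fps_conv_radius E2_fps \<ge> 1"
  unfolding fps_conv_radius_def
proof (rule conv_radius_geI_ex')
  fix r :: real assume "0 < r" "ereal r < 1"
  thus "summable (\<lambda>n. fps_nth E2_fps n * of_real r ^ n)"
    using E2_fps_sums[of "of_real r"] by (auto simp: sums_iff)
qed

lemma norm_qexp_less_1: "z \<in> UH \<Longrightarrow> norm (qexp 1 z) < 1"
  by (simp add: norm_qexp UH_def)

lemma E2_eval_fps: "z \<in> UH \<Longrightarrow> E2 z = eval_fps E2_fps (qexp 1 z)"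
  using E2_fps_sums[OF norm_qexp_less_1] by (simp add: E2_def eval_fps_def sums_iff)

text \<open>The indices m and -m contribute the same Lambert term with factor -4 pi^2, so B is -8
  pi^2 times the divisor series, which enters \<open>E2\<close> with factor -24.\<close>

lemma E2_csc2:
  fixes B :: complex
  assumes z: "z \<in> UH" and B: "((\<lambda>m. csc2 (of_int m * z)) has_sum B) (-{0})"
  shows "E2 z = 1 + 3 / of_real pi ^ 2 * B"
proof -
  have z': "Im z > 0" using z by (simp add: UH_def)
  from lambert_series[OF norm_qexp_less_1[OF z]] obtain S
    where S1: "((\<lambda>m. qexp 1 z ^ m / (1 - qexp 1 z ^ m)\<^sup>2) has_sum S) {1..}"
      and S2: "(\<lambda>n. of_nat (\<Sum>d | d dvd Suc n. d) * qexp 1 z ^ Suc n) sums S" by blast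
  have "((\<lambda>m. -4 * pi\<^sup>2 * (qexp 1 z ^ m / (1 - qexp 1 z ^ m)\<^sup>2)) has_sum (-4 * pi\<^sup>2 * S)) {1..}"
    using S1 by (rule has_sum_cmult_right)
  hence *: "((\<lambda>m. csc2 (of_nat m * z)) has_sum (-4 * pi\<^sup>2 * S)) {1..}"
    by (simp add: csc2_qexp qexp_pow)
  have "((\<lambda>m::int. csc2 (of_int m * z)) has_sum (-4 * pi\<^sup>2 * S)) (int ` {1..})"
    by (subst has_sum_reindex) (use * in \<open>auto simp: o_def\<close>)
  moreover have "((\<lambda>m::int. csc2 (of_int m * z)) has_sum (-4 * pi\<^sup>2 * S)) ((\<lambda>m. - int m) ` {1..})"
    by (subst has_sum_reindex) (use * in \<open>auto simp: o_def inj_on_def\<close>)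
  ultimately have "((\<lambda>m::int. csc2 (of_int m * z)) has_sum (-4 * pi\<^sup>2 * S + -4 * pi\<^sup>2 * S)) (int ` {1..} \<union> (\<lambda>m. - int m) ` {1..})"
    by (rule has_sum_Un_disjoint) auto
  also have "int ` {1..} \<union> (\<lambda>m. - int m) ` {1..} = - {0}"
  proof -
    have "x \<in> int ` {1..} \<union> (\<lambda>m. - int m) ` {1..}" if "x \<noteq> 0" for x
      using that by (cases x rule: int_cases3) auto
    thus ?thesis by auto
  qed
  finally have "B = -4 * pi\<^sup>2 * S + -4 * pi\<^sup>2 * S" using B by (metis has_sum_unique)
  thus ?thesis using S2 by (simp add: E2_def sums_iff field_simps)
qed

theorem E2_quasimodular:
  assumes "z \<in> UH"
  shows "E2 (- (1 / z)) = z\<^sup>2 * E2 z + 6 * z / (of_real pi * \<i>)"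
proof -
  have z: "Im z > 0" using assms by (simp add: UH_def)
  have z': "- (1 / z) \<in> UH" using z by (auto simp: UH_def Im_divide sum_power2_gt_zero_iff complex_eq_iff)
  from csc2_lattice[OF z] obtain B P where B: "((\<lambda>m. csc2 (of_int m * z)) has_sum B) (-{0})"
    and P: "((\<lambda>m. csc2 (of_int m * (- (1 / z)))) has_sum P) (-{0})"
    and eq: "P + pi\<^sup>2 / 3 = z\<^sup>2 * (B + pi\<^sup>2 / 3) - 2 * of_real pi * \<i> * z" by blast
  have "E2 (- (1 / z)) = 3 / pi\<^sup>2 * (P + pi\<^sup>2 / 3)" using E2_csc2[OF z' P] by (simp add: field_simps)
  also have "\<dots> = z\<^sup>2 * (3 / pi\<^sup>2 * (B + pi\<^sup>2 / 3)) - 6 * \<i> * z / pi"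
    unfolding eq by (simp add: field_simps power2_eq_square)
  also have "3 / pi\<^sup>2 * (B + pi\<^sup>2 / 3) = E2 z" by (simp add: E2_csc2[OF assms B] distrib_left)
  also have "6 * \<i> * z / pi = - (6 * z / (of_real pi * \<i>))" by (simp add: divide_simps)
  finally show ?thesis by simp
qed

section \<open>The modular group\<close>

definition mat2 :: "'a::zero \<Rightarrow> 'a \<Rightarrow> 'a \<Rightarrow> 'a \<Rightarrow> 'a^2^2" where
  "mat2 a b c d = (\<chi> i j. if i = 1 then (if j = 1 then a else b) else (if j = 1 then c else d))"

lemma mat2_nth [simp]:
  "mat2 a b c d $ 1 $ 1 = a" "mat2 a b c d $ 1 $ 2 = b"
  "mat2 a b c d $ 2 $ 1 = c" "mat2 a b c d $ 2 $ 2 = d"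
  by (simp_all add: mat2_def)

lemma mat2_eq_iff: "A = B \<longleftrightarrow> A $ 1 $ 1 = B $ 1 $ 1 \<and> A $ 1 $ 2 = B $ 1 $ 2 \<and>
    A $ 2 $ 1 = B $ 2 $ 1 \<and> A $ 2 $ 2 = B $ 2 $ 2" for A B :: "'a^2^2"
  by (auto simp: vec_eq_iff forall_2)

lemma mat2_surj: "A = mat2 (A $ 1 $ 1) (A $ 1 $ 2) (A $ 2 $ 1) (A $ 2 $ 2)"
  by (simp add: mat2_eq_iff)

lemma mat2_mult_nth:
  "(A ** B) $ i $ j = A $ i $ 1 * B $ 1 $ j + A $ i $ 2 * B $ 2 $ j" for A B :: "'a::semiring_1^2^2"
  by (simp add: matrix_matrix_mult_def sum_2)

lemma mat2_mult: "mat2 a b c d ** mat2 a' b' c' d' =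
    mat2 (a * a' + b * c') (a * b' + b * d') (c * a' + d * c') (c * b' + d * d')"
  for a :: "'a :: semiring_1"
  by (simp add: mat2_eq_iff mat2_mult_nth)

lemma mat2_mv_nth: "(A *v x) $ i = A $ i $ 1 * x $ 1 + A $ i $ 2 * x $ 2" for A :: "'a::semiring_1^2^2"
  by (simp add: matrix_vector_mult_def sum_2)

lemma mat2_one: "mat 1 = mat2 1 0 0 1"
  by (simp add: mat2_eq_iff mat_def)

definition matS :: "int^2^2" where "matS = mat2 0 (-1) 1 0"

lemma matT_eq: "matT = mat2 1 1 0 1"
  by (simp add: matT_def mat2_eq_iff)

lemma SL2Z_iff: "\<gamma> \<in> carrier SL2Z \<longleftrightarrow> \<gamma> $ 1 $ 1 * \<gamma> $ 2 $ 2 - \<gamma> $ 1 $ 2 * \<gamma> $ 2 $ 1 = 1"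
  by (simp add: SL2Z_def det_2)

lemma SL2Z_closed [simp]:
  "matS \<in> carrier SL2Z" "matT \<in> carrier SL2Z" "mat 1 \<in> carrier SL2Z"
  "\<gamma> \<in> carrier SL2Z \<Longrightarrow> \<delta> \<in> carrier SL2Z \<Longrightarrow> \<gamma> ** \<delta> \<in> carrier SL2Z"
  by (simp_all add: SL2Z_iff matS_def matT_eq mat2_one) (simp add: SL2Z_def det_mul flip: SL2Z_iff)

text \<open>The inverses of the generators are positive words, since \<open>(ST)\<^sup>3 = S\<^sup>2\<close> and \<open>S\<^sup>4 = 1\<close>.\<close>

lemma SL2Z_induct [consumes 1, case_names S T mult]:
  assumes "\<gamma> \<in> carrier SL2Z" and S: "P matS" and T: "P matT"
    and mult: "\<And>\<gamma> \<delta>. \<gamma> \<in> carrier SL2Z \<Longrightarrow> \<delta> \<in> carrier SL2Z \<Longrightarrow> P \<gamma> \<Longrightarrow> P \<delta> \<Longrightarrow> P (\<gamma> ** \<delta>)"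
  shows "P \<gamma>"
proof -
  let ?G = "\<lambda>A. A \<in> carrier SL2Z \<and> P A"
  have m: "?G (A ** B)" if "?G A" "?G B" for A B using that mult by auto
  have S': "?G matS" and T': "?G matT" using S T by auto
  have S2: "?G (mat2 (-1) 0 0 (-1))" using m[OF S' S'] by (simp add: matS_def mat2_mult)
  have I: "?G (mat2 1 0 0 1)" using m[OF S2 S2] by (simp add: mat2_mult)
  have ST: "?G (mat2 0 (-1) 1 1)" using m[OF S' T'] by (simp add: matS_def matT_eq mat2_mult)
  have ST2: "?G (mat2 (-1) (-1) 1 0)" using m[OF ST ST] by (simp add: mat2_mult)
  have Ti: "?G (mat2 1 (-1) 0 1)"
    using m[OF m[OF ST2 S'] S2] by (simp add: mat2_mult matS_def)
  have Tn: "?G (mat2 1 (int n) 0 1)" for n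
  proof (induction n)
    case (Suc n)
    from m[OF this T'] show ?case by (simp add: mat2_mult matT_eq add_ac)
  qed (use I in simp)
  have Tm: "?G (mat2 1 (- int n) 0 1)" for n
  proof (induction n)
    case (Suc n)
    from m[OF this Ti] show ?case by (simp add: mat2_mult)
  qed (use I in simp)
  have Tz: "?G (mat2 1 n 0 1)" for n :: int
    using Tn[of "nat n"] Tm[of "nat (- n)"] by (cases "n \<ge> 0") auto
  have "?G \<gamma>"
    using \<open>\<gamma> \<in> carrier SL2Z\<close>
  proof (induction "nat \<bar>\<gamma> $ 2 $ 1\<bar>" arbitrary: \<gamma> rule: less_induct)
    case less
    define a b c d where "a = \<gamma> $ 1 $ 1" "b = \<gamma> $ 1 $ 2" "c = \<gamma> $ 2 $ 1" "d = \<gamma> $ 2 $ 2"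
    have g: "\<gamma> = mat2 a b c d" unfolding a_b_c_d_def by (rule mat2_surj)
    have det: "a * d - b * c = 1" using less.prems by (simp add: g SL2Z_iff)
    show ?case
    proof (cases "c = 0")
      case True
      hence "a * d = 1" using det by simp
      hence "a = 1 \<and> d = 1 \<or> a = -1 \<and> d = -1" by (simp add: zmult_eq_1_iff)
      thus ?thesis using Tz[of b] m[OF S2 Tz[of "-b"]] True by (auto simp: g mat2_mult)
    next
      case False
      \<comment> \<open>One step of the Euclidean algorithm: multiplying on the left by T^(-n) and
        then by S replaces the lower left entry c by a mod c. The way back uses
        \<open>S * S^2\<close> as the inverse of S.\<close>
      define n where "n = a div c"
      have amod: "a - n * c = a mod c" by (simp add: n_def minus_div_mult_eq_mod)
      define \<gamma>' where "\<gamma>' = mat2 (-c) (-d) (a - n * c) (b - n * d)"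
      have "\<bar>a mod c\<bar> < \<bar>c\<bar>" using False by (rule abs_mod_less)
      moreover have "\<gamma>' \<in> carrier SL2Z" using det by (simp add: SL2Z_iff \<gamma>'_def algebra_simps)
      ultimately have "?G \<gamma>'" by (intro less.hyps) (auto simp: \<gamma>'_def g amod)
      from m[OF m[OF Tz[of n] m[OF S' S2]] this] show ?thesis
        by (simp add: \<gamma>'_def g matS_def mat2_mult algebra_simps)
    qed
  qed
  thus ?thesis by simp
qed

section \<open>The action on the upper half-plane and its automorphy factor\<close>

lemma UH_nz: "z \<in> UH \<Longrightarrow> z \<noteq> 0" by (auto simp: UH_def)

lemma mobius_matS: "mobius matS z = - (1 / z)"
  by (simp add: mobius_def matS_def)

lemma mobius_matT: "mobius matT z = z + 1"
  by (simp add: mobius_def matT_eq)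

lemma autf_matS [simp]: "autf matS z = z"
  by (simp add: autf_def matS_def)

lemma autf_matT [simp]: "autf matT z = 1"
  by (simp add: autf_def matT_eq)

lemma autf_nz:
  assumes "\<gamma> \<in> carrier SL2Z" "z \<in> UH"
  shows "autf \<gamma> z \<noteq> 0"
proof
  assume *: "autf \<gamma> z = 0"
  hence "Im (autf \<gamma> z) = 0" by simp
  hence "\<gamma> $ 2 $ 1 = 0" using assms(2) by (simp add: autf_def UH_def)
  with * assms(1) show False by (simp add: autf_def SL2Z_iff)
qed

lemma Im_mobius:
  assumes "\<gamma> \<in> carrier SL2Z" "z \<in> UH"
  shows "Im (mobius \<gamma> z) = Im z / norm (autf \<gamma> z) ^ 2"
proof -
  define a b c d :: real where "a = of_int (\<gamma> $ 1 $ 1)" "b = of_int (\<gamma> $ 1 $ 2)"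
    "c = of_int (\<gamma> $ 2 $ 1)" "d = of_int (\<gamma> $ 2 $ 2)"
  have det: "a * d - b * c = 1" unfolding a_b_c_d_def using assms(1)
    by (simp add: SL2Z_iff flip: of_int_mult of_int_diff)
  have "mobius \<gamma> z = (a * z + b) / (c * z + d)" by (simp add: mobius_def a_b_c_d_def)
  moreover have "autf \<gamma> z = c * z + d" by (simp add: autf_def a_b_c_d_def)
  moreover have "Im ((a * z + b) / (c * z + d)) = Im z * (a * d - b * c) / norm (c * z + d) ^ 2"
  proof -
    have "Im ((a * z + b) / (c * z + d)) =
        (Im (a * z + b) * Re (c * z + d) - Re (a * z + b) * Im (c * z + d)) / norm (c * z + d) ^ 2"
      unfolding cmod_power2 by (rule Im_divide)
    also have "Im (a * z + b) * Re (c * z + d) - Re (a * z + b) * Im (c * z + d) = Im z * (a * d - b * c)"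
      by (simp add: algebra_simps)
    finally show ?thesis .
  qed
  ultimately show ?thesis using det by simp
qed

lemma mobius_UH: "\<gamma> \<in> carrier SL2Z \<Longrightarrow> z \<in> UH \<Longrightarrow> mobius \<gamma> z \<in> UH"
  using Im_mobius[of \<gamma> z] autf_nz[of \<gamma> z] by (simp add: UH_def)

lemma mobius_autf:
  assumes "\<gamma> \<in> carrier SL2Z" "z \<in> UH"
  shows "mobius \<gamma> z * autf \<gamma> z = of_int (\<gamma>$1$1) * z + of_int (\<gamma>$1$2)"
  using autf_nz[OF assms] by (simp add: mobius_def autf_def)

lemma autf_mult:
  assumes "\<delta> \<in> carrier SL2Z" "z \<in> UH"
  shows "autf (\<gamma> ** \<delta>) z = autf \<gamma> (mobius \<delta> z) * autf \<delta> z"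
proof -
  have "autf \<gamma> (mobius \<delta> z) * autf \<delta> z =
      of_int (\<gamma>$2$1) * (mobius \<delta> z * autf \<delta> z) + of_int (\<gamma>$2$2) * autf \<delta> z"
    by (simp only: autf_def[of \<gamma>] distrib_right mult.assoc)
  thus ?thesis unfolding mobius_autf[OF assms]
    by (simp add: autf_def mat2_mult_nth algebra_simps)
qed

lemma mobius_mult:
  assumes "\<gamma> \<in> carrier SL2Z" "\<delta> \<in> carrier SL2Z" "z \<in> UH"
  shows "mobius (\<gamma> ** \<delta>) z = mobius \<gamma> (mobius \<delta> z)"
proof -
  have 1: "autf \<delta> z \<noteq> 0" using assms autf_nz by blast
  have 2: "autf \<gamma> (mobius \<delta> z) \<noteq> 0" using assms autf_nz mobius_UH by blast
  have "mobius (\<gamma> ** \<delta>) z * autf (\<gamma> ** \<delta>) z =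
      of_int (\<gamma>$1$1) * (mobius \<delta> z * autf \<delta> z) + of_int (\<gamma>$1$2) * autf \<delta> z"
    using mobius_autf[OF SL2Z_closed(4)[OF assms(1,2)] assms(3)] mobius_autf[OF assms(2,3)]
    by (simp add: autf_def mat2_mult_nth algebra_simps)
  also have "\<dots> = (of_int (\<gamma>$1$1) * mobius \<delta> z + of_int (\<gamma>$1$2)) * autf \<delta> z"
    by (simp add: algebra_simps)
  also have "of_int (\<gamma>$1$1) * mobius \<delta> z + of_int (\<gamma>$1$2) = mobius \<gamma> (mobius \<delta> z) * autf \<gamma> (mobius \<delta> z)"
    using mobius_autf[OF assms(1) mobius_UH[OF assms(2,3)]] by simp
  finally show ?thesis using 1 2 by (simp add: autf_mult[OF assms(2,3)] mult_ac)
qed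

text \<open>On the orbit of z, only finitely many heights are at least Im z, because such a height
  bounds the bottom row of the matrix. At a point w of maximal height, translated so that |Re w| is
  at most 1/2, S cannot increase the height, whence |w| is at least 1. The bound 1/2 is weaker than
  the sharp sqrt 3 / 2 but keeps the domain away from the real axis.\<close>

lemma fundamental_reduction:
  assumes z: "z \<in> UH"
  shows "\<exists>\<gamma>\<in>carrier SL2Z. \<bar>Re (mobius \<gamma> z)\<bar> \<le> 1 / 2 \<and> Im (mobius \<gamma> z) \<ge> 1 / 2"
proof -
  define V where "V = (\<lambda>\<gamma>. Im (mobius \<gamma> z)) ` {\<gamma> \<in> carrier SL2Z. Im (mobius \<gamma> z) \<ge> Im z}"
  have z0: "Im z > 0" using z by (simp add: UH_def)
  hence "Im z \<noteq> 0" by simp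
  then obtain c where c: "c > 0" "\<forall>x y. c * (\<bar>x\<bar> + \<bar>y\<bar>) \<le> norm (of_real x * z + of_real y)"
    using lattice_norm_bound by blast
  define K where "K = \<lceil>1 / c\<rceil>"
  have "V \<subseteq> (\<lambda>(x,y). Im z / norm (of_int x * z + of_int y) ^ 2) ` ({-K..K} \<times> {-K..K})"
  proof
    fix v assume "v \<in> V"
    then obtain \<gamma> where g: "\<gamma> \<in> carrier SL2Z" "v = Im (mobius \<gamma> z)" "v \<ge> Im z" by (auto simp: V_def)
    have v: "v = Im z / norm (autf \<gamma> z) ^ 2" using Im_mobius[OF g(1) z] g(2) by simp
    have "norm (autf \<gamma> z) > 0" using autf_nz[OF g(1) z] by simp
    hence "norm (autf \<gamma> z) ^ 2 \<le> 1" using g(3) z0 unfolding v by (simp add: field_simps)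
    hence "norm (autf \<gamma> z) \<le> 1" by (simp add: power_le_one_iff)
    moreover have "c * (\<bar>of_int (\<gamma>$2$1)\<bar> + \<bar>of_int (\<gamma>$2$2)\<bar>) \<le> norm (autf \<gamma> z)"
      using c(2)[rule_format, of "of_int (\<gamma>$2$1)" "of_int (\<gamma>$2$2)"] by (simp add: autf_def)
    ultimately have "c * (\<bar>of_int (\<gamma>$2$1)\<bar> + \<bar>of_int (\<gamma>$2$2)\<bar>) \<le> 1" by linarith
    hence *: "\<bar>of_int (\<gamma>$2$1)\<bar> + \<bar>of_int (\<gamma>$2$2)\<bar> \<le> 1 / c" using c(1) by (simp add: field_simps)
    hence "\<bar>of_int (\<gamma>$2$1)\<bar> \<le> 1 / c" "\<bar>of_int (\<gamma>$2$2)\<bar> \<le> 1 / c" by linarith+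
    hence "\<bar>\<gamma>$2$1\<bar> \<le> K" "\<bar>\<gamma>$2$2\<bar> \<le> K" unfolding K_def by linarith+
    thus "v \<in> (\<lambda>(x,y). Im z / norm (of_int x * z + of_int y) ^ 2) ` ({-K..K} \<times> {-K..K})"
      by (intro image_eqI[where x = "(\<gamma>$2$1, \<gamma>$2$2)"]) (auto simp: v autf_def)
  qed
  hence fin: "finite V" by (rule finite_subset) auto
  have "Im z \<in> V" unfolding V_def
    by (rule image_eqI[where x = "mat 1"]) (auto simp: mobius_def mat2_one SL2Z_iff)
  hence ne: "V \<noteq> {}" by auto
  from Max_in[OF fin ne] obtain \<gamma> where g: "\<gamma> \<in> carrier SL2Z" "Im (mobius \<gamma> z) = Max V" "Im (mobius \<gamma> z) \<ge> Im z"
    unfolding V_def by auto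
  have le: "Im (mobius \<delta> z) \<le> Im (mobius \<gamma> z)" if "\<delta> \<in> carrier SL2Z" for \<delta>
  proof (cases "Im (mobius \<delta> z) \<ge> Im z")
    case True
    hence "Im (mobius \<delta> z) \<in> V" using that by (auto simp: V_def)
    thus ?thesis using g(2) fin by simp
  qed (use g(3) in auto)
  define n where "n = - round (Re (mobius \<gamma> z))"
  define \<delta> where "\<delta> = mat2 1 n 0 1 ** \<gamma>"
  define w where "w = mobius \<delta> z"
  have N: "mat2 1 n 0 1 \<in> carrier SL2Z" by (simp add: SL2Z_iff)
  have d: "\<delta> \<in> carrier SL2Z" unfolding \<delta>_def using N g(1) by (rule SL2Z_closed)
  have w: "w = mobius \<gamma> z + of_int n"
    unfolding w_def \<delta>_def mobius_mult[OF N g(1) z] by (simp add: mobius_def[of "mat2 1 n 0 1"])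
  have wUH: "w \<in> UH" unfolding w_def by (rule mobius_UH[OF d z])
  have re: "\<bar>Re w\<bar> \<le> 1 / 2"
    using of_int_round_abs_le[of "Re (mobius \<gamma> z)"] unfolding w n_def by (simp add: abs_minus_commute)
  have "Im (mobius (matS ** \<delta>) z) \<le> Im w"
    using le[of "matS ** \<delta>"] d by (simp add: w)
  also have "Im (mobius (matS ** \<delta>) z) = Im w / norm w ^ 2"
    using Im_mobius[of matS w] wUH by (simp add: mobius_mult d z w_def)
  finally have "Im w / norm w ^ 2 \<le> Im w" .
  moreover have "norm w > 0" "Im w > 0" using wUH by (auto simp: UH_def)
  ultimately have "norm w ^ 2 \<ge> 1" by (simp add: field_simps)
  hence "(Re w)\<^sup>2 + (Im w)\<^sup>2 \<ge> 1" by (simp add: cmod_power2)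
  moreover have "(Re w)\<^sup>2 \<le> (1/2)\<^sup>2" using re by (metis power2_abs power_mono abs_ge_zero)
  ultimately have "(1/2)\<^sup>2 \<le> (Im w)\<^sup>2" by (simp add: power_divide)
  hence "Im w \<ge> 1 / 2" using \<open>Im w > 0\<close> by (meson less_imp_le power2_le_imp_le)
  with re d show ?thesis unfolding w_def by blast
qed

lemma open_UH: "open UH" and convex_UH: "convex UH" and connected_UH: "connected UH"
proof -
  show "open UH" unfolding UH_def by (rule open_halfspace_Im_gt)
  show "convex UH" unfolding UH_def by (rule convex_halfspace_Im_gt)
  thus "connected UH" by (rule convex_connected)
qed

section \<open>Forms of negative weight vanish\<close>

text \<open>The function |h| (Im z)^(-s/2) is invariant and tends to 0 at the cusp, so if it is not
  identically zero it attains a positive maximum on a truncated fundamental domain. Near such a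
  point its logarithm would be strictly subharmonic, since -ln (Im z) is; the proof turns this into
  an application of the maximum modulus principle.\<close>

lemma negative_weight_zero:
  fixes h :: "complex \<Rightarrow> complex" and s :: real
  assumes hol: "h holomorphic_on UH" and s: "s > 0"
    and inv_S: "\<And>z. z \<in> UH \<Longrightarrow> norm (h (- (1 / z))) = norm z powr (- s) * norm (h z)"
    and inv_T: "\<And>z. z \<in> UH \<Longrightarrow> norm (h (z + 1)) = norm (h z)"
    and bdd: "\<And>z. z \<in> UH \<Longrightarrow> Im z \<ge> Y \<Longrightarrow> norm (h z) \<le> B"
    and z: "z \<in> UH"
  shows "h z = 0"
proof (rule ccontr)
  assume hz: "h z \<noteq> 0"
  define \<phi> where "\<phi> z = norm (h z) * Im z powr (- s / 2)" for z
  have inv: "\<forall>z\<in>UH. \<phi> (mobius \<gamma> z) = \<phi> z" if "\<gamma> \<in> carrier SL2Z" for \<gamma>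
    using that
  proof (induction rule: SL2Z_induct)
    case S
    show ?case
    proof
      fix z assume z: "z \<in> UH"
      have Im: "Im (- (1 / z)) = Im z / norm z ^ 2"
        using Im_mobius[of matS z] z by (simp add: mobius_matS)
      have nz: "norm z > 0" using UH_nz[OF z] by simp
      have "norm z ^ 2 = norm z powr 2" using nz by simp
      moreover have "(norm z powr 2) powr (- s / 2) = norm z powr (- s)" by (subst powr_powr) simp
      ultimately have "(norm z ^ 2) powr (- s / 2) = norm z powr (- s)" by (simp only:)
      moreover have "(Im z / norm z ^ 2) powr (- s / 2) = Im z powr (- s / 2) / (norm z ^ 2) powr (- s / 2)"
        by (rule powr_divide)
      ultimately have "norm z powr - s * (Im z / norm z ^ 2) powr (- s / 2) = Im z powr (- s / 2)"
        using nz by simp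
      thus "\<phi> (mobius matS z) = \<phi> z"
        unfolding \<phi>_def mobius_matS Im inv_S[OF z] by (simp only: mult_ac)
    qed
  next
    case T
    show ?case by (simp add: mobius_matT \<phi>_def inv_T)
  next
    case (mult \<gamma> \<delta>)
    show ?case
    proof
      fix z assume z: "z \<in> UH"
      have "\<phi> (mobius (\<gamma> ** \<delta>) z) = \<phi> (mobius \<gamma> (mobius \<delta> z))" using mult.hyps z by (simp only: mobius_mult)
      also have "\<dots> = \<phi> (mobius \<delta> z)" using mult.IH(1) mobius_UH[OF mult.hyps(2) z] by blast
      also have "\<dots> = \<phi> z" using mult.IH(2) z by blast
      finally show "\<phi> (mobius (\<gamma> ** \<delta>) z) = \<phi> z" .
    qed
  qed
  have \<phi>z: "\<phi> z > 0" using hz z by (simp add: \<phi>_def UH_def)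
  have "((\<lambda>y. B * y powr (- s / 2)) \<longlongrightarrow> B * 0) at_top"
    using s by (intro tendsto_intros tendsto_neg_powr filterlim_ident) auto
  hence "eventually (\<lambda>y. B * y powr (- s / 2) < \<phi> z) at_top"
    using \<phi>z by (auto simp: order_tendstoD)
  then obtain Y1 where Y1: "\<And>y. y \<ge> Y1 \<Longrightarrow> B * y powr (- s / 2) < \<phi> z"
    by (auto simp: eventually_at_top_linorder)
  define Y2 where "Y2 = max 1 (max Y Y1)"
  have small: "\<phi> w < \<phi> z" if "Im w \<ge> Y2" for w
  proof -
    have w: "w \<in> UH" "Im w \<ge> Y" "Im w \<ge> Y1" using that by (auto simp: Y2_def UH_def)
    have "\<phi> w \<le> B * Im w powr (- s / 2)" unfolding \<phi>_def by (intro mult_right_mono bdd w) auto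
    also have "\<dots> < \<phi> z" by (rule Y1[OF w(3)])
    finally show ?thesis .
  qed
  define K where "K = cbox (Complex (- 1 / 2) (1 / 2)) (Complex (1 / 2) Y2)"
  have KUH: "K \<subseteq> UH" by (auto simp: K_def UH_def in_cbox_complex_iff)
  have "compact K" by (simp add: K_def)
  have "K \<noteq> {}" by (auto simp: K_def Y2_def box_ne_empty Basis_complex_def)
  have "continuous_on K \<phi>"
    unfolding \<phi>_def using KUH
    by (intro continuous_intros continuous_on_subset[OF holomorphic_on_imp_continuous_on[OF hol]])
       (auto simp: UH_def)
  from continuous_attains_sup[OF \<open>compact K\<close> \<open>K \<noteq> {}\<close> this]
  obtain p where p: "p \<in> K" and pmax: "\<And>w. w \<in> K \<Longrightarrow> \<phi> w \<le> \<phi> p" by blast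
  have red: "\<exists>w'. \<phi> w' = \<phi> w \<and> (w' \<in> K \<or> Im w' \<ge> Y2)" if w: "w \<in> UH" for w
  proof -
    obtain \<gamma> where g: "\<gamma> \<in> carrier SL2Z" "\<bar>Re (mobius \<gamma> w)\<bar> \<le> 1 / 2" "Im (mobius \<gamma> w) \<ge> 1 / 2"
      using fundamental_reduction[OF w] by blast
    thus ?thesis using inv[OF g(1)] w
      by (intro exI[of _ "mobius \<gamma> w"]) (auto simp: K_def in_cbox_complex_iff abs_le_iff)
  qed
  have "\<phi> z \<le> \<phi> p" using red[OF z] pmax small by (metis less_irrefl)
  hence gmax: "\<phi> w \<le> \<phi> p" if "w \<in> UH" for w
    using red[OF that] pmax small by (metis less_le_trans less_imp_le)
  have pUH: "p \<in> UH" using p KUH by blast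
  define y where "y = Im p"
  have y: "y > 0" using pUH by (simp add: y_def UH_def)
  text \<open>Multiplying by an exponential of the tangent line of \<open>ln\<close> at \<open>y\<close> majorises the
    real-analytic factor of \<open>\<phi>\<close> by the modulus of a holomorphic function.\<close>
  define g where "g w = h w * exp (\<i> * of_real (s / (2 * y)) * w)" for w
  have norm_g: "norm (g w) = norm (h w) * exp (- s / (2 * y) * Im w)" for w
    by (simp add: g_def norm_mult)
  have bound: "norm (g w) = \<phi> w * exp (s / 2 * (ln (Im w) - Im w / y))" if "w \<in> UH" for w
    using that unfolding norm_g \<phi>_def
    by (simp add: UH_def powr_def mult.assoc flip: exp_add) (simp add: algebra_simps)
  have tangent: "ln t - t / y \<le> ln y - 1" if "t > 0" for t
    using ln_le_minus_one[of "t / y"] y that by (simp add: ln_div)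
  have "norm (g w) \<le> norm (g p)" if w: "w \<in> UH" for w
  proof -
    have "norm (g w) \<le> \<phi> p * exp (s / 2 * (ln y - 1))"
      unfolding bound[OF w] using w s gmax[OF w] tangent[of "Im w"]
      by (intro mult_mono) (auto simp: UH_def \<phi>_def)
    also have "\<dots> = norm (g p)" unfolding bound[OF pUH] using y by (simp add: y_def)
    finally show ?thesis .
  qed
  moreover have "g holomorphic_on UH" unfolding g_def by (intro holomorphic_intros hol)
  ultimately have "g constant_on UH"
    using maximum_modulus_principle[of g UH UH p] open_UH connected_UH pUH by blast
  then obtain c where c: "\<And>w. w \<in> UH \<Longrightarrow> g w = c" by (auto simp: constant_on_def)
  \<comment> \<open>The height 2y differs from y, so the tangent inequality for \<open>ln\<close> is
    strict there. As \<open>g\<close> is constant, this would give 1 at most ln 2.\<close>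
  define w where "w = Complex 0 (2 * y)"
  have w: "w \<in> UH" using y by (simp add: w_def UH_def)
  have "\<phi> p * exp (s / 2 * (ln y - 1)) = norm (g p)" unfolding bound[OF pUH] using y by (simp add: y_def)
  also have "\<dots> = norm (g w)" using c w pUH by simp
  also have "\<dots> = \<phi> w * exp (s / 2 * (ln (2 * y) - 2))" unfolding bound[OF w] using y by (simp add: w_def)
  also have "\<dots> \<le> \<phi> p * exp (s / 2 * (ln (2 * y) - 2))" using gmax[OF w] by (intro mult_right_mono) auto
  finally have "exp (s / 2 * (ln y - 1)) \<le> exp (s / 2 * (ln (2 * y) - 2))"
    using \<open>\<phi> z \<le> \<phi> p\<close> \<phi>z by simp
  hence "ln y - 1 \<le> ln (2 * y) - 2" using s by simp
  hence "(1::real) \<le> ln 2" using y by (simp add: ln_mult)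
  moreover have "ln 2 < (1::real)" using ln_less_self[of 2] ln2_le_25_over_36 by simp
  ultimately show False by simp
qed

section \<open>Multiplier systems\<close>

lemma powr_of_int_mult:
  fixes x y :: complex
  assumes "x \<noteq> 0" "y \<noteq> 0"
  shows "(x * y) powr of_int n = x powr of_int n * y powr of_int n"
  by (cases n rule: int_cases2) (use assms in \<open>simp_all add: powr_minus powr_nat' power_mult_distrib\<close>)

definition autj :: "real \<Rightarrow> (int^2^2 \<Rightarrow> complex) \<Rightarrow> int^2^2 \<Rightarrow> complex \<Rightarrow> complex" where
  "autj k \<upsilon> \<gamma> z = inverse (\<upsilon> \<gamma>) * autf \<gamma> z powr (- of_real k)"

lemma slash_autj: "slash k \<upsilon> \<gamma> f z = autj k \<upsilon> \<gamma> z * f (mobius \<gamma> z)"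
  by (simp add: slash_def autj_def)

text \<open>The slash operators act on all functions exactly when the factors \<open>autj\<close>
  form a cocycle; the constant function 1 recovers the factor from the operator.\<close>

lemma multiplier_system_iff:
  "multiplier_system k \<upsilon> \<longleftrightarrow> (\<forall>\<gamma>\<in>carrier SL2Z. cmod (\<upsilon> \<gamma>) = 1) \<and>
     (\<forall>z\<in>UH. autj k \<upsilon> (mat 1) z = 1) \<and>
     (\<forall>\<gamma>\<in>carrier SL2Z. \<forall>\<delta>\<in>carrier SL2Z. \<forall>z\<in>UH.
        autj k \<upsilon> \<delta> z * autj k \<upsilon> \<gamma> (mobius \<delta> z) = autj k \<upsilon> (\<gamma> ** \<delta>) z)" (is "_ = (?U \<and> ?I \<and> ?C)")
proof
  assume L: "multiplier_system k \<upsilon>"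
  have "(\<lambda>_. 1) holomorphic_on UH" by (rule holomorphic_on_const)
  with L show "?U \<and> ?I \<and> ?C" unfolding multiplier_system_def slash_autj by fastforce
next
  assume R: "?U \<and> ?I \<and> ?C"
  have "mobius (mat 1) z = z" for z by (simp add: mobius_def mat2_one)
  moreover have "slash k \<upsilon> \<delta> (slash k \<upsilon> \<gamma> f) z = slash k \<upsilon> (\<gamma> ** \<delta>) f z"
    if "\<gamma> \<in> carrier SL2Z" "\<delta> \<in> carrier SL2Z" "z \<in> UH" for \<gamma> \<delta> z f
    using R that by (simp add: slash_autj mobius_mult mult.assoc[symmetric])
  ultimately show "multiplier_system k \<upsilon>" using R unfolding multiplier_system_def by (simp add: slash_autj)
qed

lemma autf_one [simp]: "autf (mat 1) z = 1"
  by (simp add: autf_def mat2_one)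

lemma autj_shift: "autj (k + of_int n) \<upsilon> \<gamma> z = autj k \<upsilon> \<gamma> z * autf \<gamma> z powr of_int (- n)"
  by (simp add: autj_def powr_diff powr_add powr_minus divide_inverse mult_ac)

text \<open>Powers with integer exponents are multiplicative for every branch of the argument, so
  the additional factor is itself a cocycle.\<close>

lemma multiplier_system_shift:
  assumes "multiplier_system k \<upsilon>"
  shows "multiplier_system (k + of_int n) \<upsilon>"
proof -
  have 1: "autf \<delta> z powr of_int (- n) * autf \<gamma> (mobius \<delta> z) powr of_int (- n) = autf (\<gamma> ** \<delta>) z powr of_int (- n)"
    if "\<gamma> \<in> carrier SL2Z" "\<delta> \<in> carrier SL2Z" "z \<in> UH" for \<gamma> \<delta> z
    unfolding autf_mult[OF that(2,3)]
    by (subst powr_of_int_mult) (use that mobius_UH autf_nz in auto)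
  have 2: "autj k \<upsilon> \<delta> z * autf \<delta> z powr of_int (- n) * (autj k \<upsilon> \<gamma> w * autf \<gamma> w powr of_int (- n))
     = (autj k \<upsilon> \<delta> z * autj k \<upsilon> \<gamma> w) * (autf \<delta> z powr of_int (- n) * autf \<gamma> w powr of_int (- n))" for \<gamma> \<delta> z w
    by (simp only: mult_ac)
  have 3: "autj k \<upsilon> \<delta> z * autj k \<upsilon> \<gamma> (mobius \<delta> z) = autj k \<upsilon> (\<gamma> ** \<delta>) z"
    if "\<gamma> \<in> carrier SL2Z" "\<delta> \<in> carrier SL2Z" "z \<in> UH" for \<gamma> \<delta> z
    using assms that unfolding multiplier_system_iff by blast
  show ?thesis unfolding multiplier_system_iff autj_shift
  proof (intro conjI ballI)
    show "cmod (\<upsilon> \<gamma>) = 1" if "\<gamma> \<in> carrier SL2Z" for \<gamma>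
      using assms that unfolding multiplier_system_iff by blast
    show "autj k \<upsilon> (mat 1) z * autf (mat 1) z powr of_int (- n) = 1" if "z \<in> UH" for z
      using assms that unfolding multiplier_system_iff by simp
  qed (simp only: 1 2 3)
qed

abbreviation "neg1 \<equiv> mat2 (-1) 0 0 (-1) :: int^2^2"

lemma matS_sq: "matS ** matS = neg1"
  by (simp add: matS_def mat2_mult)

lemma neg1_sq: "neg1 ** neg1 = mat 1"
  by (simp add: mat2_mult mat2_one)

lemma neg1_carrier [simp]: "neg1 \<in> carrier SL2Z" by (simp add: SL2Z_iff)

lemma matST_cube: "(matS ** matT) ** ((matS ** matT) ** (matS ** matT)) = neg1"
  by (simp add: matS_def matT_eq mat2_mult)

lemma mobius_neg1 [simp]: "mobius neg1 z = z" and autf_neg1 [simp]: "autf neg1 z = -1"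
  by (simp_all add: mobius_def autf_def)

section \<open>Values of a multiplier system at the generators\<close>

context
  fixes k :: real and \<upsilon> :: "int^2^2 \<Rightarrow> complex"
  assumes ms: "multiplier_system k \<upsilon>"
begin

lemma upsilon_nz: "\<gamma> \<in> carrier SL2Z \<Longrightarrow> \<upsilon> \<gamma> \<noteq> 0"
  using ms unfolding multiplier_system_iff by force

lemma autj_nz: "\<gamma> \<in> carrier SL2Z \<Longrightarrow> z \<in> UH \<Longrightarrow> autj k \<upsilon> \<gamma> z \<noteq> 0"
  using upsilon_nz autf_nz by (simp add: autj_def)

lemma autj_mult: "\<gamma> \<in> carrier SL2Z \<Longrightarrow> \<delta> \<in> carrier SL2Z \<Longrightarrow> z \<in> UH \<Longrightarrow>
   autj k \<upsilon> (\<gamma> ** \<delta>) z = autj k \<upsilon> \<delta> z * autj k \<upsilon> \<gamma> (mobius \<delta> z)"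
  using ms unfolding multiplier_system_iff by simp

lemma autj_one: "z \<in> UH \<Longrightarrow> autj k \<upsilon> (mat 1) z = 1"
  using ms unfolding multiplier_system_iff by simp

lemma autj_neg1: "autj k \<upsilon> neg1 z = inverse (\<upsilon> neg1) * exp (- (\<i> * of_real (pi * k)))"
  by (simp add: autj_def powr_def mult_ac)

text \<open>The matrix -1 fixes every point and has automorphy factor -1, so applying the cocycle
  relation to its square shows that \<upsilon> determines its weight modulo the integers.\<close>

lemma exp_weight: "exp (2 * of_real pi * \<i> * of_real k) = inverse (\<upsilon> neg1) ^ 2"
proof -
  have i: "\<i> \<in> UH" by (simp add: UH_def)
  have "autj k \<upsilon> neg1 \<i> * autj k \<upsilon> neg1 \<i> = 1"
    using autj_mult[OF neg1_carrier neg1_carrier i] autj_one[OF i] by (simp only: neg1_sq mobius_neg1)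
  hence "inverse (\<upsilon> neg1) ^ 2 * exp (- (\<i> * of_real (pi * k))) ^ 2 = 1"
    unfolding autj_neg1 by (simp add: power2_eq_square mult_ac)
  also have "exp (- (\<i> * of_real (pi * k))) ^ 2 = exp (- (2 * of_real pi * \<i> * of_real k))"
    by (simp add: mult_ac flip: exp_double)
  finally have "inverse (\<upsilon> neg1) ^ 2 * exp (- (2 * of_real pi * \<i> * of_real k)) = 1" .
  thus ?thesis by (simp add: exp_minus field_simps)
qed

text \<open>At the fixed point i of S the cocycle relation becomes an identity of numbers, and the
  principal power of i squares to that of -1. So the branch leaves no extra factor.\<close>

lemma upsilon_S: "\<upsilon> matS ^ 2 = \<upsilon> neg1"
proof -
  have i: "\<i> \<in> UH" by (simp add: UH_def)
  have m: "mobius matS \<i> = \<i>" by (simp add: mobius_matS)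
  have "autj k \<upsilon> neg1 \<i> = autj k \<upsilon> matS \<i> ^ 2"
    using autj_mult[of matS matS \<i>] i unfolding matS_sq m by (simp add: power2_eq_square)
  also have "autj k \<upsilon> matS \<i> = inverse (\<upsilon> matS) * exp (- (\<i> * of_real (pi * k) / 2))"
    by (simp add: autj_def powr_def mult_ac)
  also have "(inverse (\<upsilon> matS) * exp (- (\<i> * of_real (pi * k) / 2))) ^ 2 =
      inverse (\<upsilon> matS) ^ 2 * exp (- (\<i> * of_real (pi * k)))"
    by (simp add: power_mult_distrib flip: exp_double)
  finally have "inverse (\<upsilon> neg1) = inverse (\<upsilon> matS) ^ 2" unfolding autj_neg1 by simp
  thus ?thesis by (simp add: power_inverse)
qed

lemma upsilon_ST: "\<upsilon> (matS ** matT) = \<upsilon> matS * \<upsilon> matT"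
proof -
  have i: "\<i> \<in> UH" "\<i> + 1 \<in> UH" by (simp_all add: UH_def)
  have "autj k \<upsilon> (matS ** matT) \<i> = autj k \<upsilon> matT \<i> * autj k \<upsilon> matS (\<i> + 1)"
    using autj_mult[of matS matT \<i>] i by (simp add: mobius_matT)
  moreover have "autf (matS ** matT) \<i> = \<i> + 1" by (simp add: autf_def matS_def matT_eq mat2_mult)
  ultimately have "inverse (\<upsilon> (matS ** matT)) = inverse (\<upsilon> matS * \<upsilon> matT)"
    using UH_nz[OF i(2)] by (simp add: autj_def)
  thus ?thesis by (simp only: inverse_eq_iff_eq)
qed

text \<open>The same evaluation as for S, now at the fixed point of S T, a primitive cube root of
  unity. Its automorphy factor exp(pi i / 3) has a principal power whose cube is that of -1.\<close>

lemma upsilon_ST_cube: "\<upsilon> (matS ** matT) ^ 3 = \<upsilon> neg1"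
proof -
  define w where "w = cis (2 * pi / 3)"
  have w_eq: "w = Complex (- 1 / 2) (sqrt 3 / 2)"
    by (simp add: w_def complex_eq_iff cos_120 sin_120)
  have w: "w \<in> UH" by (simp add: w_eq UH_def)
  have w1: "w + 1 = cis (pi / 3)" by (simp add: w_eq complex_eq_iff cos_60 sin_60)
  have ST: "matS ** matT \<in> carrier SL2Z" by simp
  have "w * (w + 1) = -1" unfolding w_eq by (simp add: complex_eq_iff algebra_simps)
  moreover have "w + 1 \<noteq> 0" unfolding w1 by simp
  ultimately have m: "mobius (matS ** matT) w = w"
    by (simp add: mobius_def matS_def matT_eq mat2_mult field_simps)
  have "autj k \<upsilon> neg1 w = autj k \<upsilon> (matS ** matT) w ^ 3"
  proof -
    define R where "R = matS ** matT"
    have R: "R \<in> carrier SL2Z" "R ** R \<in> carrier SL2Z" "mobius R w = w" "R ** (R ** R) = neg1"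
      using m matST_cube by (simp_all add: R_def)
    have "mobius (R ** R) w = w" using R w by (simp add: mobius_mult)
    hence "autj k \<upsilon> (R ** (R ** R)) w = autj k \<upsilon> R w ^ 3"
      by (simp add: autj_mult R w power3_eq_cube del: R(4))
    hence "autj k \<upsilon> neg1 w = autj k \<upsilon> R w ^ 3" by (simp only: R(4))
    thus ?thesis by (simp only: R_def)
  qed
  also have "autj k \<upsilon> (matS ** matT) w = inverse (\<upsilon> (matS ** matT)) * exp (- (\<i> * of_real (pi * k) / 3))"
  proof -
    have A: "autf (matS ** matT) w = cis (pi / 3)"
      unfolding w1[symmetric] by (simp add: autf_def matS_def matT_eq mat2_mult)
    have L: "Ln (cis (pi / 3)) = of_real (pi / 3) * \<i>" by (rule Ln_cis) (simp add: less_trans[of _ 0])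
    have "autj k \<upsilon> (matS ** matT) w =
        inverse (\<upsilon> (matS ** matT)) * exp (- of_real k * (of_real (pi / 3) * \<i>))"
      by (simp only: autj_def powr_def A L cis_neq_zero if_False)
    thus ?thesis by (simp add: mult_ac)
  qed
  also have "(inverse (\<upsilon> (matS ** matT)) * exp (- (\<i> * of_real (pi * k) / 3))) ^ 3 =
      inverse (\<upsilon> (matS ** matT)) ^ 3 * exp (- (\<i> * of_real (pi * k)))"
    by (simp add: power_mult_distrib flip: exp_of_nat_mult)
  finally have "inverse (\<upsilon> neg1) = inverse (\<upsilon> (matS ** matT)) ^ 3" unfolding autj_neg1 by simp
  thus ?thesis by (simp add: power_inverse)
qed

text \<open>The relation (S T)^3 = S^2 gives
  \<open>\<upsilon> matS * \<upsilon> matT ^ 3 = 1\<close>, and \<open>\<upsilon> matS ^ 4\<close>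
  is known through \<open>exp_weight\<close>. This ties the cusp parameter to the weight and is what
  later makes \<open>k0\<close> a weight of \<upsilon>.\<close>

lemma upsilon_T_pow12: "\<upsilon> matT ^ 12 = exp (2 * of_real pi * \<i> * of_real k)"
proof -
  have nz: "\<upsilon> matS \<noteq> 0" "\<upsilon> neg1 \<noteq> 0" by (simp_all add: upsilon_nz)
  have "(\<upsilon> matS * \<upsilon> matT) ^ 3 = \<upsilon> matS ^ 2"
    using upsilon_ST_cube upsilon_S by (simp add: upsilon_ST)
  hence "\<upsilon> matS ^ 2 * (\<upsilon> matS * \<upsilon> matT ^ 3) = \<upsilon> matS ^ 2 * 1"
    by (simp add: power_mult_distrib power3_eq_cube power2_eq_square mult_ac)
  hence "\<upsilon> matS * \<upsilon> matT ^ 3 = 1" using nz(1) by (metis mult_left_cancel power_not_zero)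
  hence "\<upsilon> matT ^ 3 = inverse (\<upsilon> matS)" using nz(1) by (simp add: field_simps)
  hence "(\<upsilon> matT ^ 3) ^ 4 = inverse (\<upsilon> matS) ^ 4" by simp
  also have "\<dots> = inverse ((\<upsilon> matS ^ 2) ^ 2)" by (simp add: power_inverse)
  also have "\<dots> = inverse (\<upsilon> neg1) ^ 2" unfolding upsilon_S by (simp add: power_inverse)
  finally show ?thesis using exp_weight by (simp flip: power_mult)
qed

end

lemma exp_2pii_eq_imp_Ints:
  assumes "exp (2 * of_real pi * \<i> * of_real x) = exp (2 * of_real pi * \<i> * of_real y)"
  shows "x - y \<in> \<int>"
proof -
  obtain n :: int where "2 * of_real pi * \<i> * of_real x = 2 * of_real pi * \<i> * of_real y + (of_int (2 * n) * pi) * \<i>"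
    using assms unfolding exp_eq by blast
  hence "(2 * of_real pi * \<i>) * complex_of_real x = (2 * of_real pi * \<i>) * of_real (y + of_int n)"
    by (simp add: algebra_simps)
  hence "complex_of_real x = of_real (y + of_int n)" by simp
  hence "x = y + of_int n" by (simp only: of_real_eq_iff)
  thus ?thesis by simp
qed

lemma multiplier_weights_iff:
  assumes "multiplier_system k \<upsilon>"
  shows "k' \<in> multiplier_weights \<upsilon> \<longleftrightarrow> k' - k \<in> \<int>"
proof
  assume "k' \<in> multiplier_weights \<upsilon>"
  hence "multiplier_system k' \<upsilon>" by (simp add: multiplier_weights_def)
  from exp_weight[OF this] exp_weight[OF assms] show "k' - k \<in> \<int>"
    by (intro exp_2pii_eq_imp_Ints) simp
next
  assume "k' - k \<in> \<int>"
  then obtain n where "k' = k + of_int n" by (auto elim!: Ints_cases simp: algebra_simps)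
  thus "k' \<in> multiplier_weights \<upsilon>"
    using multiplier_system_shift[OF assms] by (simp add: multiplier_weights_def)
qed

text \<open>
  If \<open>S\<^sup>2 = (S T)\<^sup>3\<close> is scalar, \<open>T\<close> is diagonal and \<open>S\<close> is not, then the Cayley-Hamilton theorem for
  \<open>S\<close> and \<open>S T\<close> determines \<open>S\<close> by the eigenvalues of \<open>T\<close>, up to conjugation by diagonal matrices.
\<close>

lemma S_matrix_determined_by_T:
  fixes a b c d t1 t2 e :: complex
  assumes "a * a + b * c = e" "b * (a + d) = 0" "c * (a + d) = 0" "e \<noteq> 0" "t1 \<noteq> 0" "t2 \<noteq> 0"
    and "mat2 a b c d ** mat2 t1 0 0 t2 ** (mat2 a b c d ** mat2 t1 0 0 t2 ** (mat2 a b c d ** mat2 t1 0 0 t2)) = mat2 e 0 0 e"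
    and "b \<noteq> 0 \<or> c \<noteq> 0"
  shows "d = - a" "a * (t1 - t2) * (t1 * t2) = 1" "e * (t1 * t2) ^ 3 = -1" "b * c = e - a ^ 2"
proof -
  show d: "d = - a" using assms by (auto simp: add_eq_0_iff)
  show bc: "b * c = e - a ^ 2" using assms(1) by (simp add: power2_eq_square algebra_simps)
  \<comment> \<open>These are the trace and the determinant of S T. By Cayley-Hamilton its cube is
    (\<tau>^2 - \<delta>) S T - \<tau> \<delta>. As this is scalar and one off-diagonal entry of S
    is nonzero, \<tau>^2 = \<delta> and -\<tau> \<delta> = e.\<close>
  define \<tau> where "\<tau> = a * (t1 - t2)"
  define \<delta> where "\<delta> = - e * t1 * t2"
  note m = assms(7)[unfolded d mat2_mult mat2_eq_iff mat2_nth, simplified]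
  have "b * t2 * (\<tau> ^ 2 - \<delta>) = a * t1 * (a * t1 * (b * t2) - b * t2 * (a * t2)) + b * t2 * (c * t1 * (b * t2) + a * t2 * (a * t2))"
    unfolding \<tau>_def \<delta>_def assms(1)[symmetric] by (simp add: algebra_simps power2_eq_square)
  also have "\<dots> = 0" using m by simp
  finally have eq2: "b * t2 * (\<tau> ^ 2 - \<delta>) = 0" .
  have "c * t1 * (\<tau> ^ 2 - \<delta>) = c * t1 * (a * t1 * (a * t1) + b * t2 * (c * t1)) - a * t2 * (c * t1 * (a * t1) - a * t2 * (c * t1))"
    unfolding \<tau>_def \<delta>_def assms(1)[symmetric] by (simp add: algebra_simps power2_eq_square)
  also have "\<dots> = 0" using m by simp
  finally have eq3: "c * t1 * (\<tau> ^ 2 - \<delta>) = 0" .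
  have eq1: "a * t1 * (a * t1 * (a * t1) + b * t2 * (c * t1)) + b * t2 * (c * t1 * (a * t1) - a * t2 * (c * t1)) = e"
    using m by simp
  have \<tau>2: "\<tau> ^ 2 = \<delta>" using eq2 eq3 assms by auto
  have "a * t1 * (a * t1 * (a * t1) + b * t2 * (c * t1)) + b * t2 * (c * t1 * (a * t1) - a * t2 * (c * t1))
     = (\<tau> ^ 2 - \<delta>) * (a * t1) - \<tau> * \<delta>"
    unfolding \<tau>_def \<delta>_def assms(1)[symmetric] by (simp add: algebra_simps power2_eq_square)
  with eq1 \<tau>2 have "- \<tau> * \<delta> = e" by simp
  hence "e * (\<tau> * (t1 * t2)) = e * 1" by (simp add: \<delta>_def mult_ac)
  hence \<tau>1: "\<tau> * (t1 * t2) = 1" using assms(4) by (metis mult_left_cancel)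
  thus "a * (t1 - t2) * (t1 * t2) = 1" by (simp add: \<tau>_def)
  have "(\<tau> * (t1 * t2)) ^ 2 = \<delta> * (t1 * t2) ^ 2" by (simp add: power_mult_distrib \<tau>2)
  thus "e * (t1 * t2) ^ 3 = -1" unfolding \<tau>1 \<delta>_def
    by (simp add: power2_eq_square power3_eq_cube mult_ac eq_commute[of 1] minus_equation_iff)
qed

section \<open>The method of Frobenius\<close>

abbreviation "fconv h \<equiv> fps_conv_radius (h :: complex fps) \<ge> 1"

definition ftheta :: "complex fps \<Rightarrow> complex fps" where
  "ftheta h = fps_X * fps_deriv h"

lemma ftheta_nth: "fps_nth (ftheta h) n = of_nat n * fps_nth h n"
  by (cases n) (simp_all add: ftheta_def)

lemma ftheta_mult: "ftheta (f * g) = ftheta f * g + f * ftheta g"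
  by (simp add: ftheta_def algebra_simps)

lemma ftheta_add: "ftheta (f + g) = ftheta f + ftheta g"
  and ftheta_diff: "ftheta (f - g) = ftheta f - ftheta g"
  and ftheta_const: "ftheta (fps_const c) = 0"
  by (simp_all add: ftheta_def algebra_simps)

lemma fconv_mult: "fconv f \<Longrightarrow> fconv g \<Longrightarrow> fconv (f * g)"
  and fconv_add: "fconv f \<Longrightarrow> fconv g \<Longrightarrow> fconv (f + g)"
  and fconv_diff: "fconv f \<Longrightarrow> fconv g \<Longrightarrow> fconv (f - g)"
  using fps_conv_radius_mult[of f g] fps_conv_radius_add[of f g] fps_conv_radius_diff[of f g]
  by (meson min.boundedI order_trans)+

lemma fconv_const: "fconv (fps_const c)" by simp

lemma fconv_deriv: "fconv f \<Longrightarrow> fconv (fps_deriv f)"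
  using fps_conv_radius_deriv[of f] by (rule order_trans[rotated])

lemma fconv_ftheta: "fconv f \<Longrightarrow> fconv (ftheta f)"
  unfolding ftheta_def by (intro fconv_mult fconv_deriv) auto

lemmas fconv_intros = fconv_mult fconv_add fconv_diff fconv_const fconv_ftheta conv_radius_E2_fps

lemma fconvD: "fconv f \<Longrightarrow> norm q < 1 \<Longrightarrow> ereal (norm q) < fps_conv_radius f"
  by (rule less_le_trans[of _ 1]) auto

text \<open>The recursion read off from the coefficient of q^n in
  \<open>\<theta>\<^sup>2 h + P \<theta> h + Q h = 0\<close> with \<theta> = q d/dq and Q(0) = 0. A
  factor q^\<lambda> has already been split off, so one indicial root is 0 and the other is
  -P(0).\<close>

fun frobenius_coeff :: "complex fps \<Rightarrow> complex fps \<Rightarrow> nat \<Rightarrow> complex" where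
  "frobenius_coeff P Q n = (if n = 0 then 1 else
     - (\<Sum>m<n. (fps_nth P (n - m) * of_nat m + fps_nth Q (n - m)) * frobenius_coeff P Q m) /
       (of_nat n * (of_nat n + fps_nth P 0)))"

declare frobenius_coeff.simps [simp del]

lemma frobenius_coeff_rec:
  assumes "n \<ge> 1" "of_nat n + fps_nth P 0 \<noteq> 0"
  shows "frobenius_coeff P Q n * (of_nat n * (of_nat n + fps_nth P 0)) =
    - (\<Sum>m<n. (fps_nth P (n - m) * of_nat m + fps_nth Q (n - m)) * frobenius_coeff P Q m)"
proof -
  have "x / y * y = x" if "y \<noteq> 0" for x y :: complex using that by simp
  moreover have "of_nat n * (of_nat n + fps_nth P 0) \<noteq> 0" using assms by simp
  moreover have "n \<noteq> 0" using assms by simp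
  ultimately show ?thesis by (simp only: frobenius_coeff.simps[of P Q n] if_False)
qed

lemma fps_nth_bound:
  assumes "fconv f" "0 < R" "R < 1"
  obtains M where "M \<ge> 0" "\<And>n. norm (fps_nth f n) * R ^ n \<le> M"
proof -
  have "summable (\<lambda>n. fps_nth f n * of_real R ^ n)"
    using assms by (intro summable_fps fconvD) auto
  hence "Bseq (\<lambda>n. fps_nth f n * of_real R ^ n)"
    using summable_LIMSEQ_zero convergentI convergent_imp_Bseq by blast
  then obtain M where "M > 0" "\<And>n. norm (fps_nth f n * of_real R ^ n) \<le> M"
    unfolding Bseq_def by blast
  thus ?thesis using assms(2) by (intro that[of M]) (auto simp: norm_mult norm_power)
qed

text \<open>For n at least 2 |p| the triangle inequality gives the factor 1/2; the finitely many
  smaller n contribute a positive minimum.\<close>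

lemma linear_lower_bound:
  fixes p :: complex
  assumes "\<And>n::nat. n \<ge> 1 \<Longrightarrow> of_nat n + p \<noteq> 0"
  obtains e where "e > 0" "\<And>n::nat. n \<ge> 1 \<Longrightarrow> e * real n \<le> norm (of_nat n + p)"
proof -
  define N where "N = nat \<lceil>2 * norm p\<rceil> + 1"
  define V where "V = (\<lambda>n. norm (of_nat n + p) / real n) ` {1..N}"
  have V: "finite V" "V \<noteq> {}" unfolding V_def N_def by auto
  have pos: "v > 0" if "v \<in> V" for v using that assms by (auto simp: V_def)
  define e where "e = min (1/2) (Min V)"
  have "e > 0" using V pos by (simp add: e_def)
  moreover have "e * real n \<le> norm (of_nat n + p)" if n: "n \<ge> 1" for n
  proof (cases "n \<le> N")
    case True
    hence "Min V \<le> norm (of_nat n + p) / real n" using n V by (intro Min_le) (auto simp: V_def)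
    hence "e \<le> norm (of_nat n + p) / real n" by (simp add: e_def)
    thus ?thesis using n by (simp add: field_simps)
  next
    case False
    hence "2 * norm p \<le> real n" unfolding N_def by linarith
    moreover have "real n \<le> norm (of_nat n + p) + norm p"
      using norm_triangle_ineq4[of "of_nat n + p" p] by simp
    moreover have "e * real n \<le> 1/2 * real n" by (intro mult_right_mono) (auto simp: e_def)
    ultimately show ?thesis by simp
  qed
  ultimately show ?thesis by (rule that)
qed

text \<open>With \<open>R\<close> between r and 1, the decay of P and Q bounds
  \<open>b n * n^2\<close> by a constant times the weighted partial sum \<open>S n\<close>. Hence
  \<open>S (n + 1) / S n\<close> is at most 1 + O(1/n), so \<open>S n\<close> grows
  subexponentially, and so does \<open>b n\<close>.\<close>

lemma frobenius_summable:
  assumes P: "fconv P" and Q: "fconv Q"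
    and nonres: "\<And>n::nat. n \<ge> 1 \<Longrightarrow> of_nat n + fps_nth P 0 \<noteq> 0"
    and r: "0 < r" "r < 1"
  shows "summable (\<lambda>n. norm (frobenius_coeff P Q n) * r ^ n)"
proof -
  define a where "a = frobenius_coeff P Q"
  define R where "R = (1 + r) / 2"
  have R: "0 < R" "R < 1" "r < R" using r by (auto simp: R_def)
  obtain M1 where M1: "M1 \<ge> 0" "\<And>n. norm (fps_nth P n) * R ^ n \<le> M1"
    using fps_nth_bound[OF P R(1,2)] by blast
  obtain M2 where M2: "M2 \<ge> 0" "\<And>n. norm (fps_nth Q n) * R ^ n \<le> M2"
    using fps_nth_bound[OF Q R(1,2)] by blast
  obtain e where e: "e > 0" "\<And>n::nat. n \<ge> 1 \<Longrightarrow> e * real n \<le> norm (of_nat n + fps_nth P 0)"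
    using linear_lower_bound[OF nonres] by blast
  define M where "M = M1 + M2"
  define b where "b n = norm (a n) * R ^ n" for n
  define S where "S n = (\<Sum>m<n. (real m + 1) * b m)" for n
  have b0: "b n \<ge> 0" for n using R by (simp add: b_def)
  have S0: "S n \<ge> 0" for n unfolding S_def by (intro sum_nonneg mult_nonneg_nonneg b0) auto
  have M0: "M \<ge> 0" using M1 M2 by (simp add: M_def)
  define K where "K = M / e"
  have K0: "K \<ge> 0" using M0 e by (simp add: K_def)
  have main: "b n * (real n)\<^sup>2 \<le> K * S n" if n: "n \<ge> 1" for n
  proof -
    have "a n * (of_nat n * (of_nat n + fps_nth P 0)) =
        - (\<Sum>m<n. (fps_nth P (n - m) * of_nat m + fps_nth Q (n - m)) * a m)"
      unfolding a_def using n nonres[OF n] by (rule frobenius_coeff_rec)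
    from arg_cong[OF this, of norm] have "norm (a n) * (real n * norm (of_nat n + fps_nth P 0)) =
        norm (\<Sum>m<n. (fps_nth P (n - m) * of_nat m + fps_nth Q (n - m)) * a m)"
      by (simp only: norm_minus_cancel norm_mult norm_of_nat)
    also have "\<dots> \<le> (\<Sum>m<n. norm ((fps_nth P (n - m) * of_nat m + fps_nth Q (n - m)) * a m))"
      by (rule norm_sum)
    finally have "norm (a n) * (real n * norm (of_nat n + fps_nth P 0)) * R ^ n
        \<le> (\<Sum>m<n. norm ((fps_nth P (n - m) * of_nat m + fps_nth Q (n - m)) * a m)) * R ^ n"
      using R by (intro mult_right_mono) auto
    also have "\<dots> = (\<Sum>m<n. norm (fps_nth P (n - m) * of_nat m + fps_nth Q (n - m)) * R ^ (n - m) * b m)"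
      unfolding sum_distrib_right
    proof (intro sum.cong refl)
      fix m assume "m \<in> {..<n}"
      hence "R ^ n = R ^ (n - m) * R ^ m" by (simp flip: power_add)
      thus "norm ((fps_nth P (n - m) * of_nat m + fps_nth Q (n - m)) * a m) * R ^ n =
          norm (fps_nth P (n - m) * of_nat m + fps_nth Q (n - m)) * R ^ (n - m) * b m"
        by (simp add: b_def norm_mult mult_ac)
    qed
    also have "\<dots> \<le> (\<Sum>m<n. (M * (real m + 1)) * b m)"
    proof (intro sum_mono mult_right_mono b0)
      fix m
      have "norm (fps_nth P (n - m) * of_nat m + fps_nth Q (n - m)) * R ^ (n - m)
          \<le> (norm (fps_nth P (n - m)) * real m + norm (fps_nth Q (n - m))) * R ^ (n - m)"
        using R norm_triangle_ineq[of "fps_nth P (n - m) * of_nat m" "fps_nth Q (n - m)"]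
        by (intro mult_right_mono) (auto simp: norm_mult)
      also have "\<dots> = norm (fps_nth P (n - m)) * R ^ (n - m) * real m + norm (fps_nth Q (n - m)) * R ^ (n - m)"
        by (simp add: algebra_simps)
      also have "\<dots> \<le> M1 * real m + M2" by (intro add_mono mult_right_mono M1 M2) auto
      also have "\<dots> \<le> M * (real m + 1)" using M1 M2 by (simp add: M_def algebra_simps)
      finally show "norm (fps_nth P (n - m) * of_nat m + fps_nth Q (n - m)) * R ^ (n - m) \<le> M * (real m + 1)" .
    qed
    also have "\<dots> = M * S n" by (simp add: S_def sum_distrib_left mult_ac)
    finally have "b n * (real n * norm (of_nat n + fps_nth P 0)) \<le> M * S n"
      by (simp add: b_def mult_ac)
    moreover have "b n * (real n * (e * real n)) \<le> b n * (real n * norm (of_nat n + fps_nth P 0))"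
      using e(2)[OF n] by (intro mult_left_mono b0) auto
    ultimately have "b n * (real n * (e * real n)) \<le> M * S n" by linarith
    thus ?thesis using e(1) by (simp add: K_def field_simps power2_eq_square)
  qed
  define x where "x = r / R"
  have x: "0 < x" "x < 1" using r R by (auto simp: x_def)
  define c where "c = (1 + x) / 2"
  have c: "x < c" "c < 1" using x by (auto simp: c_def)
  have "summable (\<lambda>n. S n * x ^ n)"
  proof (rule summable_ratio_test[OF c(2)])
    \<comment> \<open>The threshold makes 2 K / n at most c / x - 1; the 2 comes from n + 1 being at
      most 2 n.\<close>
    fix n assume "n \<ge> nat \<lceil>2 * K / (c / x - 1)\<rceil> + 1"
    hence n: "real n \<ge> 2 * K / (c / x - 1)" "n \<ge> 1" by linarith+
    have cx: "c / x - 1 > 0" using c x by simp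
    have "b n * (real n)\<^sup>2 * (real n + 1) \<le> K * S n * (2 * real n)"
      using n(2) K0 S0[of n] by (intro mult_mono[OF main[OF n(2)]]) auto
    hence "real n * ((b n * (real n + 1)) * real n) \<le> real n * (2 * K * S n)"
      by (simp add: power2_eq_square algebra_simps)
    hence "(b n * (real n + 1)) * real n \<le> 2 * K * S n" using n(2) by simp
    also have "\<dots> \<le> (real n * (c / x - 1)) * S n"
      using n(1) cx S0[of n] by (intro mult_right_mono) (simp_all add: field_simps)
    finally have "real n * (b n * (real n + 1)) \<le> real n * ((c / x - 1) * S n)" by (simp add: mult_ac)
    hence "b n * (real n + 1) \<le> (c / x - 1) * S n" using n(2) by simp
    hence "S (Suc n) \<le> c / x * S n" by (simp add: S_def algebra_simps)
    hence "S (Suc n) * x ^ Suc n \<le> c / x * S n * x ^ Suc n" using x by (intro mult_right_mono) auto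
    also have "\<dots> = c * (S n * x ^ n)" using x by simp
    finally show "norm (S (Suc n) * x ^ Suc n) \<le> c * norm (S n * x ^ n)"
      using S0 x by (simp add: abs_mult)
  qed
  hence "summable (\<lambda>n. K * (S n * x ^ n))" by (rule summable_mult)
  thus ?thesis
  proof (rule summable_comparison_test'[where N = 1])
    fix n :: nat assume n: "n \<ge> 1"
    have "b n * 1 \<le> b n * (real n)\<^sup>2" using n b0 by (intro mult_left_mono) auto
    hence "b n \<le> K * S n" using main[OF n] by simp
    hence "b n * x ^ n \<le> K * S n * x ^ n" using x by (intro mult_right_mono) auto
    moreover have "b n * x ^ n = norm (a n) * r ^ n"
      using R by (simp add: b_def x_def power_divide)
    ultimately show "norm (norm (frobenius_coeff P Q n) * r ^ n) \<le> K * (S n * x ^ n)"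
      using r by (simp add: a_def)
  qed
qed

lemma frobenius_solution:
  assumes P: "fconv P" and Q: "fconv Q" and Q0: "fps_nth Q 0 = 0"
    and nonres: "\<And>n::nat. n \<ge> 1 \<Longrightarrow> of_nat n + fps_nth P 0 \<noteq> 0"
  obtains h where "fconv h" "fps_nth h 0 = 1" "ftheta (ftheta h) + P * ftheta h + Q * h = 0"
proof
  define h where "h = Abs_fps (frobenius_coeff P Q)"
  show "fconv h"
    unfolding fps_conv_radius_def
  proof (rule conv_radius_geI_ex')
    fix r :: real assume "0 < r" "ereal r < 1"
    hence "summable (\<lambda>n. norm (frobenius_coeff P Q n) * r ^ n)"
      by (intro frobenius_summable[OF P Q nonres]) auto
    hence "summable (\<lambda>n. norm (fps_nth h n * of_real r ^ n))"
      using \<open>0 < r\<close> by (simp add: h_def norm_mult norm_power)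
    thus "summable (\<lambda>n. fps_nth h n * of_real r ^ n)" by (rule summable_norm_cancel)
  qed
  show "fps_nth h 0 = 1" by (simp add: h_def frobenius_coeff.simps)
  show "ftheta (ftheta h) + P * ftheta h + Q * h = 0"
  proof (rule fps_ext)
    fix n
    have eq: "fps_nth (ftheta (ftheta h) + P * ftheta h + Q * h) n =
       of_nat n * (of_nat n * fps_nth h n) + (\<Sum>m\<le>n. (fps_nth P (n - m) * of_nat m + fps_nth Q (n - m)) * fps_nth h m)"
    proof -
      have "fps_nth (P * ftheta h) n = (\<Sum>m\<le>n. of_nat m * fps_nth h m * fps_nth P (n - m))"
        unfolding mult.commute[of P] by (simp only: ftheta_nth fps_mult_nth atLeast0AtMost)
      moreover have "fps_nth (Q * h) n = (\<Sum>m\<le>n. fps_nth h m * fps_nth Q (n - m))"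
        unfolding mult.commute[of Q] by (simp only: fps_mult_nth atLeast0AtMost)
      ultimately show ?thesis
        by (simp add: ftheta_nth sum.distrib distrib_left distrib_right mult_ac)
    qed
    show "fps_nth (ftheta (ftheta h) + P * ftheta h + Q * h) n = fps_nth 0 n"
    proof (cases "n = 0")
      case True
      thus ?thesis unfolding eq using Q0 by simp
    next
      case False
      have split: "{..n} = insert n {..<n}" by auto
      have "fps_nth h n * (of_nat n * (of_nat n + fps_nth P 0)) =
        - (\<Sum>m<n. (fps_nth P (n - m) * of_nat m + fps_nth Q (n - m)) * fps_nth h m)"
        unfolding h_def fps_nth_Abs_fps by (rule frobenius_coeff_rec) (use False nonres[of n] in auto)
      thus ?thesis unfolding eq split using Q0 by (simp add: algebra_simps eq_neg_iff_add_eq_0)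
    qed
  qed
qed

section \<open>Expansions in \<open>q\<close>\<close>

definition qser :: "real \<Rightarrow> complex fps \<Rightarrow> complex \<Rightarrow> complex" where
  "qser l h z = (if z \<in> UH then qexp l z * eval_fps h (qexp 1 z) else 0)"

lemma qexp_add: "qexp (l + l') z = qexp l z * qexp l' z"
  by (simp add: qexp_def ring_distribs flip: exp_add)

lemma qexp_0 [simp]: "qexp 0 z = 1" by (simp add: qexp_def)

lemma qexp_nz [simp]: "qexp l z \<noteq> 0" by (simp add: qexp_def)

lemma qexp_deriv: "(qexp l has_field_derivative (2 * of_real pi * \<i>) * (of_real l * qexp l z)) (at z)"
  unfolding qexp_def[abs_def] by (auto intro!: derivative_eq_intros)

lemma eval_fps_ftheta:
  assumes "fconv h" "norm q < 1"
  shows "eval_fps (ftheta h) q = q * deriv (eval_fps h) q"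
proof -
  have "eval_fps (ftheta h) q = eval_fps fps_X q * eval_fps (fps_deriv h) q"
    unfolding ftheta_def by (rule eval_fps_mult) (use assms fconv_deriv fconvD in auto)
  thus ?thesis using assms by (simp add: eval_fps_deriv fconvD)
qed

lemma qser_deriv:
  assumes h: "fconv h" and z: "z \<in> UH"
  shows "(qser l h has_field_derivative
    (2 * of_real pi * \<i>) * (of_real l * qser l h z + qser l (ftheta h) z)) (at z)"
proof -
  have q: "norm (qexp 1 z) < 1" by (rule norm_qexp_less_1[OF z])
  have d: "(eval_fps h has_field_derivative deriv (eval_fps h) (qexp 1 z)) (at (qexp 1 z))"
    using has_field_derivative_eval_fps[of "qexp 1 z" h UNIV] fconvD[OF h q]
    by (simp add: eval_fps_deriv)
  have d': "((\<lambda>z. eval_fps h (qexp 1 z)) has_field_derivative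
      deriv (eval_fps h) (qexp 1 z) * ((2 * of_real pi * \<i>) * (of_real 1 * qexp 1 z))) (at z)"
    by (rule DERIV_chain2[where f = "eval_fps h" and g = "qexp 1", OF d qexp_deriv])
  have "((\<lambda>z. qexp l z * eval_fps h (qexp 1 z)) has_field_derivative
    (2 * of_real pi * \<i>) * (of_real l * (qexp l z * eval_fps h (qexp 1 z)) + qexp l z * eval_fps (ftheta h) (qexp 1 z))) (at z)"
    by (rule DERIV_cong[OF DERIV_mult[OF qexp_deriv d']])
       (simp add: eval_fps_ftheta[OF h q] algebra_simps)
  hence "(qser l h has_field_derivative
    (2 * of_real pi * \<i>) * (of_real l * (qexp l z * eval_fps h (qexp 1 z)) + qexp l z * eval_fps (ftheta h) (qexp 1 z))) (at z)"
    by (rule has_field_derivative_transform_within_open[OF _ open_UH z]) (simp add: qser_def)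
  thus ?thesis using z by (simp add: qser_def)
qed

lemma qser_holomorphic: "fconv h \<Longrightarrow> qser l h holomorphic_on UH"
  using qser_deriv by (auto simp: holomorphic_on_open[OF open_UH] intro!: exI)

lemma qser_add: "fconv f \<Longrightarrow> fconv g \<Longrightarrow> qser l (f + g) z = qser l f z + qser l g z"
  and qser_diff: "fconv f \<Longrightarrow> fconv g \<Longrightarrow> qser l (f - g) z = qser l f z - qser l g z"
  and qser_mult: "fconv f \<Longrightarrow> fconv g \<Longrightarrow> qser (l + l') (f * g) z = qser l f z * qser l' g z"
  and qser_const: "qser l (fps_const c) z = c * qser l 1 z"
  by (auto simp: qser_def eval_fps_add eval_fps_diff eval_fps_mult fconvD norm_qexp_less_1 qexp_add algebra_simps)

lemma qser_one: "z \<in> UH \<Longrightarrow> qser 0 1 z = 1" by (simp add: qser_def)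

lemma qser_mult0: "fconv f \<Longrightarrow> fconv g \<Longrightarrow> qser l (f * g) z = qser 0 f z * qser l g z"
  using qser_mult[of f g 0 l z] by simp

lemma qser_E2: "z \<in> UH \<Longrightarrow> qser 0 E2_fps z = E2 z"
  by (simp add: qser_def E2_eval_fps)

lemma E2_holomorphic: "E2 holomorphic_on UH"
  using qser_holomorphic[OF conv_radius_E2_fps, of 0] by (rule holomorphic_transform) (rule qser_E2)

text \<open>The effect of the modular derivative in weight k on the power series factor of q^l h:
  the summand with l comes from differentiating q^l.\<close>

definition fD :: "real \<Rightarrow> real \<Rightarrow> complex fps \<Rightarrow> complex fps" where
  "fD k l h = fps_const (of_real l) * h - fps_const (of_real (k / 12)) * E2_fps * h + ftheta h"

lemma fconv_fD: "fconv h \<Longrightarrow> fconv (fD k l h)"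
  unfolding fD_def by (intro fconv_intros)

lemma modD_qser: "fconv h \<Longrightarrow> modD k (qser l h) = qser l (fD k l h)"
proof
  fix z assume h: "fconv h"
  show "modD k (qser l h) z = qser l (fD k l h) z"
  proof (cases "z \<in> UH")
    case True
    have "deriv (qser l h) z / (2 * of_real pi * \<i>) = of_real l * qser l h z + qser l (ftheta h) z"
      using DERIV_imp_deriv[OF qser_deriv[OF h True, of l]] by (simp add: field_simps)
    moreover have "qser l (fD k l h) z = of_real l * qser l h z - of_real (k / 12) * E2 z * qser l h z + qser l (ftheta h) z"
      unfolding fD_def using h True
      by (simp add: qser_add qser_diff qser_mult0 fconv_intros qser_const qser_one qser_E2)
    ultimately show ?thesis using True by (simp add: modD_def)
  qed (simp add: modD_def qser_def)
qed

lemma eval_fps_bounded: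
  assumes "fconv h" "r < 1"
  shows "\<exists>B. \<forall>q. norm q \<le> r \<longrightarrow> norm (eval_fps h q) \<le> B"
proof -
  have "continuous_on (cball 0 r) (eval_fps h)"
    by (intro continuous_on_subset[OF continuous_on_eval_fps])
       (use assms(2) in \<open>auto intro!: fconvD[OF assms(1)]\<close>)
  hence "compact (eval_fps h ` cball 0 r)" by (intro compact_continuous_image) auto
  hence "bounded (eval_fps h ` cball 0 r)" by (rule compact_imp_bounded)
  hence "\<exists>B. \<forall>q\<in>cball 0 r. norm (eval_fps h q) \<le> B" by (auto simp: bounded_iff)
  thus ?thesis by (simp add: Ball_def dist_norm)
qed

lemma qser_bound:
  assumes "fconv h"
  obtains B where "B \<ge> 0" "\<And>z. Im z \<ge> 1 \<Longrightarrow> norm (qser l h z) \<le> B * exp (- 2 * pi * l * Im z)"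
proof -
  obtain B where B: "\<And>q. norm q \<le> exp (- 2 * pi) \<Longrightarrow> norm (eval_fps h q) \<le> B"
    using eval_fps_bounded[OF assms, of "exp (- 2 * pi)"] by auto
  have "norm (qser l h z) \<le> B * exp (- 2 * pi * l * Im z)" if "Im z \<ge> 1" for z
  proof -
    have "norm (eval_fps h (qexp 1 z)) \<le> B" using that by (intro B) (simp add: norm_qexp)
    thus ?thesis using that by (simp add: qser_def UH_def norm_mult norm_qexp)
  qed
  moreover have "B \<ge> 0" using order_trans[OF norm_ge_zero B[of 0]] by simp
  ultimately show ?thesis using that by blast
qed

lemma qser_moderate_growth:
  assumes "fconv h" "l \<ge> 0"
  shows "moderate_growth (qser l h)"
proof -
  obtain B where B: "B \<ge> 0" "\<And>z. Im z \<ge> 1 \<Longrightarrow> norm (qser l h z) \<le> B * exp (- 2 * pi * l * Im z)"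
    using qser_bound[OF assms(1), of l] by blast
  have "\<forall>\<^sub>F y in at_top. \<forall>x::real. \<bar>x\<bar> \<le> X \<longrightarrow> norm (qser l h (Complex x y)) < y ^ 1" for X :: real
    using eventually_gt_at_top[of "max 1 B"]
  proof eventually_elim
    case (elim y)
    have "norm (qser l h (Complex x y)) \<le> B * 1" for x
      using elim B(1) assms(2) by (intro order_trans[OF B(2)] mult_left_mono) auto
    thus ?case using elim by (auto intro: le_less_trans)
  qed
  thus ?thesis unfolding moderate_growth_def by blast
qed

lemma qser_lower_bound:
  assumes "fconv h" "fps_nth h 0 \<noteq> 0"
  obtains Y c where "Y > 0" "c > 0" "\<And>z. Im z \<ge> Y \<Longrightarrow> norm (qser l h z) \<ge> c * exp (- 2 * pi * l * Im z)"
proof -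
  have "continuous (at 0) (eval_fps h)"
    by (rule continuous_eval_fps) (use fconvD[OF assms(1), of 0] in \<open>simp add: zero_ereal_def\<close>)
  hence "(eval_fps h \<longlongrightarrow> eval_fps h 0) (at 0)" by (simp add: continuous_within)
  moreover define c where "c = norm (fps_nth h 0) / 2"
  have c: "c > 0" using assms(2) by (simp add: c_def)
  ultimately obtain d where d: "d > 0" "\<And>q. q \<noteq> 0 \<Longrightarrow> norm q < d \<Longrightarrow> dist (eval_fps h q) (fps_nth h 0) < c"
    unfolding tendsto_iff eventually_at eval_fps_at_0 by force
  have lb: "norm (eval_fps h q) \<ge> c" if "q \<noteq> 0" "norm q < d" for q
    using d(2)[OF that] norm_triangle_ineq2[of "fps_nth h 0" "eval_fps h q"]
    by (simp add: c_def dist_norm norm_minus_commute)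
  define Y where "Y = max 1 (1 - ln d / (2 * pi))"
  have "norm (qser l h z) \<ge> c * exp (- 2 * pi * l * Im z)" if z: "Im z \<ge> Y" for z
  proof -
    have "Im z > - ln d / (2 * pi)" using z by (simp add: Y_def)
    hence "- 2 * pi * Im z < ln d" by (simp add: field_simps)
    hence "exp (- 2 * pi * Im z) < d" using d(1) by (metis exp_less_cancel_iff exp_ln)
    hence "norm (eval_fps h (qexp 1 z)) \<ge> c" by (intro lb) (simp_all add: norm_qexp)
    moreover have "z \<in> UH" using z by (simp add: Y_def UH_def)
    ultimately show ?thesis by (simp add: qser_def norm_mult norm_qexp)
  qed
  moreover have "Y > 0" by (simp add: Y_def)
  ultimately show ?thesis using c that by blast
qed

text \<open>The common exponent cancels, and what remains is a quotient of power series whose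
  denominator does not vanish at q = 0.\<close>

lemma qser_quotient_bounded:
  assumes g: "fconv g" and h: "fconv h" "fps_nth h 0 \<noteq> 0"
  shows "\<exists>B Y. \<forall>z. Im z \<ge> Y \<longrightarrow> norm (qser l g z / qser l h z) \<le> B"
proof -
  obtain Y c where Y: "Y > 0" "c > 0" "\<And>z. Im z \<ge> Y \<Longrightarrow> norm (qser l h z) \<ge> c * exp (- 2 * pi * l * Im z)"
    using qser_lower_bound[OF h, of l] by blast
  obtain B where B: "B \<ge> 0" "\<And>z. Im z \<ge> 1 \<Longrightarrow> norm (qser l g z) \<le> B * exp (- 2 * pi * l * Im z)"
    using qser_bound[OF g, of l] by blast
  have "norm (qser l g z / qser l h z) \<le> B / c" if z: "Im z \<ge> max Y 1" for z
  proof -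
    define e where "e = exp (- 2 * pi * l * Im z)"
    have "norm (qser l g z) \<le> B * e" "norm (qser l h z) \<ge> c * e"
      using B(2)[of z] Y(3)[of z] z unfolding e_def by simp_all
    hence "norm (qser l g z) / norm (qser l h z) \<le> B * e / (c * e)"
      using B Y(2) by (intro frac_le) (simp_all add: e_def)
    thus ?thesis by (simp add: norm_divide e_def)
  qed
  thus ?thesis by blast
qed

text \<open>The condition \<open>l < 1\<close> excludes a pole at \<open>q = 0\<close>, so the singularity is removable.\<close>

lemma moderate_growth_imp_qser:
  assumes hol: "f holomorphic_on UH" and mg: "moderate_growth f" and l: "l < 1"
    and per: "\<And>z. z \<in> UH \<Longrightarrow> f (z + 1) = exp (2 * of_real pi * \<i> * of_real l) * f z"
    and out: "\<And>z. z \<notin> UH \<Longrightarrow> f z = 0"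
  obtains h where "fconv h" "f = qser l h"
proof -
  define g where "g z = f z / qexp l z" for z
  have g_hol: "g holomorphic_on UH"
    unfolding g_def qexp_def by (intro holomorphic_intros hol) auto
  have g1: "g (z + 1) = g z" if "z \<in> UH" for z
  proof -
    have "qexp l (z + 1) = exp (2 * of_real pi * \<i> * of_real l) * qexp l z"
      by (simp add: qexp_def ring_distribs exp_add)
    thus ?thesis using per[OF that] by (simp add: g_def)
  qed
  have gn: "g (z + of_nat n) = g z" if "z \<in> UH" for z n
    by (induction n) (use that g1[of "z + of_nat _"] in \<open>auto simp: UH_def add_ac\<close>)
  have gz: "g (z + of_int n) = g z" if z: "z \<in> UH" for z n
  proof (cases n rule: int_cases2)
    case (nonneg m)
    thus ?thesis using gn[OF z] by simp
  next
    case (nonpos m)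
    have "z - of_nat m \<in> UH" using z by (simp add: UH_def)
    from gn[OF this, of m] show ?thesis using nonpos by simp
  qed
  \<comment> \<open>A pointwise inverse of the map from z to q. As \<open>g\<close> has period 1,
    \<open>G\<close> does not depend on the branch of the logarithm, so on the branch cut its
    differentiability can be tested with another one.\<close>
  define lg where "lg q = Ln q / (2 * of_real pi * \<i>)" for q
  define G where "G q = g (lg q)" for q
  have Im_lg: "Im (lg q) = - ln (norm q) / (2 * pi)" if "q \<noteq> 0" for q
    using that by (simp add: lg_def Im_divide power2_eq_square)
  have lg_UH: "lg q \<in> UH" if "q \<in> ball 0 1 - {0}" for q
    using that by (auto simp: UH_def Im_lg divide_less_0_iff)
  have qlg: "qexp 1 (lg q) = q" if "q \<noteq> 0" for q
    using that by (simp add: qexp_def lg_def)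
  have Gq: "G (qexp 1 z) = g z" if z: "z \<in> UH" for z
  proof -
    have "qexp 1 (lg (qexp 1 z)) = qexp 1 z" by (rule qlg) simp
    then obtain n :: int where "2 * of_real pi * \<i> * lg (qexp 1 z) = 2 * of_real pi * \<i> * z + (of_int (2 * n) * pi) * \<i>"
      unfolding qexp_def exp_eq by auto
    hence "(2 * of_real pi * \<i>) * lg (qexp 1 z) = (2 * of_real pi * \<i>) * (z + of_int n)" by (simp add: algebra_simps)
    hence "lg (qexp 1 z) = z + of_int n" by simp
    thus ?thesis using gz[OF z] by (simp add: G_def)
  qed
  have G_hol1: "G field_differentiable at q" if q: "q \<in> ball 0 1 - {0}" "q \<notin> \<real>\<^sub>\<le>\<^sub>0" for q
  proof -
    have "lg field_differentiable at q" unfolding lg_def using q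
      by (intro derivative_intros field_differentiable_divide field_differentiable_at_Ln) auto
    moreover have "g field_differentiable at (lg q)"
      using g_hol lg_UH[OF q(1)] open_UH by (simp add: holomorphic_on_imp_differentiable_at)
    ultimately have "(g \<circ> lg) field_differentiable at q" by (rule field_differentiable_compose)
    thus ?thesis by (simp add: G_def[abs_def] o_def)
  qed
  have G_hol2: "G field_differentiable at q" if q: "q \<in> ball 0 1 - {0}" "q \<in> \<real>\<^sub>\<le>\<^sub>0" for q
  proof -
    \<comment> \<open>Near the negative axis the logarithm of -q is analytic, and the summand 1/2
      restores the sign, so \<open>m\<close> is a local inverse of the map from z to q
      there.\<close>
    define m where "m q = Ln (- q) / (2 * of_real pi * \<i>) + 1 / 2" for q
    have nq: "- q \<notin> \<real>\<^sub>\<le>\<^sub>0" using q by (auto simp: complex_nonpos_Reals_iff complex_eq_iff)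
    have mU: "m p \<in> UH" "G p = g (m p)" if "p \<in> ball 0 1 - {0}" for p
    proof -
      have "Im (m p) = Im (lg (- p))" by (simp add: m_def lg_def)
      thus "m p \<in> UH" using lg_UH[of "- p"] that by (simp add: UH_def)
      have "qexp 1 (m p) = qexp 1 (lg (- p)) * exp (\<i> * of_real pi)"
        by (simp add: m_def lg_def qexp_def ring_distribs exp_add)
      also have "\<dots> = p" using qlg[of "- p"] that by simp
      finally show "G p = g (m p)" using Gq[OF \<open>m p \<in> UH\<close>] by simp
    qed
    have "m field_differentiable at q"
    proof -
      have "(\<lambda>q. Ln (- q)) field_differentiable at q"
        using field_differentiable_compose[of uminus q Ln] field_differentiable_at_Ln[OF nq]
        by (simp add: o_def field_differentiable_minus)
      thus ?thesis unfolding m_def by (intro derivative_intros field_differentiable_divide) auto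
    qed
    moreover have "g field_differentiable at (m q)"
      using g_hol mU(1)[OF q(1)] open_UH by (simp add: holomorphic_on_imp_differentiable_at)
    ultimately have "(g \<circ> m) field_differentiable at q" by (rule field_differentiable_compose)
    moreover have "open (ball (0::complex) 1 - {0})" by (intro open_delete) auto
    ultimately obtain g' where g': "(g \<circ> m has_field_derivative g') (at q)"
      unfolding field_differentiable_def by blast
    have "(G has_field_derivative g') (at q)"
      by (rule has_field_derivative_transform_within_open[OF g' \<open>open (ball 0 1 - {0})\<close> q(1)])
         (use mU(2) in auto)
    thus ?thesis unfolding field_differentiable_def by blast
  qed
  have G_hol: "G holomorphic_on ball 0 1 - {0}"
    unfolding holomorphic_on_def using G_hol1 G_hol2 by (meson field_differentiable_at_within)
  obtain N where N: "\<forall>\<^sub>F y in at_top. \<forall>x::real. \<bar>x\<bar> \<le> 1 \<longrightarrow> norm (f (Complex x y)) < y ^ N"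
    using mg unfolding moderate_growth_def by blast
  \<comment> \<open>The principal logarithm keeps |Re (lg q)| at most 1/2, inside the strip |x| at
    most 1 of the growth bound. Then |q G(q)| is at most y^N exp(-2 pi (1 - l) y), which tends to 0
    because l < 1.\<close>
  have lim: "((\<lambda>q. (q - 0) * G q) \<longlongrightarrow> 0) (at 0)"
  proof (rule Lim_null_comparison)
    define y where "y q = - ln (norm q) / (2 * pi)" for q :: complex
    have ytop: "filterlim y at_top (at 0)"
    proof -
      have "filterlim norm (at_right 0) (at (0::complex))"
        unfolding filterlim_at by (auto intro!: tendsto_norm_zero simp: eventually_at_filter)
      moreover have "filterlim (\<lambda>t. - ln t / (2 * pi)) at_top (at_right 0)" by real_asymp
      ultimately show ?thesis unfolding y_def by (rule filterlim_compose[rotated])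
    qed
    have "((\<lambda>t. t ^ N * exp (- 2 * pi * (1 - l) * t)) \<longlongrightarrow> 0) at_top"
      using l by real_asymp
    from filterlim_compose[OF this ytop]
    show "((\<lambda>q. y q ^ N * exp (- 2 * pi * (1 - l) * y q)) \<longlongrightarrow> 0) (at 0)" .
    have "\<forall>\<^sub>F q in at (0::complex). norm q < 1 \<and> q \<noteq> 0"
      by (auto simp: eventually_at intro!: exI[of _ 1])
    with filterlim_iff[THEN iffD1, OF ytop, rule_format, OF N]
    show "\<forall>\<^sub>F q in at 0. norm ((q - 0) * G q) \<le> y q ^ N * exp (- 2 * pi * (1 - l) * y q)"
    proof eventually_elim
      case (elim q)
      have im: "Im (lg q) = y q" using Im_lg elim by (simp add: y_def)
      have "Re (lg q) = Im (Ln q) / (2 * pi)" by (simp add: lg_def Re_divide power2_eq_square)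
      moreover have "\<bar>Im (Ln q)\<bar> \<le> pi" using elim Im_Ln_le_pi mpi_less_Im_Ln[of q] by (smt (verit))
      ultimately have "\<bar>Re (lg q)\<bar> \<le> pi / (2 * pi)" by (simp add: abs_divide divide_right_mono)
      hence re: "\<bar>Re (lg q)\<bar> \<le> 1" by simp
      have "lg q = Complex (Re (lg q)) (y q)" using im by (simp add: complex_eq_iff)
      hence "norm (f (lg q)) < y q ^ N" using elim re by metis
      moreover have "norm (qexp l (lg q)) = exp (- 2 * pi * l * y q)" by (simp add: norm_qexp im)
      moreover have "norm q = exp (- 2 * pi * y q)" using elim by (simp add: y_def)
      ultimately have "norm ((q - 0) * G q) \<le> exp (- 2 * pi * y q) * (y q ^ N / exp (- 2 * pi * l * y q))"
        by (simp add: G_def g_def norm_mult norm_divide divide_right_mono)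
      also have "\<dots> = y q ^ N * exp (- 2 * pi * (1 - l) * y q)"
        by (simp add: exp_minus field_simps flip: exp_add)
      finally show ?case .
    qed
  qed
  have "0 \<in> interior (ball (0::complex) 1)" by simp
  then obtain H where H: "H holomorphic_on ball 0 1" "\<And>q. q \<in> ball 0 1 - {0} \<Longrightarrow> H q = G q"
    using holomorphic_on_extend_lim[OF G_hol] lim by blast
  define h where "h = fps_expansion H 0"
  have conv: "fconv h" unfolding h_def using conv_radius_fps_expansion[of H 0 1] H(1)
    by (simp add: one_ereal_def)
  have ev: "eval_fps h q = H q" if "norm q < 1" for q
    unfolding h_def using eval_fps_expansion'[of H 0 1 q] H(1) that by (simp add: one_ereal_def)
  have "f = qser l h"
  proof
    fix z
    show "f z = qser l h z"
    proof (cases "z \<in> UH")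
      case True
      have "eval_fps h (qexp 1 z) = g z"
        using norm_qexp_less_1[OF True] by (subst ev) (auto simp: H(2) Gq True)
      thus ?thesis using True by (simp add: qser_def g_def)
    qed (simp add: out qser_def)
  qed
  with conv show ?thesis by (rule that)
qed

section \<open>The modular derivative and the slash action\<close>

lemma E2_T: "z \<in> UH \<Longrightarrow> E2 (z + 1) = E2 z"
proof -
  assume z: "z \<in> UH"
  have "qexp 1 (z + 1) = qexp 1 z" by (simp add: qexp_def ring_distribs exp_add)
  thus ?thesis using z by (simp add: E2_eval_fps UH_def)
qed

lemma hol_has_deriv: "f holomorphic_on UH \<Longrightarrow> z \<in> UH \<Longrightarrow> (f has_field_derivative deriv f z) (at z)"
  by (rule holomorphic_derivI[OF _ open_UH])

lemma modD_holomorphic: "f holomorphic_on UH \<Longrightarrow> modD k f holomorphic_on UH"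
proof -
  assume f: "f holomorphic_on UH"
  have "(\<lambda>z. deriv f z / (2 * of_real pi * \<i>) - of_real k / 12 * E2 z * f z) holomorphic_on UH"
    by (intro holomorphic_intros holomorphic_deriv f open_UH E2_holomorphic) auto
  thus ?thesis by (rule holomorphic_transform) (simp add: modD_def)
qed

lemma modD_cong: "(\<And>z. z \<in> UH \<Longrightarrow> f z = g z) \<Longrightarrow> modD k f = modD k g"
proof
  fix z assume eq: "\<And>z. z \<in> UH \<Longrightarrow> f z = g z"
  show "modD k f z = modD k g z"
  proof (cases "z \<in> UH")
    case True
    hence "eventually (\<lambda>z. f z = g z) (nhds z)"
      using eq open_UH eventually_nhds by blast
    thus ?thesis using True eq by (simp add: modD_def deriv_cong_ev)
  qed (simp add: modD_def)
qed

lemma modD_eqI: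
  assumes "z \<in> UH" "(f has_field_derivative 2 * of_real pi * \<i> * D) (at z)"
  shows "modD k f z = D - of_real k / 12 * E2 z * f z"
  using assms by (simp add: modD_def DERIV_imp_deriv)

lemma modD_has_deriv:
  assumes "f holomorphic_on UH" "z \<in> UH"
  shows "(f has_field_derivative 2 * of_real pi * \<i> * (modD k f z + of_real k / 12 * E2 z * f z)) (at z)"
  using hol_has_deriv[OF assms] assms(2) by (simp add: modD_def)

lemma modD_add:
  assumes "f holomorphic_on UH" "g holomorphic_on UH"
  shows "modD k (\<lambda>z. f z + g z) z = modD k f z + modD k g z"
  by (cases "z \<in> UH")
     (auto simp: modD_def algebra_simps add_divide_distrib DERIV_imp_deriv[OF DERIV_add[OF hol_has_deriv[OF assms(1)] hol_has_deriv[OF assms(2)]]])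

lemma modD_cmult:
  assumes "f holomorphic_on UH"
  shows "modD k (\<lambda>z. c * f z) z = c * modD k f z"
  by (cases "z \<in> UH")
     (auto simp: modD_def algebra_simps DERIV_imp_deriv[OF DERIV_cmult[OF hol_has_deriv[OF assms]]])

lemma modD_mult:
  assumes "f holomorphic_on UH" "g holomorphic_on UH"
  shows "modD (a + b) (\<lambda>z. f z * g z) z = modD a f z * g z + f z * modD b g z"
  by (cases "z \<in> UH")
     (auto simp: modD_def algebra_simps add_divide_distrib DERIV_imp_deriv[OF DERIV_mult[OF hol_has_deriv[OF assms(1)] hol_has_deriv[OF assms(2)]]])

lemma neg_inverse_UH: "z \<in> UH \<Longrightarrow> - (1 / z) \<in> UH"
  using mobius_UH[of matS z] by (simp add: mobius_matS)

lemma UH_add1: "z \<in> UH \<Longrightarrow> z + 1 \<in> UH" by (simp add: UH_def)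

lemma neg_inverse_deriv: "z \<in> UH \<Longrightarrow> ((\<lambda>z. - (1 / z)) has_field_derivative 1 / z\<^sup>2) (at z)"
  using UH_nz[of z] by (auto intro!: derivative_eq_intros simp: power2_eq_square)

lemma slash_holomorphic_S:
  assumes "f holomorphic_on UH"
  shows "slash k \<upsilon> matS f holomorphic_on UH"
proof -
  have "(\<lambda>z. inverse (\<upsilon> matS) * z powr (- of_real k) * f (- (1 / z))) holomorphic_on UH"
  proof (intro holomorphic_intros)
    show "(\<lambda>z. f (- (1 / z))) holomorphic_on UH"
    proof -
      have "(\<lambda>z. - (1 / z)) holomorphic_on UH"
        by (intro holomorphic_intros) (simp add: UH_nz)
      from holomorphic_on_compose_gen[OF this assms] show ?thesis
        using neg_inverse_UH by (simp add: o_def image_subset_iff)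
    qed
    show "z \<notin> \<real>\<^sub>\<le>\<^sub>0" if "z \<in> UH" for z using that by (auto simp: UH_def complex_nonpos_Reals_iff)
  qed
  thus ?thesis by (simp add: slash_def[abs_def] mobius_matS)
qed

text \<open>The algebra behind \<open>modD_slash_S\<close>. The first identity brings the derivative
  of the slashed function into the form required by \<open>modD_eqI\<close> and is used with p = 2
  pi i. In the second, used with p = pi i, the term from differentiating z^(-K) cancels the anomaly
  6 z / p of \<open>E2\<close>.\<close>

lemma slash_S_identities:
  fixes z p c K Z F D E M :: complex
  assumes "z \<noteq> 0" "p \<noteq> 0"
  shows "c * (- K * (Z / z) * F + Z * (p * D * (1 / z\<^sup>2))) = p * (c * Z * (D / z\<^sup>2 - K * F / (p * z)))"
    and "D = M + K / 12 * (z\<^sup>2 * E + 6 * z / p) * F \<Longrightarrow>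
      c * Z * (D / z\<^sup>2 - K * F / (2 * p * z)) - K / 12 * E * (c * Z * F) = c * (Z / z\<^sup>2) * M"
proof -
  have "p * (c * Z * (D / z\<^sup>2 - K * F / (p * z))) = c * Z * (p * D / z\<^sup>2 - p * (K * F) / (p * z))"
    by (simp add: algebra_simps)
  also have "p * (K * F) / (p * z) = K * F / z" using assms by simp
  finally show "c * (- K * (Z / z) * F + Z * (p * D * (1 / z\<^sup>2))) = p * (c * Z * (D / z\<^sup>2 - K * F / (p * z)))"
    by (simp add: algebra_simps)
  assume D: "D = M + K / 12 * (z\<^sup>2 * E + 6 * z / p) * F"
  have "D / z\<^sup>2 = M / z\<^sup>2 + K / 12 * (z\<^sup>2 / z\<^sup>2 * E + (6 * z / p) / z\<^sup>2) * F"
    unfolding D by (simp add: add_divide_distrib algebra_simps)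
  also have "z\<^sup>2 / z\<^sup>2 = 1" using assms by simp
  also have "(6 * z / p) / z\<^sup>2 = 6 / (p * z)" using assms by (simp add: power2_eq_square)
  finally have "D / z\<^sup>2 = M / z\<^sup>2 + K / 12 * E * F + K * F / (2 * p * z)" by (simp add: algebra_simps)
  thus "c * Z * (D / z\<^sup>2 - K * F / (2 * p * z)) - K / 12 * E * (c * Z * F) = c * (Z / z\<^sup>2) * M"
    by (simp add: algebra_simps)
qed

lemma modD_slash_S:
  assumes f: "f holomorphic_on UH" and z: "z \<in> UH"
  shows "modD k (slash k \<upsilon> matS f) z = slash (k + 2) \<upsilon> matS (modD k f) z"
proof -
  let ?p = "2 * of_real pi * \<i> :: complex"
  define w where "w = - (1 / z)"
  define c where "c = inverse (\<upsilon> matS)"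
  have w: "w \<in> UH" unfolding w_def by (rule neg_inverse_UH[OF z])
  have nz: "z \<noteq> 0" by (rule UH_nz[OF z])
  have nr: "z \<notin> \<real>\<^sub>\<le>\<^sub>0" using z by (auto simp: UH_def complex_nonpos_Reals_iff)
  define D where "D = modD k f w + of_real k / 12 * E2 w * f w"
  have df: "((\<lambda>z. f (- (1 / z))) has_field_derivative ?p * D * (1 / z\<^sup>2)) (at z)"
    using modD_has_deriv[OF f w, of k] neg_inverse_deriv[OF z] unfolding w_def D_def by (rule DERIV_chain2)
  have dp: "((\<lambda>z. z powr (- of_real k)) has_field_derivative (- of_real k) * z powr (- of_real k - 1)) (at z)"
    using nr by (auto intro!: derivative_eq_intros)
  have zp: "z powr (- of_real k - 1) = z powr (- of_real k) / z" "z powr (- of_real (k + 2)) = z powr (- of_real k) / z\<^sup>2"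
    using nz by (simp_all add: powr_diff powr_add powr_minus field_simps)
  have df': "((\<lambda>z. c * (z powr (- of_real k) * f (- (1 / z)))) has_field_derivative
     c * ((- of_real k) * z powr (- of_real k - 1) * f w + z powr (- of_real k) * (?p * D * (1 / z\<^sup>2)))) (at z)"
    using DERIV_cmult[OF DERIV_mult[OF dp df]] by (simp add: w_def mult_ac add_ac)
  have "((slash k \<upsilon> matS f) has_field_derivative
     c * ((- of_real k) * z powr (- of_real k - 1) * f w + z powr (- of_real k) * (?p * D * (1 / z\<^sup>2)))) (at z)"
  proof -
    have "slash k \<upsilon> matS f = (\<lambda>z. c * (z powr (- of_real k) * f (- (1 / z))))"
      by (simp add: fun_eq_iff slash_def mobius_matS c_def mult.assoc)
    with df' show ?thesis by (simp only:)
  qed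
  moreover have "c * ((- of_real k) * z powr (- of_real k - 1) * f w + z powr (- of_real k) * (?p * D * (1 / z\<^sup>2))) =
     ?p * (c * z powr (- of_real k) * (D / z\<^sup>2 - of_real k * f w / (?p * z)))"
    unfolding zp by (rule slash_S_identities(1)) (use nz in auto)
  ultimately have "((slash k \<upsilon> matS f) has_field_derivative
     ?p * (c * z powr (- of_real k) * (D / z\<^sup>2 - of_real k * f w / (?p * z)))) (at z)" by (simp only:)
  from modD_eqI[OF z this, of k]
  have "modD k (slash k \<upsilon> matS f) z =
     c * z powr (- of_real k) * (D / z\<^sup>2 - of_real k * f w / (?p * z)) - of_real k / 12 * E2 z * (c * z powr (- of_real k) * f w)"
    by (simp add: slash_def mobius_matS w_def c_def)
  also have "\<dots> = c * (z powr (- of_real k) / z\<^sup>2) * modD k f w"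
  proof -
    have "D = modD k f w + of_real k / 12 * (z\<^sup>2 * E2 z + 6 * z / (of_real pi * \<i>)) * f w"
      unfolding D_def w_def E2_quasimodular[OF z] ..
    from slash_S_identities(2)[OF nz _ this, of c "z powr (- of_real k)"] show ?thesis
      by (simp add: mult.assoc)
  qed
  also have "\<dots> = slash (k + 2) \<upsilon> matS (modD k f) z"
    by (simp add: slash_def mobius_matS w_def c_def zp(2) del: of_real_add)
  finally show ?thesis .
qed

lemma modD_slash_T:
  assumes f: "f holomorphic_on UH" and z: "z \<in> UH"
  shows "modD k (slash k \<upsilon> matT f) z = slash (k + 2) \<upsilon> matT (modD k f) z"
proof -
  have "(f has_field_derivative deriv f (z + 1)) (at (z + 1))" using f UH_add1[OF z] by (rule hol_has_deriv)
  hence "((\<lambda>z. inverse (\<upsilon> matT) * f (z + 1)) has_field_derivative inverse (\<upsilon> matT) * deriv f (z + 1)) (at z)"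
    unfolding DERIV_shift by (rule DERIV_cmult)
  thus ?thesis using z UH_add1[OF z]
    by (simp add: modD_def slash_def[abs_def] mobius_matT DERIV_imp_deriv E2_T[unfolded add.commute[of _ 1]] algebra_simps)
qed

text \<open>By an identity of Ramanujan this is the Eisenstein series of weight 4; only its modularity matters here.\<close>

definition E4 :: "complex \<Rightarrow> complex" where
  "E4 = qser 0 (E2_fps * E2_fps - fps_const 12 * ftheta E2_fps)"

lemma fconv_E4: "fconv (E2_fps * E2_fps - fps_const 12 * ftheta E2_fps)"
  by (intro fconv_intros)

lemma E4_eq:
  assumes "z \<in> UH"
  shows "E4 z = E2 z ^ 2 - 12 * (deriv E2 z / (2 * of_real pi * \<i>))"
proof -
  have "deriv E2 z = 2 * of_real pi * \<i> * qser 0 (ftheta E2_fps) z"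
  proof (rule DERIV_imp_deriv, rule has_field_derivative_transform_within_open[OF _ open_UH assms])
    show "(qser 0 E2_fps has_field_derivative 2 * of_real pi * \<i> * qser 0 (ftheta E2_fps) z) (at z)"
      using qser_deriv[OF conv_radius_E2_fps assms, of 0] by simp
  qed (simp add: qser_E2)
  thus ?thesis using assms unfolding E4_def
    by (simp add: qser_diff qser_mult0 fconv_intros qser_const qser_one qser_E2 power2_eq_square)
qed

text \<open>Differentiating the transformation law of \<open>E2\<close> produces anomalies in its
  derivative, which after multiplication by 12 / (2 pi i) equal those of the square of
  \<open>E2\<close> and cancel in the difference.\<close>

lemma E4_S:
  assumes z: "z \<in> UH"
  shows "E4 (- (1 / z)) = z ^ 4 * E4 z"
proof -
  let ?p = "of_real pi * \<i> :: complex"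
  have nz: "z \<noteq> 0" by (rule UH_nz[OF z])
  have "((\<lambda>z. E2 (- (1 / z))) has_field_derivative deriv E2 (- (1 / z)) * (1 / z\<^sup>2)) (at z)"
    by (rule DERIV_chain2[OF hol_has_deriv[OF E2_holomorphic neg_inverse_UH[OF z]] neg_inverse_deriv[OF z]])
  hence "((\<lambda>z. z\<^sup>2 * E2 z + 6 * z / ?p) has_field_derivative deriv E2 (- (1 / z)) * (1 / z\<^sup>2)) (at z)"
    by (rule has_field_derivative_transform_within_open[OF _ open_UH z]) (rule E2_quasimodular)
  moreover have "((\<lambda>z. z\<^sup>2 * E2 z + 6 * z / ?p) has_field_derivative 2 * z * E2 z + z\<^sup>2 * deriv E2 z + 6 / ?p) (at z)"
    by (rule derivative_eq_intros hol_has_deriv[OF E2_holomorphic z] refl | simp)+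
  ultimately have "deriv E2 (- (1 / z)) * (1 / z\<^sup>2) = 2 * z * E2 z + z\<^sup>2 * deriv E2 z + 6 / ?p"
    by (rule DERIV_unique)
  hence d: "deriv E2 (- (1 / z)) = z\<^sup>2 * (2 * z * E2 z + z\<^sup>2 * deriv E2 z + 6 / ?p)"
    using nz by (simp add: field_simps)
  show ?thesis
    unfolding E4_eq[OF z] E4_eq[OF neg_inverse_UH[OF z]] d E2_quasimodular[OF z]
    by (simp add: field_simps power2_eq_square power4_eq_xxxx)
qed

lemma E4_T: "z \<in> UH \<Longrightarrow> E4 (z + 1) = E4 z"
proof -
  assume z: "z \<in> UH"
  have "qexp 1 (z + 1) = qexp 1 z" by (simp add: qexp_def ring_distribs exp_add)
  thus ?thesis using z by (simp add: E4_def qser_def UH_def)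
qed

lemma E4_modular: "(\<lambda>z. c * E4 z) \<in> modular_forms (2 * 2)"
proof -
  have inv: "\<forall>z\<in>UH. E4 (mobius \<gamma> z) = autf \<gamma> z ^ 4 * E4 z" if "\<gamma> \<in> carrier SL2Z" for \<gamma>
    using that
  proof (induction rule: SL2Z_induct)
    case (mult \<gamma> \<delta>)
    thus ?case by (auto simp: mobius_mult autf_mult mobius_UH power_mult_distrib)
  qed (auto simp: mobius_matS mobius_matT E4_S E4_T)
  obtain B where B: "B \<ge> 0" "\<And>z. Im z \<ge> 1 \<Longrightarrow> norm (E4 z) \<le> B * exp (- 2 * pi * 0 * Im z)"
    using qser_bound[OF fconv_E4, of 0] unfolding E4_def by blast
  have "norm (c * E4 z) \<le> norm c * B" if "Im z \<ge> 1" for z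
    using B(2)[OF that] by (simp add: norm_mult mult_left_mono)
  hence "\<exists>B Y. \<forall>z. Im z \<ge> Y \<longrightarrow> norm (c * E4 z) \<le> B" by blast
  moreover have "E4 holomorphic_on UH" unfolding E4_def by (rule qser_holomorphic[OF fconv_E4])
  moreover have "E4 z = 0" if "z \<notin> UH" for z using that by (simp add: E4_def qser_def)
  ultimately show ?thesis unfolding modular_forms_def using inv
    by (auto intro!: holomorphic_intros)
qed

section \<open>Irreducible representations of dimension two\<close>

lemma modD_lin2:
  assumes "f holomorphic_on UH" "g holomorphic_on UH"
  shows "modD k (\<lambda>z. a * f z + b * g z) z = a * modD k f z + b * modD k g z"
  using modD_add[of "\<lambda>z. a * f z" "\<lambda>z. b * g z" k z] assms by (simp add: modD_cmult holomorphic_intros)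

lemma vec2_eq_iff: "x = y \<longleftrightarrow> x $ 1 = y $ 1 \<and> x $ 2 = y $ 2" for x y :: "'a^2"
  by (auto simp: vec_eq_iff forall_2)

text \<open>Here \<open>kw\<close> is some weight of \<upsilon>. That \<open>k0\<close> is a weight
  too is a consequence of irreducibility and is derived in \<open>k0_weight\<close>.\<close>

locale vvmf2 =
  fixes \<rho> :: "int^2^2 \<Rightarrow> complex^2^2" and \<upsilon> :: "int^2^2 \<Rightarrow> complex"
    and r l :: "2 \<Rightarrow> real" and kw :: real
  assumes irr: "irreducible_rep \<rho>" and rexp: "rep_exponents \<rho> r"
    and ms: "multiplier_system kw \<upsilon>" and adm: "minimal_admissible \<upsilon> r l"
begin

definition t :: "2 \<Rightarrow> complex" where "t j = exp (2 * of_real pi * \<i> * of_real (r j))"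

lemma t_nz [simp]: "t j \<noteq> 0" by (simp add: t_def)

lemma rho_mult: "\<gamma> \<in> carrier SL2Z \<Longrightarrow> \<delta> \<in> carrier SL2Z \<Longrightarrow> \<rho> (\<gamma> ** \<delta>) = \<rho> \<gamma> ** \<rho> \<delta>"
  using irr by (simp add: irreducible_rep_def hom_def SL2Z_def GLC_def)

lemma rho_invertible: "\<gamma> \<in> carrier SL2Z \<Longrightarrow> invertible (\<rho> \<gamma>)"
  using irr by (auto simp: irreducible_rep_def hom_def GLC_def)

lemma rho_one: "\<rho> (mat 1) = mat 1"
proof -
  have "\<rho> (mat 1) ** \<rho> (mat 1) = \<rho> (mat 1)" using rho_mult[of "mat 1" "mat 1"] by simp
  moreover have "invertible (\<rho> (mat 1))" by (intro rho_invertible) simp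
  ultimately show ?thesis unfolding invertible_def
    by (metis matrix_mul_assoc matrix_mul_lid)
qed

lemma rho_T: "\<rho> matT = mat2 (t 1) 0 0 (t 2)"
  using rexp by (simp add: rep_exponents_def mat2_eq_iff t_def)

lemma l_range: "0 \<le> l j" "l j < 1"
  using adm by (auto simp: minimal_admissible_def)

lemma exp_l: "exp (2 * of_real pi * \<i> * of_real (l j)) = \<upsilon> matT * t j"
proof -
  obtain m where m: "cusp_parameter \<upsilon> m" "l j - (r j + m / 12) \<in> \<int>"
    using adm by (auto simp: minimal_admissible_def)
  then obtain n where "l j - (r j + m / 12) = of_int n" by (auto elim: Ints_cases)
  hence "l j = r j + m / 12 + of_int n" by simp
  hence "exp (2 * of_real pi * \<i> * of_real (l j)) =
      exp (2 * of_real pi * \<i> * of_real (r j)) * exp (2 * of_real pi * \<i> * of_real m / 12) * exp (2 * of_real pi * \<i> * of_int n)"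
    by (simp add: ring_distribs flip: exp_add)
  also have "exp (2 * of_real pi * \<i> * of_int n) = 1"
    using exp_integer_2pi[of "of_int n"] by (simp add: mult_ac)
  finally show ?thesis using m(1) by (simp add: cusp_parameter_def t_def mult_ac)
qed

lemma invariant_subspace:
  assumes "vec.subspace V" and "\<And>v. v \<in> V \<Longrightarrow> \<rho> matS *v v \<in> V" "\<And>v. v \<in> V \<Longrightarrow> \<rho> matT *v v \<in> V"
  shows "V = {0} \<or> V = UNIV"
proof -
  have "\<forall>v\<in>V. \<rho> \<gamma> *v v \<in> V" if "\<gamma> \<in> carrier SL2Z" for \<gamma>
    using that
  proof (induction rule: SL2Z_induct)
    case (mult \<gamma> \<delta>)
    thus ?case by (simp add: rho_mult flip: matrix_vector_mul_assoc)
  qed (use assms in auto)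
  with irr assms(1) show ?thesis unfolding irreducible_rep_def by blast
qed

text \<open>A zero in either place would make a coordinate axis invariant under
  \<open>\<rho> matS\<close>; the diagonal matrix \<open>\<rho> matT\<close> preserves both axes
  anyway.\<close>

lemma rho_S_offdiag: "\<rho> matS $ 1 $ 2 \<noteq> 0" "\<rho> matS $ 2 $ 1 \<noteq> 0"
proof -
  have no: "\<not> (\<forall>v. v \<in> V \<longrightarrow> \<rho> matS *v v \<in> V \<and> \<rho> matT *v v \<in> V)"
    if "vec.subspace V" "x \<in> V" "x \<noteq> 0" "y \<notin> V" for V x y
    using invariant_subspace[OF that(1)] that by blast
  show "\<rho> matS $ 1 $ 2 \<noteq> 0"
    using no[of "{v. v $ 1 = 0}" "axis 2 1" "axis 1 1"]
    by (auto simp: vec.subspace_def mat2_mv_nth rho_T axis_def vec2_eq_iff)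
  show "\<rho> matS $ 2 $ 1 \<noteq> 0"
    using no[of "{v. v $ 2 = 0}" "axis 1 1" "axis 2 1"]
    by (auto simp: vec.subspace_def mat2_mv_nth rho_T axis_def vec2_eq_iff)
qed

text \<open>Otherwise the eigenvector \<open>(b, \<mu> - a)\<close> of \<open>\<rho> S\<close> would span an invariant line.\<close>

lemma t_distinct: "t 1 \<noteq> t 2"
proof
  assume eq: "t 1 = t 2"
  define a b c d where "a = \<rho> matS $ 1 $ 1" "b = \<rho> matS $ 1 $ 2" "c = \<rho> matS $ 2 $ 1" "d = \<rho> matS $ 2 $ 2"
  have b: "b \<noteq> 0" using rho_S_offdiag by (simp add: a_b_c_d_def)
  define s where "s = csqrt ((a - d)\<^sup>2 + 4 * b * c)"
  define \<mu> where "\<mu> = ((a + d) + s) / 2"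
  have s2: "s * s = (a - d)\<^sup>2 + 4 * b * c" unfolding s_def by (simp flip: power2_eq_square)
  have "4 * (c * b + (\<mu> - d) * (a - \<mu>)) = 4 * (c * b) + ((a - d) + s) * ((a - d) - s)"
    unfolding \<mu>_def by (simp add: field_simps)
  also have "\<dots> = 4 * (c * b) + (a - d)\<^sup>2 - s * s" by (simp add: algebra_simps power2_eq_square)
  also have "\<dots> = 0" unfolding s2 by simp
  finally have \<mu>: "c * b + (\<mu> - d) * (a - \<mu>) = 0" by (simp only: mult_eq_0_iff) simp
  define V where "V = {v :: complex^2. (\<mu> - a) * v $ 1 = b * v $ 2}"
  have "vec.subspace V" unfolding V_def vec.subspace_def by (auto simp: algebra_simps)
  moreover have "\<rho> matS *v v \<in> V" if "v \<in> V" for v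
  proof -
    have v: "(\<mu> - a) * v $ 1 = b * v $ 2" using that by (simp add: V_def)
    have "b * (c * v $ 1 + d * v $ 2) - (\<mu> - a) * (a * v $ 1 + b * v $ 2) =
        (c * b + (\<mu> - d) * (a - \<mu>)) * v $ 1 + (d - (\<mu> - a)) * (b * v $ 2 - (\<mu> - a) * v $ 1)"
      by (simp add: algebra_simps)
    also have "\<dots> = 0" using \<mu> v by simp
    finally show ?thesis by (simp add: V_def mat2_mv_nth a_b_c_d_def)
  qed
  moreover have "\<rho> matT *v v \<in> V" if "v \<in> V" for v
    using that eq by (simp add: V_def mat2_mv_nth rho_T mult.left_commute)
  ultimately have "V = {0} \<or> V = UNIV" by (rule invariant_subspace)
  moreover define v :: "complex^2" where "v = (\<chi> i. if i = 1 then b else \<mu> - a)"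
  have "v \<in> V" by (simp add: V_def v_def)
  moreover have "v $ 1 \<noteq> 0" using b by (simp add: v_def)
  hence "v \<noteq> 0" by auto
  moreover have "axis 2 1 \<notin> V" using b by (simp add: V_def axis_def)
  ultimately show False by auto
qed

text \<open>The image of -1 commutes with \<open>\<rho> matT\<close>, whose eigenvalues are
  distinct, and is therefore diagonal. Being the square of \<open>\<rho> matS\<close>, it has
  off-diagonal entries b and c times the trace, so the trace vanishes and the square is a scalar e,
  equal to 1 or -1.\<close>

lemma rho_S_relations:
  obtains a b c e where "\<rho> matS = mat2 a b c (- a)" "b \<noteq> 0" "c \<noteq> 0" "e ^ 2 = 1"
    "\<rho> neg1 = mat2 e 0 0 e"
    "a * (t 1 - t 2) * (t 1 * t 2) = 1" "e * (t 1 * t 2) ^ 3 = -1" "b * c = e - a ^ 2"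
proof -
  define a b c d where abcd: "a = \<rho> matS $ 1 $ 1" "b = \<rho> matS $ 1 $ 2" "c = \<rho> matS $ 2 $ 1" "d = \<rho> matS $ 2 $ 2"
  have bc: "b \<noteq> 0" "c \<noteq> 0" using rho_S_offdiag by (simp_all add: abcd)
  have S: "\<rho> matS = mat2 a b c d" unfolding abcd by (rule mat2_surj)
  have n: "\<rho> neg1 = mat2 (a * a + b * c) (a * b + b * d) (c * a + d * c) (c * b + d * d)"
    using rho_mult[of matS matS] by (simp add: matS_sq S mat2_mult)
  have "matT ** neg1 = neg1 ** matT" by (simp add: matT_eq mat2_mult)
  hence "\<rho> matT ** \<rho> neg1 = \<rho> neg1 ** \<rho> matT"
    using rho_mult[of matT neg1] rho_mult[of neg1 matT] by simp
  hence "t 1 * (a * b + b * d) = (a * b + b * d) * t 2"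
    by (simp add: n rho_T mat2_mult mat2_eq_iff)
  hence "(t 1 - t 2) * (b * (a + d)) = 0" by (simp add: algebra_simps)
  hence d: "d = - a" using t_distinct bc by (simp add: add_eq_0_iff)
  define e where "e = a * a + b * c"
  have n': "\<rho> neg1 = mat2 e 0 0 e" using n by (simp add: d e_def mat2_eq_iff)
  have "\<rho> neg1 ** \<rho> neg1 = mat 1" using rho_mult[of neg1 neg1] rho_one by (simp add: neg1_sq)
  hence e2: "e ^ 2 = 1" by (simp add: n' mat2_mult mat2_eq_iff mat2_one power2_eq_square)
  hence "e \<noteq> 0" by auto
  have cube: "mat2 a b c d ** mat2 (t 1) 0 0 (t 2) ** (mat2 a b c d ** mat2 (t 1) 0 0 (t 2) ** (mat2 a b c d ** mat2 (t 1) 0 0 (t 2))) = mat2 e 0 0 e"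
  proof -
    have "\<rho> matS ** \<rho> matT ** (\<rho> matS ** \<rho> matT ** (\<rho> matS ** \<rho> matT)) =
        \<rho> ((matS ** matT) ** ((matS ** matT) ** (matS ** matT)))"
      by (simp only: rho_mult SL2Z_closed)
    thus ?thesis unfolding matST_cube n' S rho_T .
  qed
  have p: "b * (a + d) = 0" "c * (a + d) = 0" "b \<noteq> 0 \<or> c \<noteq> 0" using bc d by simp_all
  note rel = S_matrix_determined_by_T[OF e_def[symmetric] p(1,2) \<open>e \<noteq> 0\<close> t_nz t_nz cube p(3)]
  show ?thesis
  proof (rule that[of a b c e])
    show "\<rho> matS = mat2 a b c (- a)" using S d by simp
  qed (fact bc e2 n' rel)+
qed

section \<open>Integrality of the minimal weight relative to the given weight\<close>

definition k0 :: real where "k0 = 6 * (l 1 + l 2) - 1"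

text \<open>From e (t1 t2)^3 = -1 with e^2 = 1 one gets (t1 t2)^6 = 1. Hence exp(2 pi i k0) is
  \<open>\<upsilon> matT ^ 12\<close>, the contribution of \<rho> having dropped out.\<close>

lemma k0_weight: "k0 - kw \<in> \<int>"
proof (rule exp_2pii_eq_imp_Ints)
  obtain a b c e where e: "e ^ 2 = 1" "e * (t 1 * t 2) ^ 3 = -1" using rho_S_relations by metis
  have "(e * (t 1 * t 2) ^ 3) ^ 2 = 1" using e(2) by simp
  hence t6: "(t 1 * t 2) ^ 6 = 1" using e(1) by (simp add: power_mult_distrib flip: power_mult)
  have "exp (2 * of_real pi * \<i> * of_real k0) =
     (exp (2 * of_real pi * \<i> * of_real (l 1)) * exp (2 * of_real pi * \<i> * of_real (l 2))) ^ 6 * exp (- (2 * of_real pi * \<i>))"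
  proof -
    have "(exp x * exp y) ^ 6 = exp (6 * (x + y))" for x y :: complex
      using exp_of_nat_mult[of 6 "x + y"] by (simp add: exp_add)
    thus ?thesis by (simp add: k0_def algebra_simps flip: exp_add)
  qed
  also have "\<dots> = (t 1 * t 2) ^ 6 * \<upsilon> matT ^ 12" unfolding exp_l
    by (simp add: power_mult_distrib exp_minus mult_ac flip: power_add)
  also have "\<dots> = exp (2 * of_real pi * \<i> * of_real kw)" unfolding t6 upsilon_T_pow12[OF ms] by simp
  finally show "exp (2 * of_real pi * \<i> * of_real k0) = exp (2 * of_real pi * \<i> * of_real kw)" .
qed

lemma weights_iff: "k \<in> multiplier_weights \<upsilon> \<longleftrightarrow> k - k0 \<in> \<int>"
proof -
  have "k - kw \<in> \<int> \<longleftrightarrow> k - k0 \<in> \<int>"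
    using k0_weight by (metis Ints_add Ints_diff diff_add_cancel add_diff_cancel_right' diff_diff_eq2)
  thus ?thesis by (simp add: multiplier_weights_iff[OF ms])
qed

lemma multiplier_k0: "multiplier_system k0 \<upsilon>"
  using weights_iff[of k0] by (simp add: multiplier_weights_def)

lemma l_distinct: "l 1 \<noteq> l 2"
  using exp_l[of 1] exp_l[of 2] t_distinct upsilon_nz[OF ms, of matT] by auto

text \<open>The matrix is kept separate from \<rho> because the solutions of the differential
  equation first transform under S by an unknown matrix, which has to satisfy the relations of the
  group before it can be compared with \<open>\<rho> matS\<close>.\<close>

definition intertwines :: "real \<Rightarrow> (complex \<Rightarrow> complex^2) \<Rightarrow> int^2^2 \<Rightarrow> complex^2^2 \<Rightarrow> bool" where
  "intertwines k F \<gamma> A \<longleftrightarrow> (\<forall>z\<in>UH. autj k \<upsilon> \<gamma> z *s F (mobius \<gamma> z) = A *v F z)"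

lemma intertwines_mult:
  assumes k: "multiplier_system k \<upsilon>"
    and g: "\<gamma> \<in> carrier SL2Z" "\<delta> \<in> carrier SL2Z" "intertwines k F \<gamma> A" "intertwines k F \<delta> B"
  shows "intertwines k F (\<gamma> ** \<delta>) (A ** B)"
  unfolding intertwines_def
proof
  fix z assume z: "z \<in> UH"
  have "autj k \<upsilon> (\<gamma> ** \<delta>) z *s F (mobius (\<gamma> ** \<delta>) z) =
      autj k \<upsilon> \<delta> z *s (autj k \<upsilon> \<gamma> (mobius \<delta> z) *s F (mobius \<gamma> (mobius \<delta> z)))"
    using g z by (simp add: autj_mult[OF k] mobius_mult)
  also have "autj k \<upsilon> \<gamma> (mobius \<delta> z) *s F (mobius \<gamma> (mobius \<delta> z)) = A *v F (mobius \<delta> z)"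
    using g z mobius_UH unfolding intertwines_def by blast
  also have "autj k \<upsilon> \<delta> z *s (A *v F (mobius \<delta> z)) = A *v (autj k \<upsilon> \<delta> z *s F (mobius \<delta> z))"
    by (simp add: vector_scalar_commute)
  also have "autj k \<upsilon> \<delta> z *s F (mobius \<delta> z) = B *v F z"
    using g z unfolding intertwines_def by blast
  finally show "autj k \<upsilon> (\<gamma> ** \<delta>) z *s F (mobius (\<gamma> ** \<delta>) z) = (A ** B) *v F z"
    by (simp add: matrix_vector_mul_assoc)
qed

lemma intertwines_ST:
  "intertwines k F matS A \<longleftrightarrow> (\<forall>z\<in>UH. autj k \<upsilon> matS z *s F (- (1 / z)) = A *v F z)"
  "intertwines k F matT A \<longleftrightarrow> (\<forall>z\<in>UH. autj k \<upsilon> matT z *s F (z + 1) = A *v F z)"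
  by (simp_all add: intertwines_def mobius_matS mobius_matT)

lemma vvmf_intertwines:
  "F \<in> vvmf k \<rho> \<upsilon> \<longleftrightarrow> (\<forall>z. z \<notin> UH \<longrightarrow> F z = 0) \<and>
    (\<forall>j. (\<lambda>z. F z $ j) holomorphic_on UH \<and> moderate_growth (\<lambda>z. F z $ j)) \<and>
    (\<forall>\<gamma>\<in>carrier SL2Z. intertwines k F \<gamma> (\<rho> \<gamma>))"
proof -
  have "(\<chi> j. slash k \<upsilon> \<gamma> (\<lambda>w. F w $ j) z) = autj k \<upsilon> \<gamma> z *s F (mobius \<gamma> z)" for \<gamma> z
    by (simp add: vec_eq_iff slash_autj)
  thus ?thesis by (simp add: vvmf_def intertwines_def)
qed

text \<open>By the cocycle relation it is enough to test the transformation law on the generators S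
  and T.\<close>

lemma vvmf_iff:
  assumes k: "multiplier_system k \<upsilon>"
  shows "F \<in> vvmf k \<rho> \<upsilon> \<longleftrightarrow> (\<forall>z. z \<notin> UH \<longrightarrow> F z = 0) \<and>
    (\<forall>j. (\<lambda>z. F z $ j) holomorphic_on UH \<and> moderate_growth (\<lambda>z. F z $ j)) \<and>
    (\<forall>z\<in>UH. autj k \<upsilon> matS z *s F (- (1 / z)) = \<rho> matS *v F z) \<and>
    (\<forall>z\<in>UH. autj k \<upsilon> matT z *s F (z + 1) = \<rho> matT *v F z)"
proof -
  have "intertwines k F \<gamma> (\<rho> \<gamma>)"
    if "\<gamma> \<in> carrier SL2Z" "intertwines k F matS (\<rho> matS)" "intertwines k F matT (\<rho> matT)" for \<gamma>
    using that(1)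
  proof (induction rule: SL2Z_induct)
    case (mult \<gamma> \<delta>)
    thus ?case using intertwines_mult[OF k] by (simp add: rho_mult)
  qed (use that in auto)
  thus ?thesis unfolding vvmf_intertwines intertwines_ST[symmetric] using SL2Z_closed(1,2) by blast
qed

lemma vvmf_transform:
  assumes "F \<in> vvmf k \<rho> \<upsilon>" "\<gamma> \<in> carrier SL2Z" "z \<in> UH"
  shows "autj k \<upsilon> \<gamma> z *s F (mobius \<gamma> z) = \<rho> \<gamma> *v F z"
  using assms by (simp add: vvmf_intertwines intertwines_def)

lemma autj_T: "autj k \<upsilon> matT z = inverse (\<upsilon> matT)"
  by (simp add: autj_def)

lemma T_component:
  assumes "autj k \<upsilon> matT z *s F (z + 1) = \<rho> matT *v F z"
  shows "F (z + 1) $ j = exp (2 * of_real pi * \<i> * of_real (l j)) * F z $ j"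
proof -
  have "inverse (\<upsilon> matT) * F (z + 1) $ j = t j * F z $ j"
    using arg_cong[OF assms, of "\<lambda>v. v $ j"] exhaust_2[of j]
    by (auto simp: autj_T rho_T mat2_mv_nth)
  hence "F (z + 1) $ j = \<upsilon> matT * t j * F z $ j"
    using upsilon_nz[OF ms, of matT] by (simp add: field_simps)
  thus ?thesis by (simp only: exp_l)
qed

lemma vvmf_qser:
  assumes "F \<in> vvmf k \<rho> \<upsilon>" "multiplier_system k \<upsilon>"
  obtains h where "fconv h" "(\<lambda>z. F z $ j) = qser (l j) h"
proof (rule moderate_growth_imp_qser[of "\<lambda>z. F z $ j" "l j"])
  note * = assms(1)[unfolded vvmf_iff[OF assms(2)]]
  show "(\<lambda>z. F z $ j) holomorphic_on UH" "moderate_growth (\<lambda>z. F z $ j)" using * by auto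
  show "l j < 1" by (rule l_range)
  show "F (z + 1) $ j = exp (2 * of_real pi * \<i> * of_real (l j)) * F z $ j" if "z \<in> UH" for z
    using * that by (intro T_component) auto
  show "F z $ j = 0" if "z \<notin> UH" for z using * that by simp
qed (use that in blast)

lemma modD_vec_vvmf:
  assumes F: "F \<in> vvmf k \<rho> \<upsilon>" and k: "multiplier_system k \<upsilon>"
  shows "modD_vec k F \<in> vvmf (k + 2) \<rho> \<upsilon>"
proof -
  have k2: "multiplier_system (k + 2) \<upsilon>" using multiplier_system_shift[OF k, of 2] by simp
  note * = F[unfolded vvmf_iff[OF k]]
  have hol: "(\<lambda>z. F z $ j) holomorphic_on UH" for j using * by auto
  have comm: "slash (k + 2) \<upsilon> \<gamma> (modD k (\<lambda>w. F w $ j)) z = (\<rho> \<gamma> *v modD_vec k F z) $ j"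
    if z: "z \<in> UH" and g: "\<gamma> \<in> carrier SL2Z"
      "modD k (slash k \<upsilon> \<gamma> (\<lambda>w. F w $ j)) z = slash (k + 2) \<upsilon> \<gamma> (modD k (\<lambda>w. F w $ j)) z" for \<gamma> z j
  proof -
    have "modD k (slash k \<upsilon> \<gamma> (\<lambda>w. F w $ j)) = modD k (\<lambda>z. \<rho> \<gamma> $ j $ 1 * F z $ 1 + \<rho> \<gamma> $ j $ 2 * F z $ 2)"
    proof (rule modD_cong)
      fix z assume z: "z \<in> UH"
      have "slash k \<upsilon> \<gamma> (\<lambda>w. F w $ j) z = (autj k \<upsilon> \<gamma> z *s F (mobius \<gamma> z)) $ j" by (simp add: slash_autj)
      also have "\<dots> = \<rho> \<gamma> $ j $ 1 * F z $ 1 + \<rho> \<gamma> $ j $ 2 * F z $ 2"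
        unfolding vvmf_transform[OF F g(1) z] by (rule mat2_mv_nth)
      finally show "slash k \<upsilon> \<gamma> (\<lambda>w. F w $ j) z = \<rho> \<gamma> $ j $ 1 * F z $ 1 + \<rho> \<gamma> $ j $ 2 * F z $ 2" .
    qed
    hence "slash (k + 2) \<upsilon> \<gamma> (modD k (\<lambda>w. F w $ j)) z =
        \<rho> \<gamma> $ j $ 1 * modD k (\<lambda>w. F w $ 1) z + \<rho> \<gamma> $ j $ 2 * modD k (\<lambda>w. F w $ 2) z"
      unfolding g(2)[symmetric] by (simp only: modD_lin2[OF hol hol])
    thus ?thesis by (simp add: mat2_mv_nth modD_vec_def)
  qed
  show ?thesis unfolding vvmf_iff[OF k2]
  proof (intro conjI allI impI ballI)
    show "modD_vec k F z = 0" if "z \<notin> UH" for z using that by (simp add: modD_vec_def modD_def vec_eq_iff)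
    fix j
    \<comment> \<open>The growth condition is not differentiated. The expansion of a component gives
      the expansion of its modular derivative with the same exponent, and moderate growth follows
      from that.\<close>
    obtain h where h: "fconv h" "(\<lambda>z. F z $ j) = qser (l j) h" using vvmf_qser[OF F k] by blast
    have eq: "(\<lambda>z. modD_vec k F z $ j) = qser (l j) (fD k (l j) h)"
      by (simp add: modD_vec_def h modD_qser)
    show "(\<lambda>z. modD_vec k F z $ j) holomorphic_on UH" unfolding eq by (intro qser_holomorphic fconv_fD h)
    show "moderate_growth (\<lambda>z. modD_vec k F z $ j)" unfolding eq
      by (intro qser_moderate_growth fconv_fD h l_range)
  next
    fix z assume z: "z \<in> UH"
    show "autj (k + 2) \<upsilon> matS z *s modD_vec k F (- (1 / z)) = \<rho> matS *v modD_vec k F z"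
      using comm[OF z _ modD_slash_S[OF hol z]]
      by (auto simp: vec_eq_iff slash_autj mobius_matS modD_vec_def)
    show "autj (k + 2) \<upsilon> matT z *s modD_vec k F (z + 1) = \<rho> matT *v modD_vec k F z"
      using comm[OF z _ modD_slash_T[OF hol z]]
      by (auto simp: vec_eq_iff slash_autj mobius_matT modD_vec_def)
  qed
qed

end

section \<open>The modular differential equation of order two\<close>

definition ode_sol :: "real \<Rightarrow> complex \<Rightarrow> (complex \<Rightarrow> complex) \<Rightarrow> bool" where
  "ode_sol k c f \<longleftrightarrow> f holomorphic_on UH \<and>
     (\<forall>z\<in>UH. modD (k + 2) (modD k f) z + c * E4 z * f z = 0)"

text \<open>The terms with \<open>E2\<close> cancel, so on the upper half-plane this is the ordinary
  Wronskian divided by 2 pi i. Written with the modular derivative it visibly has weight 2k +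
  2.\<close>

definition wronskian :: "real \<Rightarrow> (complex \<Rightarrow> complex) \<Rightarrow> (complex \<Rightarrow> complex) \<Rightarrow> complex \<Rightarrow> complex" where
  "wronskian k f g z = f z * modD k g z - g z * modD k f z"

lemma ode_sol_lin2:
  assumes "ode_sol k c f" "ode_sol k c g"
  shows "ode_sol k c (\<lambda>z. a * f z + b * g z)"
proof -
  have hol: "f holomorphic_on UH" "g holomorphic_on UH" using assms by (simp_all add: ode_sol_def)
  have "modD k (\<lambda>z. a * f z + b * g z) = (\<lambda>z. a * modD k f z + b * modD k g z)"
    using modD_lin2[OF hol] by blast
  hence "modD (k + 2) (modD k (\<lambda>z. a * f z + b * g z)) z =
      a * modD (k + 2) (modD k f) z + b * modD (k + 2) (modD k g) z" for z
    by (simp add: modD_lin2 modD_holomorphic hol)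
  moreover have "a * x + b * y + c * E4 z * (a * f z + b * g z) =
      a * (x + c * E4 z * f z) + b * (y + c * E4 z * g z)" for x y z by (simp add: algebra_simps)
  ultimately show ?thesis using assms by (auto simp: ode_sol_def intro!: holomorphic_intros)
qed

lemma wronskian_holomorphic:
  "f holomorphic_on UH \<Longrightarrow> g holomorphic_on UH \<Longrightarrow> wronskian k f g holomorphic_on UH"
  unfolding wronskian_def[abs_def] by (intro holomorphic_intros modD_holomorphic)

lemma modD_wronskian:
  assumes "ode_sol k c f" "ode_sol k c g" "z \<in> UH"
  shows "modD (2 * k + 2) (wronskian k f g) z = 0"
proof -
  have hol: "f holomorphic_on UH" "g holomorphic_on UH" using assms by (simp_all add: ode_sol_def)
  note hol' = modD_holomorphic[OF hol(1), of k] modD_holomorphic[OF hol(2), of k]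
  have k2: "2 * k + 2 = k + (k + 2)" by simp
  have W: "wronskian k f g = (\<lambda>z. 1 * (f z * modD k g z) + (-1) * (g z * modD k f z))"
    by (simp add: wronskian_def fun_eq_iff)
  have "modD (2 * k + 2) (wronskian k f g) z =
      1 * (modD k f z * modD k g z + f z * modD (k + 2) (modD k g) z) +
      (-1) * (modD k g z * modD k f z + g z * modD (k + 2) (modD k f) z)"
    unfolding W k2
    by (simp only: modD_lin2[OF holomorphic_on_mult[OF hol(1) hol'(2)] holomorphic_on_mult[OF hol(2) hol'(1)]]
        modD_mult[OF hol(1) hol'(2)] modD_mult[OF hol(2) hol'(1)])
  moreover have "modD (k + 2) (modD k g) z = - c * E4 z * g z" "modD (k + 2) (modD k f) z = - c * E4 z * f z"
    using assms by (simp_all add: ode_sol_def add_eq_0_iff2)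
  ultimately show ?thesis by simp
qed

text \<open>The exponent \<open>p\<close> is quantified first because it depends on the weight only.
  All Wronskians of solutions in weight k are thus multiples of one and the same nowhere vanishing
  function, and quotients of them are constants.\<close>

lemma wronskian_exp:
  "\<exists>p :: complex \<Rightarrow> complex. \<forall>f g c. ode_sol k c f \<longrightarrow> ode_sol k c g \<longrightarrow>
     (\<exists>C. \<forall>z\<in>UH. wronskian k f g z = C * exp (p z))"
proof -
  define e where "e z = 2 * of_real pi * \<i> * (of_real (2 * k + 2) / 12 * E2 z)" for z
  have "e holomorphic_on UH" unfolding e_def by (intro holomorphic_intros E2_holomorphic)
  then obtain p where "\<And>z. z \<in> UH \<Longrightarrow> (p has_field_derivative e z) (at z within UH)"
    using holomorphic_convex_primitive'[OF convex_UH open_UH] by blast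
  hence p: "(p has_field_derivative e z) (at z)" if "z \<in> UH" for z
    using that by (simp add: at_within_open[OF _ open_UH])
  have "\<exists>C. \<forall>z\<in>UH. wronskian k f g z = C * exp (p z)" if fg: "ode_sol k c f" "ode_sol k c g" for f g c
  proof -
    let ?W = "wronskian k f g"
    have hol: "?W holomorphic_on UH" using fg by (intro wronskian_holomorphic) (simp_all add: ode_sol_def)
    have "((\<lambda>z. ?W z * exp (- p z)) has_field_derivative 0) (at z within UH)" if z: "z \<in> UH" for z
    proof -
      have "(?W has_field_derivative e z * ?W z) (at z)"
        by (rule DERIV_cong[OF modD_has_deriv[OF hol z, of "2 * k + 2"]])
           (simp add: e_def modD_wronskian[OF fg z] del: of_real_add of_real_mult)
      from DERIV_mult[OF this DERIV_chain2[OF DERIV_exp DERIV_minus[OF p[OF z]]]]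
      have "((\<lambda>z. ?W z * exp (- p z)) has_field_derivative 0) (at z)" by (simp add: mult_ac)
      thus ?thesis by (rule has_field_derivative_at_within)
    qed
    from has_field_derivative_zero_constant[OF convex_UH this] obtain C
      where "\<And>z. z \<in> UH \<Longrightarrow> ?W z * exp (- p z) = C" by blast
    hence "\<forall>z\<in>UH. ?W z = C * exp (p z)" by (auto simp: exp_minus field_simps)
    thus ?thesis by blast
  qed
  thus ?thesis by blast
qed

lemma wronskian_nonzero:
  assumes "ode_sol k c f" "ode_sol k c g" "z0 \<in> UH" "wronskian k f g z0 \<noteq> 0" "z \<in> UH"
  shows "wronskian k f g z \<noteq> 0"
proof -
  obtain p where "\<And>f g c. ode_sol k c f \<Longrightarrow> ode_sol k c g \<Longrightarrow> \<exists>C. \<forall>z\<in>UH. wronskian k f g z = C * exp (p z)"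
    using wronskian_exp[of k] by auto
  with assms(1,2) obtain C where "\<forall>z\<in>UH. wronskian k f g z = C * exp (p z)" by blast
  thus ?thesis using assms(3-5) by auto
qed

text \<open>Cramer's rule expresses g through f1 and f2 with quotients of Wronskians as
  coefficients, and these are constant by \<open>wronskian_exp\<close>.\<close>

lemma ode_sol_span:
  assumes f: "ode_sol k c f1" "ode_sol k c f2" and g: "ode_sol k c g"
    and z0: "z0 \<in> UH" "wronskian k f1 f2 z0 \<noteq> 0"
  obtains a b where "\<And>z. z \<in> UH \<Longrightarrow> g z = a * f1 z + b * f2 z"
proof -
  obtain p where p: "\<And>f g c. ode_sol k c f \<Longrightarrow> ode_sol k c g \<Longrightarrow> \<exists>C. \<forall>z\<in>UH. wronskian k f g z = C * exp (p z)"
    using wronskian_exp[of k] by auto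
  obtain C where C: "\<And>z. z \<in> UH \<Longrightarrow> wronskian k f1 f2 z = C * exp (p z)" using p[OF f] by blast
  obtain A where A: "\<And>z. z \<in> UH \<Longrightarrow> wronskian k g f2 z = A * exp (p z)" using p[OF g f(2)] by blast
  obtain B where B: "\<And>z. z \<in> UH \<Longrightarrow> wronskian k f1 g z = B * exp (p z)" using p[OF f(1) g] by blast
  have C0: "C \<noteq> 0" using C[OF z0(1)] z0(2) by auto
  have "g z = A / C * f1 z + B / C * f2 z" if z: "z \<in> UH" for z
  proof -
    have "g z * wronskian k f1 f2 z = f1 z * wronskian k g f2 z + f2 z * wronskian k f1 g z"
      by (simp add: wronskian_def algebra_simps)
    hence "exp (p z) * (C * g z) = exp (p z) * (A * f1 z + B * f2 z)"
      unfolding A[OF z] B[OF z] C[OF z] by (simp add: algebra_simps)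
    hence "C * g z = A * f1 z + B * f2 z" by (simp only: mult_left_cancel exp_not_eq_zero not_False_eq_True)
    thus ?thesis using C0 by (simp add: field_simps)
  qed
  thus ?thesis by (rule that)
qed

lemma wronskian_independent:
  assumes "f1 holomorphic_on UH" "f2 holomorphic_on UH" "z0 \<in> UH" "wronskian k f1 f2 z0 \<noteq> 0"
    and "\<And>z. z \<in> UH \<Longrightarrow> a * f1 z + b * f2 z = 0"
  shows "a = 0 \<and> b = 0"
proof -
  have "modD k (\<lambda>z. a * f1 z + b * f2 z) = modD k (\<lambda>_. 0)" by (rule modD_cong) (rule assms(5))
  moreover have "modD k (\<lambda>_. 0) z0 = 0" by (simp add: modD_def)
  ultimately have D: "a * modD k f1 z0 + b * modD k f2 z0 = 0"
    using modD_lin2[OF assms(1,2), of k a b z0] by simp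
  have f: "a * f1 z0 + b * f2 z0 = 0" by (rule assms(5)[OF assms(3)])
  have "a * wronskian k f1 f2 z0 = (a * f1 z0 + b * f2 z0) * modD k f2 z0 - f2 z0 * (a * modD k f1 z0 + b * modD k f2 z0)"
    "b * wronskian k f1 f2 z0 = f1 z0 * (a * modD k f1 z0 + b * modD k f2 z0) - (a * f1 z0 + b * f2 z0) * modD k f1 z0"
    by (simp_all add: wronskian_def algebra_simps)
  thus ?thesis using assms(4) unfolding D f by simp
qed

lemma slash_S_cong:
  "z \<in> UH \<Longrightarrow> (\<And>z. z \<in> UH \<Longrightarrow> f z = g z) \<Longrightarrow> slash k \<upsilon> matS f z = slash k \<upsilon> matS g z"
  by (simp add: slash_def mobius_matS neg_inverse_UH)

text \<open>Two modular derivatives carry the slash operator to weight k + 4, and the factor z^4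
  from \<open>E4\<close> brings the other term to the same weight.\<close>

lemma ode_sol_slash_S:
  assumes "ode_sol k c f"
  shows "ode_sol k c (slash k \<upsilon> matS f)"
  unfolding ode_sol_def
proof (intro conjI ballI)
  have hol: "f holomorphic_on UH" using assms by (simp add: ode_sol_def)
  show "slash k \<upsilon> matS f holomorphic_on UH" by (rule slash_holomorphic_S[OF hol])
  fix z assume z: "z \<in> UH"
  have nz: "z \<noteq> 0" by (rule UH_nz[OF z])
  have "modD (k + 2) (modD k (slash k \<upsilon> matS f)) z = modD (k + 2) (slash (k + 2) \<upsilon> matS (modD k f)) z"
    by (rule arg_cong[of _ _ "\<lambda>g. g z"], rule modD_cong) (rule modD_slash_S[OF hol])
  also have "\<dots> = slash (k + 2 + 2) \<upsilon> matS (modD (k + 2) (modD k f)) z"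
    by (rule modD_slash_S[OF modD_holomorphic[OF hol] z])
  also have "\<dots> = slash (k + 2 + 2) \<upsilon> matS (\<lambda>z. - c * E4 z * f z) z"
    by (rule slash_S_cong[OF z]) (use assms in \<open>simp add: ode_sol_def add_eq_0_iff2\<close>)
  also have "\<dots> = - c * E4 z * slash k \<upsilon> matS f z"
  proof -
    have "z powr (- of_real (k + 2 + 2)) * z ^ 4 = z powr (- of_real k)"
    proof -
      have "z powr (- of_real (k + 2 + 2)) = z powr (- of_real k - 4)" by (simp add: algebra_simps)
      also have "\<dots> = z powr (- of_real k) / z powr 4" by (rule powr_diff)
      also have "z powr 4 = z ^ 4" using powr_nat'[of z 4] nz by simp
      finally show ?thesis using nz by simp
    qed
    hence "slash (k + 2 + 2) \<upsilon> matS (\<lambda>z. - c * E4 z * f z) z =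
       inverse (\<upsilon> matS) * (z powr (- of_real (k + 2 + 2)) * z ^ 4) * (- c * E4 z * f (- (1 / z)))"
      unfolding slash_def mobius_matS autf_matS E4_S[OF z] by (simp only: mult_ac)
    also have "z powr (- of_real (k + 2 + 2)) * z ^ 4 = z powr (- of_real k)" by fact
    finally show ?thesis unfolding slash_def mobius_matS autf_matS by (simp only: mult_ac)
  qed
  finally show "modD (k + 2) (modD k (slash k \<upsilon> matS f)) z + c * E4 z * slash k \<upsilon> matS f z = 0" by simp
qed

lemma ode_sol_qser:
  assumes "fconv h"
    and "fD (k + 2) x (fD k x h) + fps_const c * (E2_fps * E2_fps - fps_const 12 * ftheta E2_fps) * h = 0"
  shows "ode_sol k c (qser x h)"
  unfolding ode_sol_def
proof (intro conjI ballI)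
  show "qser x h holomorphic_on UH" by (rule qser_holomorphic[OF assms(1)])
  fix z assume z: "z \<in> UH"
  let ?E = "E2_fps * E2_fps - fps_const 12 * ftheta E2_fps"
  have "modD (k + 2) (modD k (qser x h)) z = qser x (fD (k + 2) x (fD k x h)) z"
    by (simp add: modD_qser assms(1) fconv_fD)
  moreover have "c * E4 z * qser x h z = qser x (fps_const c * ?E * h) z"
  proof -
    have "qser x (fps_const c * ?E * h) z = qser 0 (fps_const c) z * qser 0 ?E z * qser x h z"
      by (simp add: qser_mult0 assms(1) fconv_intros fconv_E4 del: fps_const_mult)
    thus ?thesis by (simp add: qser_const qser_one z E4_def)
  qed
  ultimately have "modD (k + 2) (modD k (qser x h)) z + c * E4 z * qser x h z =
      qser x (fD (k + 2) x (fD k x h) + fps_const c * ?E * h) z"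
    using assms(1) by (simp add: qser_add fconv_fD fconv_intros fconv_E4)
  also have "\<dots> = 0" unfolding assms(2) by (simp add: qser_def)
  finally show "modD (k + 2) (modD k (qser x h)) z + c * E4 z * qser x h z = 0" .
qed

text \<open>The indicial polynomial of the equation is \<open>(X - x) (X - y)\<close>.\<close>

lemma ode_series_solution:
  fixes x y k :: real
  assumes k: "k = 6 * (x + y) - 1" and xy: "\<bar>x - y\<bar> < 1"
    and c: "c = of_real (x * y - k * (k + 2) / 144)"
  obtains h where "fconv h" "fps_nth h 0 = 1" "ode_sol k c (qser x h)"
proof -
  let ?E = E2_fps
  define L A B where LAB: "L = fps_const (complex_of_real x)" "A = fps_const (complex_of_real (k / 12))"
    "B = fps_const (complex_of_real ((k + 2) / 12))"
  \<comment> \<open>Splitting off q^x turns the equation into the operator (\<theta> + L - B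
    E)(\<theta> + L - A E) + c (E^2 - 12 \<theta> E) on the power series factor, with \<theta> = q
    d/dq and E for \<open>E2_fps\<close>. Expanding it gives the coefficients P and Q.\<close>
  define P where "P = L + L - (A + B) * ?E"
  define Q where "Q = (L - B * ?E) * (L - A * ?E) - A * ftheta ?E + fps_const c * (?E * ?E - fps_const 12 * ftheta ?E)"
  have E0: "fps_nth ?E 0 = 1" "fps_nth (ftheta ?E) 0 = 0"
    by (simp_all add: E2_fps_def E2_coeff_def ftheta_nth)
  have P0: "fps_nth P 0 = of_real (x - y)"
    by (simp add: P_def LAB E0 k field_simps)
  have "fps_nth Q 0 = of_real ((x - (k + 2) / 12) * (x - k / 12) + (x * y - k * (k + 2) / 144))"
    by (simp add: Q_def LAB E0 c)
  also have "(x - (k + 2) / 12) * (x - k / 12) + (x * y - k * (k + 2) / 144) = 0"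
    unfolding k by (simp add: field_simps)
  finally have Q0: "fps_nth Q 0 = 0" by simp
  have conv: "fconv P" "fconv Q" unfolding P_def Q_def LAB by (intro fconv_intros)+
  \<comment> \<open>A resonance would require n = y - x for some n at least 1, against |x - y| <
    1.\<close>
  have "of_nat n + fps_nth P 0 \<noteq> 0" if "n \<ge> 1" for n
  proof
    assume "of_nat n + fps_nth P 0 = 0"
    hence "complex_of_real (real n + (x - y)) = 0" by (simp add: P0)
    hence "real n + (x - y) = 0" by (simp only: of_real_eq_0_iff)
    with that xy show False by linarith
  qed
  from frobenius_solution[OF conv Q0 this] obtain h where h: "fconv h" "fps_nth h 0 = 1"
    "ftheta (ftheta h) + P * ftheta h + Q * h = 0" by blast
  have "fD (k + 2) x (fD k x h) + fps_const c * (?E * ?E - fps_const 12 * ftheta ?E) * h =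
      ftheta (ftheta h) + P * ftheta h + Q * h"
  proof -
    have \<theta>: "ftheta L = 0" "ftheta A = 0" by (simp_all add: LAB ftheta_const)
    show ?thesis
      unfolding fD_def P_def Q_def LAB[symmetric] ftheta_add ftheta_diff ftheta_mult \<theta>
      by (simp add: algebra_simps)
  qed
  with h show ?thesis by (intro that ode_sol_qser) auto
qed

lemma wronskian_qser:
  assumes "fconv g" "fconv h"
  shows "wronskian k (qser x g) (qser y h) z = qser (x + y) (g * fD k y h - h * fD k x g) z"
proof -
  have "qser (x + y) (g * fD k y h) z = qser x g z * qser y (fD k y h) z"
    by (rule qser_mult) (intro assms fconv_fD)+
  moreover have "qser (y + x) (h * fD k x g) z = qser y h z * qser x (fD k x g) z"
    by (rule qser_mult) (intro assms fconv_fD)+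
  ultimately show ?thesis
    unfolding wronskian_def modD_qser[OF assms(1)] modD_qser[OF assms(2)]
    by (simp add: qser_diff fconv_intros fconv_fD assms add.commute[of y x])
qed

lemma fD_nth_0: "fps_nth (fD k x h) 0 = (of_real x - of_real (k / 12)) * fps_nth h 0"
  by (simp add: fD_def ftheta_nth E2_fps_def E2_coeff_def algebra_simps)

section \<open>A form in the minimal weight\<close>

lemma autj_S_shift: "z \<in> UH \<Longrightarrow> autj (k + 2) \<upsilon> matS z = autj k \<upsilon> matS z / z\<^sup>2"
proof -
  assume z: "z \<in> UH"
  have "z powr (- of_real (k + 2)) = z powr (- of_real k - 2)" by (simp add: algebra_simps)
  also have "\<dots> = z powr (- of_real k) / z powr 2" by (rule powr_diff)
  also have "z powr 2 = z ^ 2" using powr_nat'[of z 2] UH_nz[OF z] by simp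
  finally show ?thesis by (simp add: autj_def)
qed

lemma qexp_periodic: "qexp l (z + 1) = exp (2 * of_real pi * \<i> * of_real l) * qexp l z"
  by (simp add: qexp_def ring_distribs exp_add)

lemma qser_periodic: "z \<in> UH \<Longrightarrow> qser l h (z + 1) = exp (2 * of_real pi * \<i> * of_real l) * qser l h z"
  using qexp_periodic[of 1 z] by (simp add: qser_def UH_add1 qexp_periodic)

lemma qser_nonzero_point:
  assumes "fconv h" "fps_nth h 0 \<noteq> 0"
  obtains z where "z \<in> UH" "qser l h z \<noteq> 0"
proof -
  obtain Y c where Y: "Y > 0" "c > 0" "\<And>z. Im z \<ge> Y \<Longrightarrow> norm (qser l h z) \<ge> c * exp (- 2 * pi * l * Im z)"
    using qser_lower_bound[OF assms, of l] by blast
  have "0 < c * exp (- 2 * pi * l * Im (Complex 0 Y))" using Y(2) by simp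
  also have "\<dots> \<le> norm (qser l h (Complex 0 Y))" by (rule Y(3)) simp
  finally have "qser l h (Complex 0 Y) \<noteq> 0" by simp
  thus ?thesis using that[of "Complex 0 Y"] Y(1) by (simp add: UH_def)
qed

context vvmf2
begin

definition c0 :: complex where "c0 = of_real (l 1 * l 2 - k0 * (k0 + 2) / 144)"

text \<open>Since both exponents lie in [0,1), the recursion has no resonance for either of them,
  and each solution is a pure q-series starting with 1.\<close>

lemma series_solutions:
  "\<exists>h :: 2 \<Rightarrow> complex fps. \<forall>j. fconv (h j) \<and> fps_nth (h j) 0 = 1 \<and> ode_sol k0 c0 (qser (l j) (h j))"
proof -
  have "\<exists>h. fconv h \<and> fps_nth h 0 = 1 \<and> ode_sol k0 c0 (qser (l j) h)" for j
  proof -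
    define j' :: 2 where "j' = (if j = 1 then 2 else 1)"
    have j: "k0 = 6 * (l j + l j') - 1" "\<bar>l j - l j'\<bar> < 1" "c0 = of_real (l j * l j' - k0 * (k0 + 2) / 144)"
      using exhaust_2[of j] l_range[of j] l_range[of j'] by (auto simp: j'_def k0_def c0_def)
    show ?thesis by (rule ode_series_solution[OF j]) blast
  qed
  thus ?thesis by (intro choice) blast
qed

text \<open>The leading coefficient is the product of those of the two series times l2 - l1, which
  is nonzero because the eigenvalues of \<open>\<rho> matT\<close> are distinct.\<close>

lemma ode_imp_qser_wronskian:
  fixes h :: "2 \<Rightarrow> complex fps"
  assumes h: "\<And>j. fconv (h j)" "\<And>j. fps_nth (h j) 0 \<noteq> 0"
  shows "\<exists>w. fconv w \<and> fps_nth w 0 \<noteq> 0 \<and>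
    wronskian k0 (qser (l 1) (h 1)) (qser (l 2) (h 2)) = qser (l 1 + l 2) w"
proof -
  define w where "w = h 1 * fD k0 (l 2) (h 2) - h 2 * fD k0 (l 1) (h 1)"
  have "fconv w" unfolding w_def by (intro fconv_intros fconv_fD h)
  moreover have "fps_nth w 0 = fps_nth (h 1) 0 * fps_nth (h 2) 0 * of_real (l 2 - l 1)"
    by (simp add: w_def fD_nth_0 algebra_simps)
  hence "fps_nth w 0 \<noteq> 0" using h(2) l_distinct by simp
  moreover have "wronskian k0 (qser (l 1) (h 1)) (qser (l 2) (h 2)) = qser (l 1 + l 2) w"
    unfolding w_def by (rule ext, rule wronskian_qser) (rule h)+
  ultimately show ?thesis by blast
qed

text \<open>If both solutions were eigenfunctions of \<open>S\<close>, then \<open>f\<^sub>1 f\<^sub>2 / W\<close> would be a bounded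
  form of weight \<open>-2\<close>.\<close>

lemma not_both_eigenfunctions:
  fixes h :: "2 \<Rightarrow> complex fps"
  assumes h: "\<And>j. fconv (h j)" "\<And>j. fps_nth (h j) 0 \<noteq> 0" "\<And>j. ode_sol k0 c0 (qser (l j) (h j))"
    and s: "s1 \<noteq> 0" "s2 \<noteq> 0"
    and S: "\<And>z. z \<in> UH \<Longrightarrow> autj k0 \<upsilon> matS z * qser (l 1) (h 1) (- (1 / z)) = s1 * qser (l 1) (h 1) z"
      "\<And>z. z \<in> UH \<Longrightarrow> autj k0 \<upsilon> matS z * qser (l 2) (h 2) (- (1 / z)) = s2 * qser (l 2) (h 2) z"
  shows False
proof -
  define f1 f2 where f: "f1 = qser (l 1) (h 1)" "f2 = qser (l 2) (h 2)"
  have hol: "f1 holomorphic_on UH" "f2 holomorphic_on UH" unfolding f by (intro qser_holomorphic h)+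
  define W where "W = wronskian k0 f1 f2"
  obtain w where w: "fconv w" "fps_nth w 0 \<noteq> 0" "W = qser (l 1 + l 2) w"
    using ode_imp_qser_wronskian[of h, OF h(1,2)] unfolding W_def f by auto
  obtain z0 where "z0 \<in> UH" "W z0 \<noteq> 0" using qser_nonzero_point[OF w(1,2)] w(3) by metis
  hence Wnz: "W z \<noteq> 0" if "z \<in> UH" for z
    using wronskian_nonzero[OF h(3)[of 1] h(3)[of 2]] that unfolding W_def f by blast
  have Whol: "W holomorphic_on UH" unfolding W_def by (intro wronskian_holomorphic hol)
  define g where "g z = f1 z * f2 z / W z" for z
  \<comment> \<open>A function that S multiplies by a constant has a modular derivative that S
    multiplies by the same constant, in weight two higher.\<close>
  have D: "autj (k0 + 2) \<upsilon> matS z * modD k0 f (- (1 / z)) = s * modD k0 f z"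
    if "f holomorphic_on UH" "z \<in> UH" "\<And>z. z \<in> UH \<Longrightarrow> autj k0 \<upsilon> matS z * f (- (1 / z)) = s * f z" for f s z
  proof -
    have "modD k0 (slash k0 \<upsilon> matS f) = modD k0 (\<lambda>z. s * f z)"
      by (rule modD_cong) (simp add: slash_autj mobius_matS that(3))
    thus ?thesis using modD_slash_S[OF that(1,2), of k0 \<upsilon>]
      by (simp add: modD_cmult[OF that(1)] slash_autj mobius_matS)
  qed
  have g_S: "g (- (1 / z)) = g z / z\<^sup>2" if z: "z \<in> UH" for z
  proof -
    define j where "j = autj k0 \<upsilon> matS z"
    have j0: "j \<noteq> 0" unfolding j_def by (rule autj_nz[OF multiplier_k0 _ z]) simp
    have z0: "z \<noteq> 0" by (rule UH_nz[OF z])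
    have f': "f1 (- (1 / z)) = s1 * f1 z / j" "f2 (- (1 / z)) = s2 * f2 z / j"
      using S[OF z] j0 unfolding f j_def[symmetric] by (simp_all add: field_simps)
    have "j / z\<^sup>2 * modD k0 f1 (- (1 / z)) = s1 * modD k0 f1 z"
      "j / z\<^sup>2 * modD k0 f2 (- (1 / z)) = s2 * modD k0 f2 z"
      using D[OF hol(1) z, of s1] D[OF hol(2) z, of s2] S
      unfolding autj_S_shift[OF z] j_def[symmetric] f by auto
    hence D': "modD k0 f1 (- (1 / z)) = s1 * modD k0 f1 z * z\<^sup>2 / j" "modD k0 f2 (- (1 / z)) = s2 * modD k0 f2 z * z\<^sup>2 / j"
      using j0 z0 by (simp_all add: field_simps)
    have "W (- (1 / z)) = s1 * s2 * (z\<^sup>2 / j\<^sup>2) * W z"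
      unfolding W_def wronskian_def f' D'
      by (simp add: field_simps power2_eq_square diff_divide_distrib)
    moreover have "f1 (- (1 / z)) * f2 (- (1 / z)) = s1 * s2 / j\<^sup>2 * (f1 z * f2 z)"
      unfolding f' by (simp add: power2_eq_square)
    ultimately have "g (- (1 / z)) = (s1 * s2 / j\<^sup>2 * (f1 z * f2 z)) / (s1 * s2 * (z\<^sup>2 / j\<^sup>2) * W z)"
      by (simp only: g_def)
    also have "\<dots> = g z / z\<^sup>2" using s j0 z0 Wnz[OF z] by (simp add: g_def field_simps)
    finally show ?thesis .
  qed
  have g_T: "g (z + 1) = g z" if z: "z \<in> UH" for z
    using z unfolding g_def w(3) f by (simp add: qser_periodic ring_distribs exp_add)
  have conv: "fconv (h 1 * h 2)" by (intro fconv_intros h)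
  have ff: "f1 z * f2 z = qser (l 1 + l 2) (h 1 * h 2) z" for z unfolding f by (rule qser_mult[symmetric]) (rule h)+
  obtain B Y where bound: "\<And>z. Im z \<ge> Y \<Longrightarrow> norm (g z) \<le> B"
    using qser_quotient_bounded[OF conv w(1,2), of "l 1 + l 2"] unfolding g_def ff w(3) by blast
  have g0: "g z = 0" if "z \<in> UH" for z
  proof (rule negative_weight_zero[where h = g and s = 2 and Y = Y and B = B])
    show "g holomorphic_on UH" unfolding g_def by (intro holomorphic_intros hol Whol Wnz)
    show "norm (g (- (1 / z))) = norm z powr - 2 * norm (g z)" if "z \<in> UH" for z
      unfolding g_S[OF that] by (simp add: norm_divide norm_power powr_minus divide_inverse mult.commute norm_mult norm_inverse)
  qed (use that g_T bound in auto)
  have "fps_nth (h 1 * h 2) 0 \<noteq> 0" using h(2) by simp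
  then obtain z where z: "z \<in> UH" "qser (l 1 + l 2) (h 1 * h 2) z \<noteq> 0" using qser_nonzero_point[OF conv] by metis
  with g0[OF z(1)] Wnz[OF z(1)] show False unfolding g_def ff[symmetric] by simp
qed

lemma fundamental_vvmf:
  obtains h :: "2 \<Rightarrow> complex fps" where "\<And>j. fconv (h j)" "\<And>j. fps_nth (h j) 0 \<noteq> 0"
    "\<And>j. ode_sol k0 c0 (qser (l j) (h j))" "(\<lambda>z. \<chi> j. qser (l j) (h j) z) \<in> vvmf k0 \<rho> \<upsilon>"
proof -
  obtain h :: "2 \<Rightarrow> complex fps" where h: "\<And>j. fconv (h j)" "\<And>j. fps_nth (h j) 0 = 1"
    "\<And>j. ode_sol k0 c0 (qser (l j) (h j))"
    using series_solutions by auto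
  have h0: "fps_nth (h j) 0 \<noteq> 0" for j using h(2) by simp
  define f where "f j = qser (l j) (h j)" for j
  have sol: "ode_sol k0 c0 (f j)" for j unfolding f_def by (rule h)
  have hol: "f j holomorphic_on UH" for j unfolding f_def by (rule qser_holomorphic[OF h(1)])
  define F where "F z = (\<chi> j. f j z)" for z
  have Fj [simp]: "F z $ j = f j z" for z j by (simp add: F_def)
  obtain w where w: "fconv w" "fps_nth w 0 \<noteq> 0" "wronskian k0 (f 1) (f 2) = qser (l 1 + l 2) w"
    using ode_imp_qser_wronskian[of h, OF h(1) h0] unfolding f_def by auto
  obtain z0 where z0: "z0 \<in> UH" "wronskian k0 (f 1) (f 2) z0 \<noteq> 0"
    using qser_nonzero_point[OF w(1,2)] w(3) by metis
  have "\<exists>A :: 2 \<Rightarrow> complex \<times> complex. \<forall>j. \<forall>z\<in>UH. slash k0 \<upsilon> matS (f j) z = fst (A j) * f 1 z + snd (A j) * f 2 z"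
  proof (rule choice, rule allI)
    fix j
    obtain a b where "\<And>z. z \<in> UH \<Longrightarrow> slash k0 \<upsilon> matS (f j) z = a * f 1 z + b * f 2 z"
      using ode_sol_span[OF sol[of 1] sol[of 2] ode_sol_slash_S[OF sol[of j]] z0] by blast
    thus "\<exists>p. \<forall>z\<in>UH. slash k0 \<upsilon> matS (f j) z = fst p * f 1 z + snd p * f 2 z"
      by (intro exI[of _ "(a, b)"]) simp
  qed
  then obtain A0 :: "2 \<Rightarrow> complex \<times> complex"
    where A0: "\<And>j z. z \<in> UH \<Longrightarrow> slash k0 \<upsilon> matS (f j) z = fst (A0 j) * f 1 z + snd (A0 j) * f 2 z" by blast
  define a b c d where abcd: "a = fst (A0 1)" "b = snd (A0 1)" "c = fst (A0 2)" "d = snd (A0 2)"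
  have S: "intertwines k0 F matS (mat2 a b c d)"
    using A0 by (auto simp: intertwines_def vec2_eq_iff mat2_mv_nth abcd mobius_matS slash_autj)
  have S1: "autj k0 \<upsilon> matS z * f 1 (- (1 / z)) = a * f 1 z + b * f 2 z"
    and S2: "autj k0 \<upsilon> matS z * f 2 (- (1 / z)) = c * f 1 z + d * f 2 z" if "z \<in> UH" for z
    using S that by (auto simp: intertwines_def vec2_eq_iff mat2_mv_nth mobius_matS)
  have fT: "autj k0 \<upsilon> matT z * f j (z + 1) = t j * f j z" if "z \<in> UH" for z j
    using that upsilon_nz[OF ms, of matT] by (simp add: f_def qser_periodic exp_l autj_T)
  have T: "intertwines k0 F matT (mat2 (t 1) 0 0 (t 2))"
    by (auto simp: intertwines_def vec2_eq_iff mat2_mv_nth mobius_matT fT)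
  define e where "e = inverse (\<upsilon> neg1) * exp (- (\<i> * of_real (pi * k0)))"
  have N: "intertwines k0 F neg1 (mat2 e 0 0 e)"
    by (auto simp: intertwines_def vec2_eq_iff mat2_mv_nth autj_neg1[OF multiplier_k0] e_def)
  have e0: "e \<noteq> 0" using upsilon_nz[OF multiplier_k0, of neg1] by (simp add: e_def)
  \<comment> \<open>Linear independence of f1 and f2 makes the matrix attached to a group element
    unique. Relations between words in S and T therefore become relations between matrices.\<close>
  have uniq: "A = B" if "intertwines k0 F \<gamma> A" "intertwines k0 F \<gamma> B" for A B \<gamma>
  proof -
    have eq: "(A $ j $ 1 - B $ j $ 1) * f 1 z + (A $ j $ 2 - B $ j $ 2) * f 2 z = 0" if "z \<in> UH" for j z
    proof -
      have "A *v F z = B *v F z" using \<open>intertwines k0 F \<gamma> A\<close> \<open>intertwines k0 F \<gamma> B\<close> that by (simp add: intertwines_def)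
      hence "(A *v F z) $ j = (B *v F z) $ j" by simp
      thus ?thesis by (simp add: mat2_mv_nth algebra_simps)
    qed
    have "A $ j $ 1 = B $ j $ 1 \<and> A $ j $ 2 = B $ j $ 2" for j
      using wronskian_independent[OF hol hol z0 eq[of _ j]] by simp
    thus ?thesis by (simp add: mat2_eq_iff)
  qed
  have "mat2 a b c d ** mat2 a b c d = mat2 e 0 0 e"
    using intertwines_mult[OF multiplier_k0 _ _ S S] by (intro uniq[OF _ N]) (simp add: matS_sq)
  hence sq: "a * a + b * c = e" "b * (a + d) = 0" "c * (a + d) = 0" "c * b + d * d = e"
    by (simp_all add: mat2_mult mat2_eq_iff algebra_simps)
  have ST: "intertwines k0 F (matS ** matT) (mat2 a b c d ** mat2 (t 1) 0 0 (t 2))"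
    by (rule intertwines_mult[OF multiplier_k0 _ _ S T]) simp_all
  have ST2: "intertwines k0 F ((matS ** matT) ** (matS ** matT))
      (mat2 a b c d ** mat2 (t 1) 0 0 (t 2) ** (mat2 a b c d ** mat2 (t 1) 0 0 (t 2)))"
    by (rule intertwines_mult[OF multiplier_k0 _ _ ST ST]) simp_all
  have "intertwines k0 F neg1 (mat2 a b c d ** mat2 (t 1) 0 0 (t 2) **
      (mat2 a b c d ** mat2 (t 1) 0 0 (t 2) ** (mat2 a b c d ** mat2 (t 1) 0 0 (t 2))))"
    unfolding matST_cube[symmetric] by (rule intertwines_mult[OF multiplier_k0 _ _ ST ST2]) simp_all
  hence cube: "mat2 a b c d ** mat2 (t 1) 0 0 (t 2) **
      (mat2 a b c d ** mat2 (t 1) 0 0 (t 2) ** (mat2 a b c d ** mat2 (t 1) 0 0 (t 2))) = mat2 e 0 0 e"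
    by (rule uniq[OF _ N])
  have bc: "b \<noteq> 0 \<or> c \<noteq> 0"
  proof (rule ccontr)
    assume "\<not> (b \<noteq> 0 \<or> c \<noteq> 0)"
    hence b: "b = 0" "c = 0" by auto
    hence "a \<noteq> 0" "d \<noteq> 0" using sq e0 by auto
    from not_both_eigenfunctions[OF h(1) h0 h(3) this] show False
      using S1 S2 unfolding b f_def by simp
  qed
  note rel = S_matrix_determined_by_T[OF sq(1-3) e0 t_nz t_nz cube bc]
  obtain a' b' c' e' where rho: "\<rho> matS = mat2 a' b' c' (- a')" "b' \<noteq> 0" "c' \<noteq> 0"
    "a' * (t 1 - t 2) * (t 1 * t 2) = 1" "e' * (t 1 * t 2) ^ 3 = -1" "b' * c' = e' - a' ^ 2"
    by (rule rho_S_relations) blast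
  have "a * ((t 1 - t 2) * (t 1 * t 2)) = a' * ((t 1 - t 2) * (t 1 * t 2))"
    using rel(2) rho(4) by (simp only: mult.assoc)
  hence a: "a = a'" using t_distinct by simp
  have "e * (t 1 * t 2) ^ 3 = e' * (t 1 * t 2) ^ 3" using rel(3) rho(5) by simp
  hence "e = e'" by simp
  hence bc': "b * c = b' * c'" using rel(4) rho(6) a by simp
  hence b0: "b \<noteq> 0" using rho(2,3) by auto
  \<comment> \<open>Replacing f1 by p f1 conjugates the matrix of S by a diagonal matrix: b becomes
    p b and c becomes c / p. As the products b c and b' c' agree, matching b with b' also matches c
    with c'.\<close>
  define p where "p = b' / b"
  have p0: "p \<noteq> 0" using rho(2) b0 by (simp add: p_def)
  have pb: "p * b = b'" "c' * p = c" using b0 bc' rho(2) by (simp_all add: p_def field_simps)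
  define h' where "h' j = (if j = 1 then fps_const p * h 1 else h j)" for j :: 2
  have h'conv: "fconv (h' j)" for j by (simp add: h'_def h fconv_intros)
  have f': "qser (l 1) (h' 1) z = p * f 1 z" "qser (l 2) (h' 2) z = f 2 z" for z
    using h(1) by (cases "z \<in> UH"; simp add: h'_def f_def qser_mult0 qser_const qser_one fconv_const; simp add: qser_def)+
  have sol': "ode_sol k0 c0 (qser (l j) (h' j))" for j
  proof -
    have "ode_sol k0 c0 (\<lambda>z. p * f 1 z + 0 * f 1 z)" by (rule ode_sol_lin2[OF sol sol])
    moreover have "qser (l 1) (h' 1) = (\<lambda>z. p * f 1 z + 0 * f 1 z)" "qser (l 2) (h' 2) = f 2"
      using f' by (simp_all add: fun_eq_iff)
    ultimately show ?thesis using exhaust_2[of j] sol[of 2] by auto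
  qed
  have "(\<lambda>z. \<chi> j. qser (l j) (h' j) z) \<in> vvmf k0 \<rho> \<upsilon>"
    unfolding vvmf_iff[OF multiplier_k0]
  proof (intro conjI allI impI ballI)
    fix z :: complex assume "z \<notin> UH"
    thus "(\<chi> j. qser (l j) (h' j) z) = 0" by (simp add: qser_def vec_eq_iff)
  next
    fix j
    show "(\<lambda>z. (\<chi> j. qser (l j) (h' j) z) $ j) holomorphic_on UH"
      by (simp add: qser_holomorphic h'conv)
    show "moderate_growth (\<lambda>z. (\<chi> j. qser (l j) (h' j) z) $ j)"
      using qser_moderate_growth[OF h'conv[of j] l_range(1)[of j]] by simp
  next
    fix z assume z: "z \<in> UH"
    have "autj k0 \<upsilon> matS z * (p * f 1 (- (1 / z))) = p * (autj k0 \<upsilon> matS z * f 1 (- (1 / z)))"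
      by (simp only: mult_ac)
    also have "\<dots> = a' * (p * f 1 z) + b' * f 2 z"
      unfolding S1[OF z] pb(1)[symmetric] a by (simp add: algebra_simps)
    finally have 1: "autj k0 \<upsilon> matS z * (p * f 1 (- (1 / z))) = a' * (p * f 1 z) + b' * f 2 z" .
    have 2: "autj k0 \<upsilon> matS z * f 2 (- (1 / z)) = c' * (p * f 1 z) + - a' * f 2 z"
      unfolding S2[OF z] rel(1) a pb(2)[symmetric] by (simp add: algebra_simps)
    show "autj k0 \<upsilon> matS z *s (\<chi> j. qser (l j) (h' j) (- (1 / z))) = \<rho> matS *v (\<chi> j. qser (l j) (h' j) z)"
      using 1 2 by (simp add: vec2_eq_iff mat2_mv_nth rho(1) f')
    show "autj k0 \<upsilon> matT z *s (\<chi> j. qser (l j) (h' j) (z + 1)) = \<rho> matT *v (\<chi> j. qser (l j) (h' j) z)"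
      using fT[OF z, of 1] fT[OF z, of 2] by (simp add: vec2_eq_iff mat2_mv_nth rho_T f' mult.left_commute)
  qed
  moreover have "fps_nth (h' j) 0 \<noteq> 0" for j using h(2) p0 by (simp add: h'_def)
  ultimately show ?thesis using h'conv sol' by (intro that) blast+
qed

end

section \<open>Quotients of determinants\<close>

definition det2 :: "(complex \<Rightarrow> complex^2) \<Rightarrow> (complex \<Rightarrow> complex^2) \<Rightarrow> complex \<Rightarrow> complex" where
  "det2 X Y z = X z $ 1 * Y z $ 2 - X z $ 2 * Y z $ 1"

lemma zero_modular_form: "0 \<in> modular_forms w"
  by (auto simp: modular_forms_def zero_fun_def)

lemma modular_form_qser:
  assumes "f \<in> modular_forms w"
  obtains h where "fconv h" "f = qser 0 h"
proof (rule moderate_growth_imp_qser[of f 0])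
  show "f holomorphic_on UH" using assms by (simp add: modular_forms_def)
  show "f z = 0" if "z \<notin> UH" for z using assms that by (simp add: modular_forms_def)
  show "f (z + 1) = exp (2 * of_real pi * \<i> * of_real 0) * f z" if "z \<in> UH" for z
  proof -
    have "f (mobius matT z) = autf matT z ^ w * f z"
      using assms that SL2Z_closed(2) unfolding modular_forms_def by blast
    thus ?thesis by (simp add: mobius_matT)
  qed
  obtain B Y where BY: "\<And>z. Im z \<ge> Y \<Longrightarrow> norm (f z) \<le> B"
    using assms by (auto simp: modular_forms_def)
  have "\<forall>\<^sub>F y in at_top. \<forall>x::real. \<bar>x\<bar> \<le> X \<longrightarrow> norm (f (Complex x y)) < y ^ 1" for X :: real
    using eventually_gt_at_top[of "max Y B"]
  proof eventually_elim
    case (elim y)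
    show ?case using elim by (auto intro: le_less_trans[OF BY])
  qed
  thus "moderate_growth f" unfolding moderate_growth_def by blast
qed (use that in auto)

section \<open>Closure of the spaces of forms under the module operations\<close>

context vvmf2
begin

lemma zero_vvmf:
  assumes "multiplier_system k \<upsilon>"
  shows "0 \<in> vvmf k \<rho> \<upsilon>"
proof -
  have "(\<lambda>z. 0) = qser 0 0" by (simp add: qser_def fun_eq_iff)
  hence "moderate_growth (\<lambda>z. 0)" using qser_moderate_growth[of 0 0] by simp
  thus ?thesis by (auto simp: vvmf_iff[OF assms] vec_eq_iff mat2_mv_nth)
qed

lemma add_vvmf:
  assumes k: "multiplier_system k \<upsilon>" and F: "F \<in> vvmf k \<rho> \<upsilon>" and G: "G \<in> vvmf k \<rho> \<upsilon>"
  shows "(\<lambda>z. F z + G z) \<in> vvmf k \<rho> \<upsilon>"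
proof -
  note * = F[unfolded vvmf_iff[OF k]] G[unfolded vvmf_iff[OF k]]
  show ?thesis unfolding vvmf_iff[OF k]
  proof (intro conjI allI impI ballI)
    fix j
    obtain f where f: "fconv f" "(\<lambda>z. F z $ j) = qser (l j) f" using vvmf_qser[OF F k] by blast
    obtain g where g: "fconv g" "(\<lambda>z. G z $ j) = qser (l j) g" using vvmf_qser[OF G k] by blast
    have fg: "fconv (f + g)" by (intro fconv_intros f g)
    have eq: "(\<lambda>z. (F z + G z) $ j) = qser (l j) (f + g)"
      using f g by (auto simp: fun_eq_iff qser_add)
    show "(\<lambda>z. (F z + G z) $ j) holomorphic_on UH" "moderate_growth (\<lambda>z. (F z + G z) $ j)"
      unfolding eq using fg l_range by (auto intro: qser_holomorphic qser_moderate_growth)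
  qed (use * in \<open>auto simp: vector_add_ldistrib matrix_vector_right_distrib\<close>)
qed

lemma sum_vvmf:
  assumes k: "multiplier_system k \<upsilon>" and "finite I" "\<And>i. i \<in> I \<Longrightarrow> F i \<in> vvmf k \<rho> \<upsilon>"
  shows "(\<lambda>z. \<Sum>i\<in>I. F i z) \<in> vvmf k \<rho> \<upsilon>"
  using assms(2,3)
proof (induction I rule: finite_induct)
  case empty
  thus ?case using zero_vvmf[OF k] by (simp add: zero_fun_def)
next
  case (insert i I)
  thus ?case using add_vvmf[OF k, of "F i" "\<lambda>z. \<Sum>i\<in>I. F i z"] by simp
qed

lemma autj_shift_nat:
  assumes "\<gamma> \<in> carrier SL2Z" "z \<in> UH"
  shows "autj (k + real n) \<upsilon> \<gamma> z * autf \<gamma> z ^ n = autj k \<upsilon> \<gamma> z"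
  using autj_shift[of k "int n" \<upsilon> \<gamma> z] autf_nz[OF assms] by (simp add: powr_minus powr_nat')

lemma modular_mult_vvmf:
  assumes k: "multiplier_system k \<upsilon>" and F: "F \<in> vvmf k \<rho> \<upsilon>" and f: "f \<in> modular_forms n"
  shows "(\<lambda>z. f z *s F z) \<in> vvmf (k + real n) \<rho> \<upsilon>"
proof -
  have k': "multiplier_system (k + real n) \<upsilon>" using multiplier_system_shift[OF k, of "int n"] by simp
  note * = F[unfolded vvmf_iff[OF k]]
  obtain g where g: "fconv g" "f = qser 0 g" using modular_form_qser[OF f] by blast
  have tr: "autj (k + real n) \<upsilon> \<gamma> z *s (f (mobius \<gamma> z) *s F (mobius \<gamma> z)) = \<rho> \<gamma> *v (f z *s F z)"
    if "\<gamma> \<in> carrier SL2Z" "z \<in> UH" for \<gamma> z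
  proof -
    have "f (mobius \<gamma> z) = autf \<gamma> z ^ n * f z" using f that unfolding modular_forms_def by blast
    hence "autj (k + real n) \<upsilon> \<gamma> z *s (f (mobius \<gamma> z) *s F (mobius \<gamma> z)) =
        (f z * (autj (k + real n) \<upsilon> \<gamma> z * autf \<gamma> z ^ n)) *s F (mobius \<gamma> z)"
      by (simp add: mult_ac)
    also have "\<dots> = f z *s (autj k \<upsilon> \<gamma> z *s F (mobius \<gamma> z))"
      unfolding autj_shift_nat[OF that] by simp
    also have "\<dots> = \<rho> \<gamma> *v (f z *s F z)"
      unfolding vvmf_transform[OF F that] by (simp add: vector_scalar_commute)
    finally show ?thesis .
  qed
  show ?thesis unfolding vvmf_iff[OF k']
  proof (intro conjI allI impI ballI)
    fix j
    obtain h where h: "fconv h" "(\<lambda>z. F z $ j) = qser (l j) h" using vvmf_qser[OF F k] by blast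
    have gh: "fconv (g * h)" by (intro fconv_intros g h)
    have eq: "(\<lambda>z. (f z *s F z) $ j) = qser (l j) (g * h)"
      using g h by (auto simp: fun_eq_iff qser_mult0)
    show "(\<lambda>z. (f z *s F z) $ j) holomorphic_on UH" "moderate_growth (\<lambda>z. (f z *s F z) $ j)"
      unfolding eq using gh l_range by (auto intro: qser_holomorphic qser_moderate_growth)
  next
    fix z assume z: "z \<in> UH"
    show "autj (k + real n) \<upsilon> matS z *s (f (- (1 / z)) *s F (- (1 / z))) = \<rho> matS *v (f z *s F z)"
      "autj (k + real n) \<upsilon> matT z *s (f (z + 1) *s F (z + 1)) = \<rho> matT *v (f z *s F z)"
      using tr[of matS z] tr[of matT z] z by (simp_all add: mobius_matS mobius_matT)
  qed (use * in auto)
qed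

lemma det2_transform:
  assumes "X \<in> vvmf k1 \<rho> \<upsilon>" "Y \<in> vvmf k2 \<rho> \<upsilon>" "\<gamma> \<in> carrier SL2Z" "z \<in> UH"
  shows "autj k1 \<upsilon> \<gamma> z * autj k2 \<upsilon> \<gamma> z * det2 X Y (mobius \<gamma> z) = det (\<rho> \<gamma>) * det2 X Y z"
proof -
  have X: "autj k1 \<upsilon> \<gamma> z * X (mobius \<gamma> z) $ j = \<rho> \<gamma> $ j $ 1 * X z $ 1 + \<rho> \<gamma> $ j $ 2 * X z $ 2" for j
    using arg_cong[OF vvmf_transform[OF assms(1,3,4)], of "\<lambda>v. v $ j"] by (simp add: mat2_mv_nth)
  have Y: "autj k2 \<upsilon> \<gamma> z * Y (mobius \<gamma> z) $ j = \<rho> \<gamma> $ j $ 1 * Y z $ 1 + \<rho> \<gamma> $ j $ 2 * Y z $ 2" for j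
    using arg_cong[OF vvmf_transform[OF assms(2,3,4)], of "\<lambda>v. v $ j"] by (simp add: mat2_mv_nth)
  have "autj k1 \<upsilon> \<gamma> z * autj k2 \<upsilon> \<gamma> z * det2 X Y (mobius \<gamma> z) =
      (autj k1 \<upsilon> \<gamma> z * X (mobius \<gamma> z) $ 1) * (autj k2 \<upsilon> \<gamma> z * Y (mobius \<gamma> z) $ 2) -
      (autj k1 \<upsilon> \<gamma> z * X (mobius \<gamma> z) $ 2) * (autj k2 \<upsilon> \<gamma> z * Y (mobius \<gamma> z) $ 1)"
    by (simp add: det2_def algebra_simps)
  also have "\<dots> = det (\<rho> \<gamma>) * det2 X Y z" unfolding X Y by (simp add: det2_def det_2 algebra_simps)
  finally show ?thesis .
qed

lemma det2_qser:
  assumes "X \<in> vvmf k1 \<rho> \<upsilon>" "multiplier_system k1 \<upsilon>" "Y \<in> vvmf k2 \<rho> \<upsilon>" "multiplier_system k2 \<upsilon>"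
  obtains h where "fconv h" "det2 X Y = qser (l 1 + l 2) h"
proof -
  obtain f1 where f1: "fconv f1" "(\<lambda>z. X z $ 1) = qser (l 1) f1" using vvmf_qser[OF assms(1,2)] by blast
  obtain f2 where f2: "fconv f2" "(\<lambda>z. X z $ 2) = qser (l 2) f2" using vvmf_qser[OF assms(1,2)] by blast
  obtain g1 where g1: "fconv g1" "(\<lambda>z. Y z $ 1) = qser (l 1) g1" using vvmf_qser[OF assms(3,4)] by blast
  obtain g2 where g2: "fconv g2" "(\<lambda>z. Y z $ 2) = qser (l 2) g2" using vvmf_qser[OF assms(3,4)] by blast
  note eqs = f1(2)[THEN fun_cong] f2(2)[THEN fun_cong] g1(2)[THEN fun_cong] g2(2)[THEN fun_cong]
  have c: "fconv (f1 * g2)" "fconv (g1 * f2)" by (intro fconv_intros f1 f2 g1 g2)+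
  have "det2 X Y z = qser (l 1 + l 2) (f1 * g2 - g1 * f2) z" for z
    unfolding qser_diff[OF c] qser_mult[OF f1(1) g2(1)] qser_mult[OF g1(1) f2(1)] det2_def
    by (simp add: eqs)
  moreover have "fconv (f1 * g2 - g1 * f2)" by (intro fconv_intros c)
  ultimately show ?thesis using that by blast
qed

end

locale vvmf2_fundamental = vvmf2 +
  fixes h :: "2 \<Rightarrow> complex fps" and F0 :: "complex \<Rightarrow> complex^2"
  assumes hconv: "\<And>j. fconv (h j)" and h0: "\<And>j. fps_nth (h j) 0 \<noteq> 0"
    and hsol: "\<And>j. ode_sol k0 c0 (qser (l j) (h j))"
    and F0_def: "F0 = (\<lambda>z. \<chi> j. qser (l j) (h j) z)"
    and F0: "F0 \<in> vvmf k0 \<rho> \<upsilon>"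
begin

lemma F0_nth [simp]: "F0 z $ j = qser (l j) (h j) z"
  by (simp add: F0_def)

abbreviation "DF0 \<equiv> modD_vec k0 F0"

abbreviation "W \<equiv> wronskian k0 (qser (l 1) (h 1)) (qser (l 2) (h 2))"

lemma DF0: "DF0 \<in> vvmf (k0 + 2) \<rho> \<upsilon>" and ms_k02: "multiplier_system (k0 + 2) \<upsilon>"
  using modD_vec_vvmf[OF F0 multiplier_k0] multiplier_system_shift[OF multiplier_k0, of 2] by simp_all

lemma W_det2: "W = det2 F0 DF0"
  by (simp add: fun_eq_iff wronskian_def det2_def modD_vec_def mult.commute)

lemma W_nonzero: "z \<in> UH \<Longrightarrow> W z \<noteq> 0"
proof -
  obtain w where w: "fconv w" "fps_nth w 0 \<noteq> 0" "W = qser (l 1 + l 2) w"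
    using ode_imp_qser_wronskian[of h, OF hconv h0] by auto
  obtain z0 where "z0 \<in> UH" "W z0 \<noteq> 0" using qser_nonzero_point[OF w(1,2)] w(3) by metis
  thus "z \<in> UH \<Longrightarrow> W z \<noteq> 0" using wronskian_nonzero[OF hsol hsol] by blast
qed

text \<open>Numerator and denominator acquire the same factor det (\<rho> \<gamma>) and the same
  square of \<upsilon>, so u has trivial multiplier and weight n. Both carry the exponent l1 + l2 at
  the cusp, where the leading coefficient of W is nonzero, so u is bounded there. The weight is an
  integer rather than a natural number because negative weights have to be excluded.\<close>

lemma quotient_form:
  fixes n :: int
  assumes X: "X \<in> vvmf k1 \<rho> \<upsilon>" "multiplier_system k1 \<upsilon>" and Y: "Y \<in> vvmf k2 \<rho> \<upsilon>" "multiplier_system k2 \<upsilon>"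
    and n: "k1 + k2 = 2 * k0 + 2 + of_int n"
  defines "u \<equiv> (\<lambda>z. if z \<in> UH then det2 X Y z / W z else 0)"
  shows "n < 0 \<or> odd n \<Longrightarrow> u = 0"
    and "n = int m \<Longrightarrow> u \<in> modular_forms m"
proof -
  obtain w where w: "fconv w" "fps_nth w 0 \<noteq> 0" "W = qser (l 1 + l 2) w"
    using ode_imp_qser_wronskian[of h, OF hconv h0] by auto
  obtain g where g: "fconv g" "det2 X Y = qser (l 1 + l 2) g" by (rule det2_qser[OF X Y])
  have hol: "u holomorphic_on UH"
  proof -
    have "(\<lambda>z. det2 X Y z / W z) holomorphic_on UH"
      by (intro holomorphic_on_divide W_nonzero) (simp_all add: g w qser_holomorphic)
    thus ?thesis by (rule holomorphic_transform) (simp add: u_def)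
  qed
  have tr: "u (mobius \<gamma> z) = autf \<gamma> z powr of_int n * u z" if gz: "\<gamma> \<in> carrier SL2Z" "z \<in> UH" for \<gamma> z
  proof -
    define v where "v = inverse (\<upsilon> \<gamma>)"
    define p where "p = autf \<gamma> z"
    have nz: "v \<noteq> 0" "p \<noteq> 0" using upsilon_nz[OF ms gz(1)] autf_nz[OF gz] by (simp_all add: v_def p_def)
    have d: "det (\<rho> \<gamma>) \<noteq> 0" using rho_invertible[OF gz(1)] invertible_det_nz by blast
    have "v * v * p powr (- of_real (k1 + k2)) * det2 X Y (mobius \<gamma> z) = det (\<rho> \<gamma>) * det2 X Y z"
      using det2_transform[OF X(1) Y(1) gz] by (simp add: autj_def v_def p_def powr_add powr_diff powr_minus divide_inverse mult_ac)
    hence 1: "det2 X Y (mobius \<gamma> z) = det (\<rho> \<gamma>) * det2 X Y z / (v * v * p powr (- of_real (k1 + k2)))"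
      using nz by (simp add: field_simps)
    have "v * v * p powr (- of_real (2 * k0 + 2)) * W (mobius \<gamma> z) = det (\<rho> \<gamma>) * W z"
    proof -
      have "p powr (- of_real (2 * k0 + 2)) = p powr (- of_real k0) * p powr (- of_real (k0 + 2))"
        unfolding powr_add[symmetric] by (simp add: algebra_simps)
      thus ?thesis using det2_transform[OF F0 DF0 gz] unfolding W_det2 autj_def v_def[symmetric] p_def[symmetric]
        by (simp only: mult_ac)
    qed
    hence 2: "W (mobius \<gamma> z) = det (\<rho> \<gamma>) * W z / (v * v * p powr (- of_real (2 * k0 + 2)))"
      using nz by (simp add: field_simps)
    have "p powr of_int n = p powr (- of_real (2 * k0 + 2) - - of_real (k1 + k2))"
      by (simp add: n)
    hence 3: "p powr of_int n = p powr (- of_real (2 * k0 + 2)) / p powr (- of_real (k1 + k2))"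
      by (simp only: powr_diff)
    have "x * y / (v * v * b) / (x * y' / (v * v * a)) = a / b * (y / y')"
      if "x \<noteq> 0" "a \<noteq> 0" "b \<noteq> 0" for x y y' a b :: complex
      using nz that by (cases "y' = 0") (simp_all add: field_simps)
    from this[OF d] show ?thesis
      using gz mobius_UH[OF gz] nz unfolding u_def 1 2 3 p_def[symmetric] by simp
  qed
  obtain B y0 where B: "\<And>z. Im z \<ge> y0 \<Longrightarrow> norm (det2 X Y z / W z) \<le> B"
    using qser_quotient_bounded[OF g(1) w(1,2), of "l 1 + l 2"] unfolding g(2) w(3) by blast
  have bound: "norm (u z) \<le> max B 0" if "Im z \<ge> y0" for z
    using B[OF that] by (auto simp: u_def)
  have out: "u z = 0" if "z \<notin> UH" for z using that by (simp add: u_def)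
  show "u = 0" if "n < 0 \<or> odd n"
  proof -
    have "u z = 0" if z: "z \<in> UH" for z
    proof (cases "n < 0")
      case True
      show ?thesis
      proof (rule negative_weight_zero[where h = u and s = "- of_int n" and Y = y0 and B = "max B 0"])
        show "norm (u (- (1 / z))) = norm z powr - (- of_int n) * norm (u z)" if "z \<in> UH" for z
        proof -
          have "norm (z powr of_int n) = norm z powr of_int n"
            using norm_powr_real_powr'[of "of_int n" z] by simp
          thus ?thesis using tr[of matS z] that by (simp add: mobius_matS norm_mult)
        qed
        show "norm (u (z + 1)) = norm (u z)" if "z \<in> UH" for z
          using tr[of matT z] that by (simp add: mobius_matT)
      qed (use True hol z bound in auto)
    next
      case False
      \<comment> \<open>The matrix -1 fixes every point and multiplies u by (-1)^n.\<close>
      hence "odd n" "n \<ge> 0" using that \<open>n < 0 \<or> odd n\<close> by auto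
      hence "(-1 :: complex) powr of_int n = -1"
        using powr_nat'[of "-1" "nat n"] by (simp add: even_nat_iff)
      hence "u z = - u z" using tr[of neg1 z] z by simp
      thus ?thesis by simp
    qed
    thus ?thesis using out by (auto simp: fun_eq_iff)
  qed
  show "u \<in> modular_forms m" if m: "n = int m"
  proof -
    have "u (mobius \<gamma> z) = autf \<gamma> z ^ m * u z" if "\<gamma> \<in> carrier SL2Z" "z \<in> UH" for \<gamma> z
      using tr[OF that] autf_nz[OF that] by (simp add: m powr_nat')
    moreover have "\<exists>B Y. \<forall>z. Im z \<ge> Y \<longrightarrow> norm (u z) \<le> B" using bound by blast
    ultimately show ?thesis using hol out unfolding modular_forms_def by blast
  qed
qed

definition alpha :: "(complex \<Rightarrow> complex^2) \<Rightarrow> complex \<Rightarrow> complex" where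
  "alpha G z = (if z \<in> UH then det2 G DF0 z / W z else 0)"

definition beta :: "(complex \<Rightarrow> complex^2) \<Rightarrow> complex \<Rightarrow> complex" where
  "beta G z = (if z \<in> UH then det2 F0 G z / W z else 0)"

lemma decompose:
  assumes "\<And>z. z \<notin> UH \<Longrightarrow> G z = 0"
  shows "G z = alpha G z *s F0 z + beta G z *s DF0 z"
proof (cases "z \<in> UH")
  case True
  have W: "det2 F0 DF0 z \<noteq> 0" using W_nonzero[OF True] by (simp add: W_det2)
  have "det2 F0 DF0 z * G z $ j = det2 G DF0 z * F0 z $ j + det2 F0 G z * DF0 z $ j" for j
    using exhaust_2[of j] by (auto simp: det2_def algebra_simps)
  hence "G z $ j = det2 G DF0 z / det2 F0 DF0 z * F0 z $ j + det2 F0 G z / det2 F0 DF0 z * DF0 z $ j" for j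
    using W by (simp add: field_simps)
  thus ?thesis using True by (simp add: vec_eq_iff alpha_def beta_def W_det2)
qed (use assms in \<open>simp add: alpha_def beta_def\<close>)

lemma alpha_beta:
  fixes n :: int
  assumes G: "G \<in> vvmf (k0 + of_int n) \<rho> \<upsilon>"
  shows "n < 0 \<or> odd n \<Longrightarrow> alpha G = 0" "n < 2 \<or> odd n \<Longrightarrow> beta G = 0"
    "n = int m \<Longrightarrow> alpha G \<in> modular_forms m" "n = int m + 2 \<Longrightarrow> beta G \<in> modular_forms m"
proof -
  have k: "multiplier_system (k0 + of_int n) \<upsilon>" by (rule multiplier_system_shift[OF multiplier_k0])
  have n1: "k0 + of_int n + (k0 + 2) = 2 * k0 + 2 + of_int n"
    and n2: "k0 + (k0 + of_int n) = 2 * k0 + 2 + of_int (n - 2)" by simp_all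
  have "alpha G = (\<lambda>z. if z \<in> UH then det2 G DF0 z / W z else 0)"
    and "beta G = (\<lambda>z. if z \<in> UH then det2 F0 G z / W z else 0)"
    by (simp_all add: fun_eq_iff alpha_def beta_def)
  note a = quotient_form[OF G k DF0 ms_k02 n1, folded this] and b = quotient_form[OF F0 multiplier_k0 G k n2, folded this]
  show "n < 0 \<or> odd n \<Longrightarrow> alpha G = 0" by (rule a(1))
  show "n = int m \<Longrightarrow> alpha G \<in> modular_forms m" by (rule a(2))
  show "n < 2 \<or> odd n \<Longrightarrow> beta G = 0" by (rule b(1)) auto
  show "n = int m + 2 \<Longrightarrow> beta G \<in> modular_forms m" by (rule b(2)) simp
qed

text \<open>In such a weight both coefficients of the decomposition vanish. This yields the
  minimality of \<open>k0\<close> as well as the grading in steps of 2.\<close>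

lemma vvmf_zero_off_grading:
  assumes "multiplier_system k \<upsilon>" "G \<in> vvmf k \<rho> \<upsilon>" "\<nexists>m. k = k0 + 2 * real m"
  shows "G = 0"
proof -
  have "k - k0 \<in> \<int>" using assms(1) weights_iff by (simp add: multiplier_weights_def)
  then obtain n where "k - k0 = of_int n" by (auto elim: Ints_cases)
  hence k: "k = k0 + of_int n" by simp
  have n: "n < 0 \<or> odd n"
  proof (rule ccontr)
    assume "\<not> (n < 0 \<or> odd n)"
    then obtain m where "n = 2 * m" "m \<ge> 0" by (auto elim: evenE)
    hence "k = k0 + 2 * real (nat m)" by (simp add: k)
    with assms(3) show False by blast
  qed
  have G: "G \<in> vvmf (k0 + of_int n) \<rho> \<upsilon>" using assms(2) k by simp
  have "G z = alpha G z *s F0 z + beta G z *s DF0 z" for z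
    using assms(2) by (intro decompose) (simp add: vvmf_def)
  moreover have "alpha G = 0" "beta G = 0" using alpha_beta[OF G] n by auto
  ultimately show ?thesis by (simp add: fun_eq_iff)
qed

end

section \<open>Cyclicity\<close>

lemma modD_zero: "modD k (\<lambda>_. 0) = (\<lambda>_. 0)"
  by (simp add: modD_def fun_eq_iff)

lemma modD_vec_zero: "modD_vec k 0 = 0"
  by (simp add: modD_vec_def modD_zero fun_eq_iff vec_eq_iff)

lemma Dgr_in_weight: "Dgr (in_weight k F) = in_weight (k + 2) (modD_vec k F)"
  by (auto simp: Dgr_def in_weight_def fun_eq_iff modD_vec_zero[unfolded zero_fun_def] zero_fun_def)

primrec modD_vec_pow :: "real \<Rightarrow> nat \<Rightarrow> (complex \<Rightarrow> complex^2) \<Rightarrow> complex \<Rightarrow> complex^2" where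
  "modD_vec_pow k 0 F = F"
| "modD_vec_pow k (Suc n) F = modD_vec (k + 2 * real n) (modD_vec_pow k n F)"

lemma Dgr_pow_in_weight: "(Dgr ^^ n) (in_weight k F) = in_weight (k + 2 * real n) (modD_vec_pow k n F)"
  by (induction n) (simp_all add: Dgr_in_weight add_ac)

lemma MF_act_in_weight:
  assumes "f \<in> MF"
  shows "MF_act f (in_weight k F) (k + 2 * real i) z = f i z *s F z"
    and "\<nexists>i. w = k + 2 * real i \<Longrightarrow> MF_act f (in_weight k F) w z = 0"
proof -
  have fin: "finite {i. f i \<noteq> 0}" using assms by (simp add: MF_def)
  have "MF_act f (in_weight k F) (k + 2 * real i) z = (\<Sum>j | f j \<noteq> 0. if j = i then f i z *s F z else 0)"
    unfolding MF_act_def by (intro sum.cong) (auto simp: in_weight_def)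
  also have "\<dots> = f i z *s F z" using fin by (auto simp: sum.delta)
  finally show "MF_act f (in_weight k F) (k + 2 * real i) z = f i z *s F z" .
  assume "\<nexists>i. w = k + 2 * real i"
  hence "w - 2 * real j \<noteq> k" for j by (metis diff_add_cancel)
  thus "MF_act f (in_weight k F) w z = 0" unfolding MF_act_def by (simp add: in_weight_def)
qed

lemma MF_act_zero: "MF_act 0 F w z = 0"
  by (simp add: MF_act_def)

context vvmf2_fundamental
begin

abbreviation "weights \<equiv> {k0 + 2 * real n | n. True}"

lemma weights_multiplier: "k \<in> weights \<Longrightarrow> multiplier_system k \<upsilon>"
  using multiplier_system_shift[OF multiplier_k0, of "2 * int _"] by auto

lemma F0_nonzero: "F0 \<noteq> 0"
proof -
  obtain z where "z \<in> UH" "qser (l 1) (h 1) z \<noteq> 0" using qser_nonzero_point[OF hconv h0] by blast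
  hence "F0 z $ 1 \<noteq> 0 $ 1" by simp
  thus ?thesis by (metis zero_fun_apply)
qed

lemma minimal: "minimal_weight \<rho> \<upsilon> k0"
  unfolding minimal_weight_def
proof (intro conjI ballI impI)
  show "k0 \<in> multiplier_weights \<upsilon>" using multiplier_k0 by (simp add: multiplier_weights_def)
  show "vvmf k0 \<rho> \<upsilon> \<noteq> {0}" using F0 F0_nonzero by blast
  fix k assume k: "k \<in> multiplier_weights \<upsilon>" "vvmf k \<rho> \<upsilon> \<noteq> {0}"
  hence m: "multiplier_system k \<upsilon>" by (simp add: multiplier_weights_def)
  then obtain G where "G \<in> vvmf k \<rho> \<upsilon>" "G \<noteq> 0" using k(2) zero_vvmf by blast
  with vvmf_zero_off_grading[OF m] obtain n where "k = k0 + 2 * real n" by blast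
  thus "k0 \<le> k" by simp
qed

lemma graded_eq: "vvmf_graded \<rho> \<upsilon> = vvmf_sum weights \<rho> \<upsilon>"
proof -
  have sub: "k \<in> weights \<Longrightarrow> k \<in> multiplier_weights \<upsilon>" for k
    using weights_multiplier by (simp add: multiplier_weights_def)
  show ?thesis
  proof (intro Set.set_eqI iffI)
    fix F assume F: "F \<in> vvmf_graded \<rho> \<upsilon>"
    have "F k = 0" if "k \<notin> weights" for k
      using F that vvmf_zero_off_grading[of k "F k"]
      by (cases "k \<in> multiplier_weights \<upsilon>") (auto simp: vvmf_graded_def vvmf_sum_def multiplier_weights_def)
    thus "F \<in> vvmf_sum weights \<rho> \<upsilon>" using F sub by (auto simp: vvmf_graded_def vvmf_sum_def)
  next
    fix F assume F: "F \<in> vvmf_sum weights \<rho> \<upsilon>"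
    have "F k \<in> vvmf k \<rho> \<upsilon>" if "k \<in> multiplier_weights \<upsilon>" for k
      using F that zero_vvmf[of k] by (cases "k \<in> weights") (auto simp: vvmf_sum_def multiplier_weights_def)
    moreover have "F k = 0" if "k \<notin> multiplier_weights \<upsilon>" for k
      using F sub that unfolding vvmf_sum_def by blast
    ultimately show "F \<in> vvmf_graded \<rho> \<upsilon>" using F by (auto simp: vvmf_graded_def vvmf_sum_def)
  qed
qed

lemma modD_vec_pow_vvmf: "modD_vec_pow k0 n F0 \<in> vvmf (k0 + 2 * real n) \<rho> \<upsilon>"
proof (induction n)
  case (Suc n)
  have "multiplier_system (k0 + 2 * real n) \<upsilon>" by (rule weights_multiplier) blast
  from modD_vec_vvmf[OF Suc this] show ?case by (simp add: algebra_simps)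
qed (use F0 in simp)

lemma orbit_subset: "skew_orbit (in_weight k0 F0) \<subseteq> vvmf_sum weights \<rho> \<upsilon>"
proof
  fix G assume "G \<in> skew_orbit (in_weight k0 F0)"
  then obtain s where s: "finite {n. s n \<noteq> 0}" "\<And>n. s n \<in> MF" "G = skew_act s (in_weight k0 F0)"
    by (auto simp: skew_orbit_def skew_ring_def)
  define D where "D n = modD_vec_pow k0 n F0" for n
  have G: "G w z = (\<Sum>n | s n \<noteq> 0. MF_act (s n) (in_weight (k0 + 2 * real n) (D n)) w z)" for w z
    unfolding s(3) skew_act_def Dgr_pow_in_weight D_def ..
  have off: "MF_act (s n) (in_weight (k0 + 2 * real n) (D n)) w z = 0" if "w \<notin> weights" for n w z
  proof (rule MF_act_in_weight(2)[OF s(2)])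
    show "\<nexists>i. w = k0 + 2 * real n + 2 * real i"
    proof
      assume "\<exists>i. w = k0 + 2 * real n + 2 * real i"
      then obtain i where "w = k0 + 2 * real (n + i)" by (auto simp: algebra_simps)
      with that show False by blast
    qed
  qed
  have vv: "MF_act (s n) (in_weight (k0 + 2 * real n) (D n)) w \<in> vvmf w \<rho> \<upsilon>" if w: "w \<in> weights" for n w
  proof (cases "\<exists>i. w = k0 + 2 * real n + 2 * real i")
    case True
    then obtain i where i: "w = k0 + 2 * real n + 2 * real i" by blast
    have "multiplier_system (k0 + 2 * real n) \<upsilon>" by (rule weights_multiplier) blast
    moreover have "s n i \<in> modular_forms (2 * i)" using s(2) by (auto simp: MF_def)
    ultimately have "(\<lambda>z. s n i z *s D n z) \<in> vvmf (k0 + 2 * real n + real (2 * i)) \<rho> \<upsilon>"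
      unfolding D_def by (intro modular_mult_vvmf modD_vec_pow_vvmf)
    moreover have "MF_act (s n) (in_weight (k0 + 2 * real n) (D n)) w = (\<lambda>z. s n i z *s D n z)"
      unfolding i by (rule ext, rule MF_act_in_weight(1)[OF s(2)])
    ultimately show ?thesis by (simp add: i)
  next
    case False
    hence "MF_act (s n) (in_weight (k0 + 2 * real n) (D n)) w = 0"
      by (intro ext) (simp add: MF_act_in_weight(2)[OF s(2) False])
    thus ?thesis using zero_vvmf[OF weights_multiplier[OF w]] by simp
  qed
  \<comment> \<open>A coefficient of weight 2i in front of the n-th power of d contributes only to
    the weight k0 + 2n + 2i, and there are finitely many such pairs.\<close>
  have "{w. G w \<noteq> 0} \<subseteq> (\<lambda>(n, i). k0 + 2 * real n + 2 * real i) ` (SIGMA n:{n. s n \<noteq> 0}. {i. s n i \<noteq> 0})"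
  proof
    fix w assume "w \<in> {w. G w \<noteq> 0}"
    then obtain z where "G w z \<noteq> 0" by (auto simp: fun_eq_iff)
    then obtain n where n: "s n \<noteq> 0" "MF_act (s n) (in_weight (k0 + 2 * real n) (D n)) w z \<noteq> 0"
      unfolding G by (metis (mono_tags, lifting) mem_Collect_eq sum.neutral)
    then obtain i where i: "w = k0 + 2 * real n + 2 * real i"
      using MF_act_in_weight(2)[OF s(2)] by blast
    have "s n i \<noteq> 0"
    proof
      assume "s n i = 0"
      thus False using n(2) MF_act_in_weight(1)[OF s(2), of n "k0 + 2 * real n" "D n" i z] by (simp add: i)
    qed
    thus "w \<in> (\<lambda>(n, i). k0 + 2 * real n + 2 * real i) ` (SIGMA n:{n. s n \<noteq> 0}. {i. s n i \<noteq> 0})"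
      using n(1) i by (intro image_eqI[of _ _ "(n, i)"]) auto
  qed
  moreover have "finite (SIGMA n:{n. s n \<noteq> 0}. {i. s n i \<noteq> 0})"
    using s by (intro finite_SigmaI) (auto simp: MF_def)
  ultimately have "finite {w. G w \<noteq> 0}" by (meson finite_imageI finite_subset)
  moreover have "G w \<in> vvmf w \<rho> \<upsilon>" if "w \<in> weights" for w
  proof -
    have "(\<lambda>z. \<Sum>n | s n \<noteq> 0. MF_act (s n) (in_weight (k0 + 2 * real n) (D n)) w z) \<in> vvmf w \<rho> \<upsilon>"
      using that s(1) vv by (intro sum_vvmf weights_multiplier) auto
    thus ?thesis unfolding G[symmetric] .
  qed
  moreover have "G w = 0" if "w \<notin> weights" for w using off[OF that] by (simp add: fun_eq_iff G)
  ultimately show "G \<in> vvmf_sum weights \<rho> \<upsilon>" unfolding vvmf_sum_def by blast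
qed

lemma subset_orbit: "vvmf_sum weights \<rho> \<upsilon> \<subseteq> skew_orbit (in_weight k0 F0)"
proof
  fix G assume G: "G \<in> vvmf_sum weights \<rho> \<upsilon>"
  have Gw: "G (k0 + 2 * real i) \<in> vvmf (k0 + of_int (int (2 * i))) \<rho> \<upsilon>" for i
    using G by (auto simp: vvmf_sum_def)
  \<comment> \<open>The ring element is alpha + beta d, assembled weight by weight. As d raises the
    weight by 2, the component of beta in weight 2i is taken from G in weight k0 + 2i + 2, hence the
    \<open>Suc i\<close>.\<close>
  define s :: skew where "s n = (if n = 0 then (\<lambda>i. alpha (G (k0 + 2 * real i)))
     else if n = 1 then (\<lambda>i. beta (G (k0 + 2 * real (Suc i)))) else 0)" for n
  have fin: "finite {i. G (k0 + 2 * real (i + j)) \<noteq> 0}" for j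
  proof -
    have "finite {w. G w \<noteq> 0}" using G by (simp add: vvmf_sum_def)
    hence "finite ((\<lambda>i. k0 + 2 * real (i + j)) -` {w. G w \<noteq> 0})"
      by (rule finite_vimageI) (auto simp: inj_def)
    thus ?thesis by (simp add: vimage_def)
  qed
  have a0: "alpha 0 = 0" and b0: "beta 0 = 0" by (simp_all add: fun_eq_iff alpha_def beta_def det2_def)
  have s0: "s 0 \<in> MF"
  proof -
    have "finite {i. s 0 i \<noteq> 0}"
      by (rule finite_subset[OF _ fin[of 0]]) (auto simp: s_def a0)
    moreover have "s 0 i \<in> modular_forms (2 * i)" for i
      using alpha_beta(3)[OF Gw[of i] refl] by (simp add: s_def)
    ultimately show ?thesis by (simp add: MF_def)
  qed
  have s1: "s 1 \<in> MF"
  proof -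
    have "finite {i. s 1 i \<noteq> 0}"
      by (rule finite_subset[OF _ fin[of 1]]) (auto simp: s_def b0)
    moreover have "s 1 i \<in> modular_forms (2 * i)" for i
      using alpha_beta(4)[OF Gw[of "Suc i"], of "2 * i"] by (simp add: s_def)
    ultimately show ?thesis by (simp add: MF_def)
  qed
  have s2: "s n = 0" if "n \<noteq> 0" "n \<noteq> 1" for n using that by (simp add: s_def)
  have MF0: "0 \<in> MF" by (simp add: MF_def zero_modular_form)
  have supp: "{n. s n \<noteq> 0} \<subseteq> {0, 1}" using s2 by blast
  hence "finite {n. s n \<noteq> 0}" by (rule finite_subset) simp
  moreover have "s n \<in> MF" for n using s0 s1 s2 MF0 by metis
  ultimately have carrier: "s \<in> carrier skew_ring" by (simp add: skew_ring_def)
  have act: "skew_act s (in_weight k0 F0) w z =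
      MF_act (s 0) (in_weight k0 F0) w z + MF_act (s 1) (in_weight (k0 + 2) DF0) w z" for w z
  proof -
    have "skew_act s (in_weight k0 F0) w z = (\<Sum>n\<in>{0, 1}. MF_act (s n) ((Dgr ^^ n) (in_weight k0 F0)) w z)"
      unfolding skew_act_def using supp by (intro sum.mono_neutral_left) (auto simp: MF_act_zero)
    thus ?thesis by (simp add: Dgr_in_weight)
  qed
  have "G w z = skew_act s (in_weight k0 F0) w z" for w z
  proof (cases "w \<in> weights")
    case False
    have n: "\<nexists>i. w = k0 + 2 * real i" "\<nexists>i. w = k0 + 2 + 2 * real i"
    proof -
      show "\<nexists>i. w = k0 + 2 * real i" using False by blast
      show "\<nexists>i. w = k0 + 2 + 2 * real i"
      proof
        assume "\<exists>i. w = k0 + 2 + 2 * real i"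
        then obtain i where "w = k0 + 2 * real (Suc i)" by (auto simp: algebra_simps)
        with False show False by blast
      qed
    qed
    have "G w = 0" using G False by (simp add: vvmf_sum_def)
    thus ?thesis unfolding act MF_act_in_weight(2)[OF s0 n(1)] MF_act_in_weight(2)[OF s1 n(2)] by simp
  next
    case True
    then obtain i where w: "w = k0 + 2 * real i" by blast
    have dec: "G w z = alpha (G w) z *s F0 z + beta (G w) z *s DF0 z"
      by (rule decompose) (use Gw[of i] in \<open>simp add: w vvmf_def\<close>)
    have 1: "MF_act (s 0) (in_weight k0 F0) w z = alpha (G w) z *s F0 z"
      unfolding w MF_act_in_weight(1)[OF s0] by (simp add: s_def)
    have 2: "MF_act (s 1) (in_weight (k0 + 2) DF0) w z = beta (G w) z *s DF0 z"
    proof (cases i)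
      \<comment> \<open>In weight k0 the summand with d cannot occur, in accordance with beta, which
        would have weight -2 and vanishes.\<close>
      case 0
      have "beta (G w) = 0" using alpha_beta(2)[OF Gw[of 0]] by (simp add: w 0)
      moreover have n: "\<nexists>j. w = k0 + 2 + 2 * real j" by (auto simp: w 0)
      ultimately show ?thesis unfolding MF_act_in_weight(2)[OF s1 n] by simp
    next
      case (Suc j)
      have w': "w = k0 + 2 + 2 * real j" by (simp add: w Suc)
      show ?thesis unfolding w' MF_act_in_weight(1)[OF s1] by (simp add: s_def algebra_simps)
    qed
    show ?thesis unfolding act 1 2 by (rule dec)
  qed
  hence "G = skew_act s (in_weight k0 F0)" by (simp add: fun_eq_iff)
  with carrier show "G \<in> skew_orbit (in_weight k0 F0)" by (auto simp: skew_orbit_def)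
qed

lemma mmde_fundamental:
  "\<exists>M. mmde_coeffs 2 M \<and> fundamental_system k0 2 M (\<lambda>j z. F0 z $ j)"
proof (intro exI conjI)
  \<comment> \<open>For an equation of order two the index j = 2 is the only one in the range of the
    coefficients, so a constant family describes it.\<close>
  let ?M = "\<lambda>_::nat. \<lambda>z. c0 * E4 z"
  show "mmde_coeffs 2 ?M" using E4_modular[of c0] by (simp add: mmde_coeffs_def)
  define f where "f j = qser (l j) (h j)" for j
  have sol: "ode_sol k0 c0 (f j)" for j unfolding f_def by (rule hsol)
  have hol: "f j holomorphic_on UH" for j unfolding f_def by (rule qser_holomorphic[OF hconv])
  have i: "\<i> \<in> UH" by (simp add: UH_def)
  have W: "wronskian k0 (f 1) (f 2) \<i> \<noteq> 0" unfolding f_def by (rule W_nonzero[OF i])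
  have indep: "a = 0 \<and> b = 0" if "\<And>z. z \<in> UH \<Longrightarrow> a * f 1 z + b * f 2 z = 0" for a b
    by (rule wronskian_independent[OF hol hol i W that])
  have ne: "f 1 \<noteq> f 2" using indep[of 1 "-1"] by auto
  have range: "range f = {f 1, f 2}" unfolding UNIV_2 by simp
  have out: "f j z = 0" if "z \<notin> UH" for j z using that by (simp add: f_def qser_def)
  have sols: "g \<in> mmde_solutions k0 2 ?M \<longleftrightarrow> (\<forall>z. z \<notin> UH \<longrightarrow> g z = 0) \<and> ode_sol k0 c0 g" for g
    by (simp add: mmde_solutions_def ode_sol_def numeral_2_eq_2)
  have "inj f" unfolding inj_def using ne exhaust_2 by metis
  moreover have "cfun.independent (range f)"
  proof
    assume "cfun.dependent (range f)"
    then obtain u v where u: "v \<in> {f 1, f 2}" "u v \<noteq> 0" "(\<Sum>v\<in>{f 1, f 2}. (\<lambda>z. u v * v z)) = 0"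
      unfolding range by (subst (asm) cfun.dependent_finite) auto
    have "u (f 1) * f 1 z + u (f 2) * f 2 z = 0" for z
      using fun_cong[OF u(3), of z] ne by simp
    from indep[OF this] u(1,2) show False by auto
  qed
  moreover have "cfun.span (range f) = mmde_solutions k0 2 ?M"
  proof -
    have sp: "cfun.span (range f) = {\<lambda>z. a * f 1 z + b * f 2 z | a b. True}"
      unfolding range
      by (auto simp: cfun.span_insert cfun.span_singleton fun_eq_iff algebra_simps) 
    show ?thesis
    proof (intro Set.set_eqI iffI)
      fix g assume "g \<in> cfun.span (range f)"
      then obtain a b where "g = (\<lambda>z. a * f 1 z + b * f 2 z)" unfolding sp by blast
      thus "g \<in> mmde_solutions k0 2 ?M" unfolding sols using ode_sol_lin2[OF sol sol] out by simp
    next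
      fix g assume g: "g \<in> mmde_solutions k0 2 ?M"
      obtain a b where ab: "\<And>z. z \<in> UH \<Longrightarrow> g z = a * f 1 z + b * f 2 z"
        by (rule ode_sol_span[OF sol[of 1] sol[of 2] _ i W, of g]) (use g sols in blast)+
      have "g z = a * f 1 z + b * f 2 z" for z
        using ab g out unfolding sols by (cases "z \<in> UH") auto
      thus "g \<in> cfun.span (range f)" unfolding sp by (auto simp: fun_eq_iff)
    qed
  qed
  moreover have "has_q_expansion (f j)" for j
    unfolding has_q_expansion_def
  proof (intro exI ballI conjI)
    fix z assume z: "z \<in> UH"
    show "summable (\<lambda>n. fps_nth (h j) n * qexp 1 z ^ n)"
      by (intro summable_fps fconvD hconv norm_qexp_less_1 z)
    show "f j z = qexp (l j) z * (\<Sum>n. fps_nth (h j) n * qexp 1 z ^ n)"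
      using z by (simp add: f_def qser_def eval_fps_def)
  qed
  ultimately have "fundamental_system k0 2 ?M f" unfolding fundamental_system_def by blast
  moreover have "(\<lambda>j z. F0 z $ j) = f" by (simp add: fun_eq_iff f_def)
  ultimately show "fundamental_system k0 2 ?M (\<lambda>j z. F0 z $ j)" by simp
qed

end

theorem theorem3p1:
  fixes \<rho> :: "int^2^2 \<Rightarrow> complex^2^2"
    and \<upsilon> :: "int^2^2 \<Rightarrow> complex"
    and r l :: "2 \<Rightarrow> real"
    and k0 :: real
  assumes "irreducible_rep \<rho>"
    and "rep_exponents \<rho> r"
    and "\<exists>k. multiplier_system k \<upsilon>"
    and "minimal_admissible \<upsilon> r l"
    and "k0 = 6 * (l 1 + l 2) - 1"
  shows "minimal_weight \<rho> \<upsilon> k0 \<and>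
    vvmf_graded \<rho> \<upsilon> = vvmf_sum {k0 + 2 * real n | n. True} \<rho> \<upsilon> \<and>
    (\<exists>F0\<in>vvmf k0 \<rho> \<upsilon>.
       vvmf_graded \<rho> \<upsilon> = skew_orbit (in_weight k0 F0) \<and>
       (\<exists>M. mmde_coeffs 2 M \<and> fundamental_system k0 2 M (\<lambda>j z. F0 z $ j)))"
proof -
  obtain kw where "multiplier_system kw \<upsilon>" using assms(3) by blast
  then interpret V: vvmf2 \<rho> \<upsilon> r l kw by unfold_locales (use assms in auto)
  have k0: "k0 = V.k0" using assms(5) by (simp add: V.k0_def)
  obtain h :: "2 \<Rightarrow> complex fps" where h: "\<And>j. fconv (h j)" "\<And>j. fps_nth (h j) 0 \<noteq> 0"
    "\<And>j. ode_sol V.k0 V.c0 (qser (l j) (h j))" "(\<lambda>z. \<chi> j. qser (l j) (h j) z) \<in> vvmf V.k0 \<rho> \<upsilon>"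
    using V.fundamental_vvmf by blast
  interpret F: vvmf2_fundamental \<rho> \<upsilon> r l kw h "\<lambda>z. \<chi> j. qser (l j) (h j) z"
    by unfold_locales (use h in auto)
  have "vvmf_graded \<rho> \<upsilon> = skew_orbit (in_weight V.k0 (\<lambda>z. \<chi> j. qser (l j) (h j) z))"
    unfolding F.graded_eq using F.orbit_subset F.subset_orbit by blast
  with F.minimal F.graded_eq F.F0 F.mmde_fundamental show ?thesis unfolding k0 by blast
qed

end
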